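(* Let $k$ be a field, $Q$ a finite quiver, $\underline{\mathbf d}=(\underline d^0,\dots,\underline d^\nu)$ a filtration and $M\in\mathrm{Rep}_Q(\underline d^\nu)(k)$. Let $\mathbf U=(U^0,U^1,\dots,U^\nu)\in\mathrm{Fl}_Q(\underline{\mathbf d},M)(K)$ for a field extension $K$ of $k$. Then $$T_{\mathbf U}\mathrm{Fl}_Q(\underline{\mathbf d},M)\cong\operatorname{Hom}_{\Lambda\otimes_kK}\bigl(\mathbf U,(\mathbf M\otimes_kK)/\mathbf U\bigr),$$ where $\Lambda=(kQ)A_{\nu+1}$ and $\mathbf M=(M=M=\dots=M)$ is regarded as a $\Lambda$-module.
   Context: A quiver $Q=(Q_0,Q_1,s,t)$ is a finite directed graph. A filtration is a sequence $\underline{\mathbf d}=(\underline d^0,\dots,\underline d^\nu)$ of dimension vectors in $\mathbb ZQ_0$ with $\underline d^0=0$ and $\underline d^l\le\underline d^{l+1}$. $\mathrm{Rep}_Q(\underline d)(R)=\prod_{\alpha:i\to j\in Q_1}\operatorname{Hom}_R(R^{d_i},R^{d_j})$. $\mathrm{Fl}_Q(\underline{\mathbf d},M)$ is the $k$-scheme whose $R$-points ($R$ a commutative $k$-algebra) are the sequences $(U^0\subset\dots\subset U^\nu)$ of subrepresentations of $M\otimes_kR$ such that $U^l_i$ is a direct summand of $R^{d^\nu_i}$ of rank $d^l_i$ for all $i\in Q_0$. $A_{\nu+1}$ is the quiver $0\to1\to\dots\to\nu$. $(kQ)A_{\nu+1}$ is its path algebra with coefficients in the path algebra $kQ$; its modules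 are sequences $M^0\to\dots\to M^\nu$ of $kQ$-modules with commutative ladders as morphisms. The flag $\mathbf U$ is regarded as the submodule $U^0\hookrightarrow\dots\hookrightarrow U^\nu$ of $\mathbf M\otimes_kK$, where the structure maps of $\mathbf M$ are identities. For a $K$-valued point $x$ of a $k$-scheme $X$, $T_xX$ is the $K$-vector space given by the fibre over $x$ of $X(K[\varepsilon])\to X(K)$, $\varepsilon^2=0$, $\varepsilon\mapsto0$. *)

theory Defs
  imports "Jordan_Normal_Form.VS_Connect" "Graph_Theory.Arc_Walk" "HOL-Algebra.QuotRing"
begin

text \<open>
  Conventions. A quiver is a \<open>pre_digraph\<close> satisfying \<open>fin_digraph\<close> (loops and multiple arrows are
  allowed); only the values of families on the vertices and arrows of the quiver matter. Commutative
  rings are types of class \<open>comm_ring_1\<close>, and a \<open>k\<close>-algebra \<open>R\<close> is given by its structure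
  homomorphism \<open>k \<Rightarrow> R\<close>. The free module \<open>R\<^sup>n\<close> is \<open>carrier_vec n\<close>, and \<open>Hom\<^sub>R(R\<^sup>m, R\<^sup>n)\<close> is
  \<open>carrier_mat n m\<close>.
\<close>

section \<open>Quiver flag schemes\<close>

text \<open>Dimension vectors of filtrations start at \<open>0\<close> and increase, so they are non-negative.\<close>

definition filtration :: "('v, 'a) pre_digraph \<Rightarrow> nat \<Rightarrow> (nat \<Rightarrow> 'v \<Rightarrow> nat) \<Rightarrow> bool" where
  "filtration Q \<nu> d \<longleftrightarrow>
     (\<forall>i\<in>verts Q. d 0 i = 0) \<and> (\<forall>l<\<nu>. \<forall>i\<in>verts Q. d l i \<le> d (Suc l) i)"

definition Rep :: "('v, 'a) pre_digraph \<Rightarrow> ('v \<Rightarrow> nat) \<Rightarrow> ('a \<Rightarrow> 'r mat) set" where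
  "Rep Q n = (\<Pi> \<alpha>\<in>arcs Q. carrier_mat (n (head Q \<alpha>)) (n (tail Q \<alpha>)))"

definition subrepresentation ::
  "('v, 'a) pre_digraph \<Rightarrow> ('v \<Rightarrow> nat) \<Rightarrow> ('a \<Rightarrow> 'r::comm_ring_1 mat) \<Rightarrow> ('v \<Rightarrow> 'r vec set) \<Rightarrow> bool"
where
  "subrepresentation Q n M U \<longleftrightarrow>
     (\<forall>i\<in>verts Q. LinearCombinations.submodule class_ring (U i) (module_vec TYPE('r) (n i))) \<and>
     (\<forall>\<alpha>\<in>arcs Q. \<forall>u\<in>U (tail Q \<alpha>). M \<alpha> *\<^sub>v u \<in> U (head Q \<alpha>))"

definition direct_summand :: "nat \<Rightarrow> 'r::comm_ring_1 vec set \<Rightarrow> bool" where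
  "direct_summand n U \<longleftrightarrow>
     LinearCombinations.submodule class_ring U (module_vec TYPE('r) n) \<and>
     (\<exists>W. LinearCombinations.submodule class_ring W (module_vec TYPE('r) n) \<and>
          U \<inter> W = {0\<^sub>v n} \<and> (\<forall>v\<in>carrier_vec n. \<exists>u\<in>U. \<exists>w\<in>W. v = u + w))"

text \<open>
  The rank of the finitely generated projective module \<open>U \<subseteq> R\<^sup>n\<close> is \<open>r\<close> if, for every prime \<open>P\<close> of
  \<open>R\<close>, the localisation \<open>U\<^sub>P\<close> is free of rank \<open>r\<close>. A basis of \<open>U\<^sub>P\<close> can be scaled by units
  of \<open>R\<^sub>P\<close> so as to consist of images of elements of \<open>U\<close>; these are the columns of \<open>B\<close>. The last two
  clauses say that they generate \<open>U\<^sub>P\<close> and are linearly independent in it, with denominators cleared.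
\<close>

definition has_rank :: "nat \<Rightarrow> 'r::comm_ring_1 vec set \<Rightarrow> nat \<Rightarrow> bool" where
  "has_rank n U r \<longleftrightarrow>
     (\<forall>P. primeideal P (class_ring :: 'r ring) \<longrightarrow>
       (\<exists>B\<in>carrier_mat n r. set (cols B) \<subseteq> U \<and>
          (\<forall>u\<in>U. \<exists>s. s \<notin> P \<and> (\<exists>a\<in>carrier_vec r. s \<cdot>\<^sub>v u = B *\<^sub>v a)) \<and>
          (\<forall>a\<in>carrier_vec r. B *\<^sub>v a = 0\<^sub>v n \<longrightarrow> (\<exists>s. s \<notin> P \<and> s \<cdot>\<^sub>v a = 0\<^sub>v r))))"

text \<open>The set of \<open>R\<close>-points of the quiver flag scheme, for the \<open>k\<close>-algebra \<open>\<phi> : k \<Rightarrow> R\<close>.\<close>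

definition Fl ::
  "('k \<Rightarrow> 'r::comm_ring_1) \<Rightarrow> ('v, 'a) pre_digraph \<Rightarrow> nat \<Rightarrow> (nat \<Rightarrow> 'v \<Rightarrow> nat) \<Rightarrow> ('a \<Rightarrow> 'k mat)
    \<Rightarrow> (nat \<Rightarrow> 'v \<Rightarrow> 'r vec set) set"
where
  "Fl \<phi> Q \<nu> d M = {U \<in> {..\<nu>} \<rightarrow>\<^sub>E verts Q \<rightarrow>\<^sub>E UNIV.
     (\<forall>l\<le>\<nu>. subrepresentation Q (d \<nu>) (\<lambda>\<alpha>. map_mat \<phi> (M \<alpha>)) (U l)) \<and>
     (\<forall>l\<le>\<nu>. \<forall>i\<in>verts Q. direct_summand (d \<nu> i) (U l i) \<and> has_rank (d \<nu> i) (U l i) (d l i)) \<and>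
     (\<forall>l<\<nu>. \<forall>i\<in>verts Q. U l i \<subseteq> U (Suc l) i)}"

text \<open>
  Functoriality along \<open>\<psi> : R \<Rightarrow> S\<close>: as \<open>U\<close> is a direct summand of \<open>R\<^sup>n\<close>, the module \<open>U \<otimes>\<^sub>R S\<close> is
  the \<open>S\<close>-submodule of \<open>S\<^sup>n\<close> generated by the image of \<open>U\<close>.
\<close>

definition Fl_map ::
  "('r \<Rightarrow> 's::comm_ring_1) \<Rightarrow> ('v, 'a) pre_digraph \<Rightarrow> nat \<Rightarrow> (nat \<Rightarrow> 'v \<Rightarrow> nat)
    \<Rightarrow> (nat \<Rightarrow> 'v \<Rightarrow> 'r vec set) \<Rightarrow> nat \<Rightarrow> 'v \<Rightarrow> 's vec set"
where
  "Fl_map \<psi> Q \<nu> d U =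
     (\<lambda>l\<in>{..\<nu>}. \<lambda>i\<in>verts Q.
        LinearCombinations.module.span class_ring (module_vec TYPE('s) (d \<nu> i)) (map_vec \<psi> ` U l i))"

section \<open>Tangent spaces\<close>

text \<open>
  \<open>('a, 'n) infinitesimal\<close> is the ring \<open>K[\<epsilon>\<^sub>n : n \<in> 'n] / (\<epsilon>\<^sub>n \<epsilon>\<^sub>m : n, m \<in> 'n)\<close> for a finite
  type \<open>'n\<close>: \<open>Eps a f\<close> stands for \<open>a + \<Sum>\<^sub>n f n \<epsilon>\<^sub>n\<close>. For \<open>'n = unit\<close> these are the dual numbers
  \<open>K[\<epsilon>]\<close>, for \<open>'n = bool\<close> the ring \<open>K[\<epsilon>\<^sub>1, \<epsilon>\<^sub>2] / (\<epsilon>\<^sub>1, \<epsilon>\<^sub>2)\<^sup>2\<close>.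
\<close>

datatype ('a, 'n) infinitesimal = Eps (std_part: 'a) (eps_part: "'n \<Rightarrow> 'a")

instantiation infinitesimal :: (comm_ring_1, type) comm_ring_1
begin

definition "0 = Eps 0 (\<lambda>_. 0)"
definition "1 = Eps 1 (\<lambda>_. 0)"
definition "x + y = Eps (std_part x + std_part y) (\<lambda>n. eps_part x n + eps_part y n)"
definition "- x = Eps (- std_part x) (\<lambda>n. - eps_part x n)"
definition "x - y = Eps (std_part x - std_part y) (\<lambda>n. eps_part x n - eps_part y n)"
definition "x * y = Eps (std_part x * std_part y)
  (\<lambda>n. std_part x * eps_part y n + eps_part x n * std_part y)"

instance
  by standard
    (auto simp: zero_infinitesimal_def one_infinitesimal_def plus_infinitesimal_def
      uminus_infinitesimal_def minus_infinitesimal_def times_infinitesimal_def algebra_simps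
      infinitesimal.expand fun_eq_iff)

end

text \<open>
  Homomorphisms of \<open>K\<close>-algebras: the structure map; \<open>\<epsilon> \<mapsto> c \<epsilon>\<close>; the map keeping \<open>\<epsilon>\<^sub>n\<close> (as \<open>\<epsilon>\<close>)
  and killing the others; and \<open>\<epsilon>\<^sub>1, \<epsilon>\<^sub>2 \<mapsto> \<epsilon>\<close>. The augmentation \<open>\<epsilon> \<mapsto> 0\<close> is \<open>std_part\<close>.
\<close>

definition eps_const :: "'a::comm_ring_1 \<Rightarrow> ('a, 'n) infinitesimal" where
  "eps_const a = Eps a (\<lambda>_. 0)"

definition eps_scale ::
  "'a::comm_ring_1 \<Rightarrow> ('a, unit) infinitesimal \<Rightarrow> ('a, unit) infinitesimal" where
  "eps_scale c x = Eps (std_part x) (\<lambda>_. c * eps_part x ())"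

definition eps_proj :: "bool \<Rightarrow> ('a, bool) infinitesimal \<Rightarrow> ('a, unit) infinitesimal" where
  "eps_proj n x = Eps (std_part x) (\<lambda>_. eps_part x n)"

definition eps_fold :: "('a::comm_ring_1, bool) infinitesimal \<Rightarrow> ('a, unit) infinitesimal" where
  "eps_fold x = Eps (std_part x) (\<lambda>_. eps_part x True + eps_part x False)"

text \<open>
  The fibre of \<open>X(K[\<epsilon>]) \<Rightarrow> X(K)\<close> over \<open>U\<close> for \<open>X = Fl\<close>, with the functorial \<open>K\<close>-vector space
  structure: \<open>c\<close> acts through \<open>\<epsilon> \<mapsto> c \<epsilon>\<close>, and the sum of \<open>V\<close> and \<open>W\<close> is the image under
  \<open>\<epsilon>\<^sub>1, \<epsilon>\<^sub>2 \<mapsto> \<epsilon>\<close> of the point of \<open>X(K[\<epsilon>\<^sub>1, \<epsilon>\<^sub>2] / (\<epsilon>\<^sub>1, \<epsilon>\<^sub>2)\<^sup>2) = X(K[\<epsilon>]) \<times>\<^bsub>X(K)\<^esub> X(K[\<epsilon>])\<close>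
  corresponding to \<open>(V, W)\<close>.
\<close>

definition tangent_space ::
  "('k \<Rightarrow> 'K::field) \<Rightarrow> ('v, 'a) pre_digraph \<Rightarrow> nat \<Rightarrow> (nat \<Rightarrow> 'v \<Rightarrow> nat) \<Rightarrow> ('a \<Rightarrow> 'k mat)
    \<Rightarrow> (nat \<Rightarrow> 'v \<Rightarrow> 'K vec set) \<Rightarrow> ('K, nat \<Rightarrow> 'v \<Rightarrow> ('K, unit) infinitesimal vec set) module"
where
  "tangent_space \<phi> Q \<nu> d M U = \<lparr>
     carrier = {V \<in> Fl (eps_const \<circ> \<phi>) Q \<nu> d M. Fl_map std_part Q \<nu> d V = U},
     mult = undefined,
     one = undefined,
     zero = Fl_map eps_const Q \<nu> d U,
     add = (\<lambda>V W. Fl_map eps_fold Q \<nu> d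
       (THE Z. Z \<in> Fl (eps_const \<circ> \<phi>) Q \<nu> d M \<and>
          Fl_map (eps_proj True) Q \<nu> d Z = V \<and> Fl_map (eps_proj False) Q \<nu> d Z = W)),
     smult = (\<lambda>c. Fl_map (eps_scale c) Q \<nu> d)\<rparr>"

section \<open>Path algebras and their modules\<close>

text \<open>A path is a start vertex with a list of arrows, in the order in which they are traversed.\<close>

definition paths :: "('v, 'a) pre_digraph \<Rightarrow> ('v \<times> 'a list) set" where
  "paths Q = {(u, p). \<exists>w. pre_digraph.awalk Q u p w}"

text \<open>
  The path algebra \<open>BQ\<close> with coefficients in a ring \<open>B\<close>, where coefficients commute with paths:
  finitely supported families of coefficients. Modules are left modules, so \<open>q \<cdot> p\<close> is \<open>p\<close> followed by
  \<open>q\<close>.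
\<close>

definition path_algebra ::
  "('b, 'm) ring_scheme \<Rightarrow> ('v, 'a) pre_digraph \<Rightarrow> ('v \<times> 'a list \<Rightarrow> 'b) ring" where
  "path_algebra B Q = \<lparr>
     carrier = {f. (\<forall>p\<in>paths Q. f p \<in> carrier B) \<and> (\<forall>p. p \<notin> paths Q \<longrightarrow> f p = \<zero>\<^bsub>B\<^esub>) \<and>
                   finite {p. f p \<noteq> \<zero>\<^bsub>B\<^esub>}},
     mult = (\<lambda>f g (u, p). if (u, p) \<in> paths Q
       then \<Oplus>\<^bsub>B\<^esub>j\<in>{..length p}.
              f (last (pre_digraph.awalk_verts Q u (take j p)), drop j p) \<otimes>\<^bsub>B\<^esub> g (u, take j p)
       else \<zero>\<^bsub>B\<^esub>),
     one = (\<lambda>(u, p). if u \<in> verts Q \<and> p = [] then \<one>\<^bsub>B\<^esub> else \<zero>\<^bsub>B\<^esub>),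
     zero = (\<lambda>_. \<zero>\<^bsub>B\<^esub>),
     add = (\<lambda>f g p. f p \<oplus>\<^bsub>B\<^esub> g p)\<rparr>"

text \<open>
  A module over \<open>A \<otimes>\<^sub>k K\<close> is recorded as an \<open>A\<close>-module (\<open>smult\<close>) with a further action of \<open>K\<close>
  (\<open>kscale\<close>), the element \<open>a \<otimes> c\<close> acting as \<open>x \<mapsto> a (c x)\<close>.
\<close>

record ('a, 'c, 'm) tensor_module = "('a, 'm) module" +
  kscale :: "'c \<Rightarrow> 'm \<Rightarrow> 'm"

text \<open>
  The \<open>BQ\<close>-module of a representation of \<open>Q\<close> in \<open>B\<close>-modules, with \<open>N i\<close> at the vertex \<open>i\<close> and
  \<open>F \<alpha>\<close> at the arrow \<open>\<alpha>\<close>: the direct sum of the \<open>N i\<close>, a path \<open>\<alpha>\<^sub>1 \<dots> \<alpha>\<^sub>m\<close> from \<open>u\<close> to \<open>i\<close>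
  acting by \<open>F \<alpha>\<^sub>m \<circ> \<dots> \<circ> F \<alpha>\<^sub>1 : N u \<Rightarrow> N i\<close>.
\<close>

definition path_module ::
  "('b, 'z) ring_scheme \<Rightarrow> ('v, 'a) pre_digraph \<Rightarrow> ('v \<Rightarrow> ('b, 'c, 'm) tensor_module)
    \<Rightarrow> ('a \<Rightarrow> 'm \<Rightarrow> 'm) \<Rightarrow> ('v \<times> 'a list \<Rightarrow> 'b, 'c, 'v \<Rightarrow> 'm) tensor_module" where
  "path_module B Q N F = \<lparr>
     carrier = (\<Pi>\<^sub>E i\<in>verts Q. carrier (N i)),
     mult = undefined,
     one = undefined,
     zero = (\<lambda>i\<in>verts Q. \<zero>\<^bsub>N i\<^esub>),
     add = (\<lambda>x y. \<lambda>i\<in>verts Q. x i \<oplus>\<^bsub>N i\<^esub> y i),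
     smult = (\<lambda>f x. \<lambda>i\<in>verts Q.
       \<Oplus>\<^bsub>N i\<^esub>p\<in>{p. pre_digraph.awalk Q (fst p) (snd p) i \<and> f p \<noteq> \<zero>\<^bsub>B\<^esub>}.
         f p \<odot>\<^bsub>N i\<^esub> fold F (snd p) (x (fst p))),
     kscale = (\<lambda>c x. \<lambda>i\<in>verts Q. kscale (N i) c (x i))\<rparr>"

definition quotient_module ::
  "('a, 'c, 'm) tensor_module \<Rightarrow> 'm set \<Rightarrow> ('a, 'c, 'm set) tensor_module" where
  "quotient_module X N = \<lparr>
     carrier = a_rcosets\<^bsub>X\<^esub> N,
     mult = undefined,
     one = undefined,
     zero = N,
     add = set_add X,
     smult = (\<lambda>a C. \<Union>x\<in>C. N +>\<^bsub>X\<^esub> (a \<odot>\<^bsub>X\<^esub> x)),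
     kscale = (\<lambda>c C. \<Union>x\<in>C. N +>\<^bsub>X\<^esub> kscale X c x)\<rparr>"

text \<open>
  The \<open>K\<close>-vector space \<open>Hom\<close> over \<open>A \<otimes>\<^sub>k K\<close>. Since \<open>A \<otimes>\<^sub>k K\<close> is generated by \<open>a \<otimes> 1\<close> and
  \<open>1 \<otimes> c\<close>, its homomorphisms are the maps that are both \<open>A\<close>-linear and \<open>K\<close>-linear.
\<close>

definition Hom_tensor ::
  "('a, 'z) ring_scheme \<Rightarrow> ('a, 'c, 'm) tensor_module \<Rightarrow> ('a, 'c, 'n) tensor_module
    \<Rightarrow> ('c, 'm \<Rightarrow> 'n) module" where
  "Hom_tensor A X Y = \<lparr>
     carrier = {f \<in> LinearCombinations.module_hom A X Y \<inter> extensional (carrier X).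
                  \<forall>c. \<forall>x\<in>carrier X. f (kscale X c x) = kscale Y c (f x)},
     mult = undefined,
     one = undefined,
     zero = (\<lambda>x\<in>carrier X. \<zero>\<^bsub>Y\<^esub>),
     add = (\<lambda>f g. \<lambda>x\<in>carrier X. f x \<oplus>\<^bsub>Y\<^esub> g x),
     smult = (\<lambda>c f. \<lambda>x\<in>carrier X. kscale Y c (f x))\<rparr>"

section \<open>The modules of the theorem\<close>

text \<open>The quiver \<open>0 \<rightarrow> 1 \<rightarrow> \<dots> \<rightarrow> \<nu>\<close>.\<close>

definition linear_quiver :: "nat \<Rightarrow> (nat, nat) pre_digraph" where
  "linear_quiver \<nu> = \<lparr>verts = {..\<nu>}, arcs = {..<\<nu>}, tail = (\<lambda>l. l), head = Suc\<rparr>"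

text \<open>\<open>\<Lambda> = (kQ)A\<close> with \<open>A = linear_quiver \<nu>\<close>.\<close>

definition Lambda ::
  "'k::field itself \<Rightarrow> ('v, 'a) pre_digraph \<Rightarrow> nat \<Rightarrow> (nat \<times> nat list \<Rightarrow> 'v \<times> 'a list \<Rightarrow> 'k) ring"
where
  "Lambda _ Q \<nu> = path_algebra (path_algebra (class_ring :: 'k ring) Q) (linear_quiver \<nu>)"

text \<open>\<open>k\<^sup>n \<otimes>\<^sub>k K = K\<^sup>n\<close> as a module over \<open>k \<otimes>\<^sub>k K\<close>.\<close>

definition vec_tensor_module ::
  "('k \<Rightarrow> 'K::field) \<Rightarrow> nat \<Rightarrow> ('k, 'K, 'K vec) tensor_module" where
  "vec_tensor_module \<phi> n = \<lparr>
     carrier = carrier_vec n,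
     mult = undefined,
     one = undefined,
     zero = 0\<^sub>v n,
     add = (+),
     smult = (\<lambda>a v. \<phi> a \<cdot>\<^sub>v v),
     kscale = (\<lambda>c v. c \<cdot>\<^sub>v v)\<rparr>"

text \<open>\<open>M \<otimes>\<^sub>k K\<close> as a module over \<open>kQ \<otimes>\<^sub>k K\<close>.\<close>

definition rep_module ::
  "('k::field \<Rightarrow> 'K::field) \<Rightarrow> ('v, 'a) pre_digraph \<Rightarrow> ('v \<Rightarrow> nat) \<Rightarrow> ('a \<Rightarrow> 'k mat)
    \<Rightarrow> ('v \<times> 'a list \<Rightarrow> 'k, 'K, 'v \<Rightarrow> 'K vec) tensor_module" where
  "rep_module \<phi> Q n M =
     path_module (class_ring :: 'k ring) Q (\<lambda>i. vec_tensor_module \<phi> (n i))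
       (\<lambda>\<alpha> v. map_mat \<phi> (M \<alpha>) *\<^sub>v v)"

text \<open>\<open>(M = M = \<dots> = M) \<otimes>\<^sub>k K\<close> as a module over \<open>\<Lambda> \<otimes>\<^sub>k K\<close>.\<close>

definition constant_module ::
  "('k::field \<Rightarrow> 'K::field) \<Rightarrow> ('v, 'a) pre_digraph \<Rightarrow> nat \<Rightarrow> ('v \<Rightarrow> nat) \<Rightarrow> ('a \<Rightarrow> 'k mat)
    \<Rightarrow> (nat \<times> nat list \<Rightarrow> 'v \<times> 'a list \<Rightarrow> 'k, 'K, nat \<Rightarrow> 'v \<Rightarrow> 'K vec) tensor_module" where
  "constant_module \<phi> Q \<nu> n M =
     path_module (path_algebra (class_ring :: 'k ring) Q) (linear_quiver \<nu>)
       (\<lambda>_. rep_module \<phi> Q n M) (\<lambda>_ x. x)"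

definition flag_carrier ::
  "('v, 'a) pre_digraph \<Rightarrow> nat \<Rightarrow> (nat \<Rightarrow> 'v \<Rightarrow> 'K vec set) \<Rightarrow> (nat \<Rightarrow> 'v \<Rightarrow> 'K vec) set" where
  "flag_carrier Q \<nu> U = (\<Pi>\<^sub>E l\<in>{..\<nu>}. \<Pi>\<^sub>E i\<in>verts Q. U l i)"

text \<open>\<open>Hom(U, (M \<otimes>\<^sub>k K) / U)\<close> over \<open>\<Lambda> \<otimes>\<^sub>k K\<close>, for \<open>U\<close> a submodule of \<open>M = (M = \<dots> = M)\<close>.\<close>

definition Hom_flag ::
  "('k::field \<Rightarrow> 'K::field) \<Rightarrow> ('v, 'a) pre_digraph \<Rightarrow> nat \<Rightarrow> (nat \<Rightarrow> 'v \<Rightarrow> nat) \<Rightarrow> ('a \<Rightarrow> 'k mat)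
    \<Rightarrow> (nat \<Rightarrow> 'v \<Rightarrow> 'K vec set)
    \<Rightarrow> ('K, (nat \<Rightarrow> 'v \<Rightarrow> 'K vec) \<Rightarrow> (nat \<Rightarrow> 'v \<Rightarrow> 'K vec) set) module" where
  "Hom_flag \<phi> Q \<nu> d M U =
     (let MK = constant_module \<phi> Q \<nu> (d \<nu>) M; N = flag_carrier Q \<nu> U
      in Hom_tensor (Lambda TYPE('k) Q \<nu>) (MK\<lparr>carrier := N\<rparr>) (quotient_module MK N))"

end

theory Submission
  imports Defs
begin

text \<open>
  A tangent vector at \<open>U\<close> is a flag \<open>V\<close> of subrepresentations over \<open>K[\<epsilon>]\<close> which reduces to \<open>U\<close>. Its
  effect on \<open>u \<in> U l i\<close> is a first order displacement: the vectors \<open>v\<close> with \<open>u + \<epsilon> v \<in> V l i\<close>. The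
  theorem holds because these displacements form one coset of \<open>U l i\<close>, because the linear maps
  \<open>U l i \<Rightarrow> K\<^sup>n / U l i\<close> obtained in this way are arbitrary, and because the conditions that tie the
  \<open>V l i\<close> together (stability under the arrows of \<open>Q\<close>, inclusion of \<open>V l i\<close> in \<open>V (l + 1) i\<close>) say
  exactly that the maps commute with the generators of \<open>\<Lambda>\<close>.

  The first point is commutative algebra over \<open>A = K[\<epsilon>\<^sub>m]\<close> with \<open>\<epsilon>\<^sub>m \<epsilon>\<^sub>k = 0\<close>. Call a submodule
  \<open>Z \<subseteq> A\<^sup>n\<close> a flat lift of \<open>U \<subseteq> K\<^sup>n\<close> if it reduces to \<open>U\<close> and its elements that reduce to \<open>0\<close> are
  those with coefficients in \<open>U\<close>. A direct summand is a flat lift of its reduction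
  (\<open>direct_summand_flat_lift\<close>). Conversely a flat lift of \<open>U\<close> is a direct summand, since a complement of
  \<open>U\<close> extends to \<open>A\<close> (\<open>flat_lift_direct_summand\<close>), and it has the rank of \<open>U\<close>, since lifts of a basis
  of \<open>U\<close> form a basis (\<open>flat_lift_has_rank\<close>). Hence the points over \<open>U\<close> are described by flat lifts
  alone, and for \<open>K[\<epsilon>]\<close> a flat lift amounts to the relation \<open>u + \<epsilon> v \<in> V\<close> between \<open>u\<close> and \<open>v\<close>, its
  \<open>graph\<close>: a linear relation with domain \<open>U\<close> and indeterminacy \<open>U\<close> (\<open>flat_lift_graph\<close>,
  \<open>flat_lift_of_graph\<close>).

  The functorial vector space structure becomes the expected one. Over \<open>K[\<epsilon>\<^sub>1, \<epsilon>\<^sub>2]\<close> the point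
  corresponding to \<open>(V, W)\<close> is the fibre product of \<open>V\<close> and \<open>W\<close> over \<open>U\<close>, and
  \<open>\<epsilon>\<^sub>1, \<epsilon>\<^sub>2 \<mapsto> \<epsilon>\<close> adds displacements; \<open>\<epsilon> \<mapsto> c \<epsilon>\<close> multiplies them by \<open>c\<close>.

  The map \<open>tangent_hom\<close> sends \<open>V\<close> to the function taking \<open>x\<close> in the flag module to the set of all \<open>y\<close>
  with \<open>x + \<epsilon> y\<close> in \<open>V\<close> at every vertex. The action of \<open>\<Lambda>\<close> enters only twice. It preserves every
  family of relations that is preserved by the structure maps (\<open>const_mod_invariant\<close>), in particular the
  graphs of \<open>V\<close>, so \<open>tangent_hom V\<close> is \<open>\<Lambda>\<close>-linear. And \<open>\<Lambda>\<close> contains the vertex idempotents and the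
  arrows (\<open>path_element_action\<close>), so that conversely a homomorphism splits into its components at the
  vertices, which are the graphs of a tangent vector (\<open>tangent_hom_surj\<close>).
\<close>

section \<open>Submodules of free modules\<close>

abbreviation submod :: "nat \<Rightarrow> 'r::comm_ring_1 vec set \<Rightarrow> bool" where
  "submod n U \<equiv> LinearCombinations.submodule class_ring U (module_vec TYPE('r) n)"

abbreviation spanned :: "nat \<Rightarrow> 'r::comm_ring_1 vec set \<Rightarrow> 'r vec set" where
  "spanned n S \<equiv> LinearCombinations.module.span class_ring (module_vec TYPE('r) n) S"

lemma module_module_vec: "Module.module (class_ring :: 'r::comm_ring_1 ring) (module_vec TYPE('r) n)"
proof -
  interpret vec_module "TYPE('r)" n .
  show ?thesis by (rule module_axioms)
qed

lemma submod_iff: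
  "submod n U \<longleftrightarrow> U \<subseteq> carrier_vec n \<and> 0\<^sub>v n \<in> U \<and> (\<forall>u\<in>U. \<forall>v\<in>U. u + v \<in> U) \<and>
     (\<forall>c. \<forall>u\<in>U. c \<cdot>\<^sub>v u \<in> U)"
  by (auto simp: LinearCombinations.submodule_def module_module_vec module_vec_simps)

lemma
  assumes "submod n U"
  shows submod_carrier: "u \<in> U \<Longrightarrow> u \<in> carrier_vec n"
    and submod_zero: "0\<^sub>v n \<in> U"
    and submod_add: "u \<in> U \<Longrightarrow> v \<in> U \<Longrightarrow> u + v \<in> U"
    and submod_smult: "u \<in> U \<Longrightarrow> c \<cdot>\<^sub>v u \<in> U"
  using assms by (auto simp: submod_iff)

lemma minus_vec_smult: "dim_vec u = dim_vec v \<Longrightarrow> u - v = u + (- 1) \<cdot>\<^sub>v (v :: 'r::comm_ring_1 vec)"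
  by (intro eq_vecI) auto

lemma submod_minus:
  assumes "submod n U" "u \<in> U" "v \<in> U"
  shows "u - v \<in> U"
proof -
  have "u - v = u + (- 1) \<cdot>\<^sub>v v"
    using submod_carrier[OF assms(1) assms(2)] submod_carrier[OF assms(1) assms(3)]
    by (intro minus_vec_smult) auto
  then show ?thesis using assms submod_add submod_smult by metis
qed

lemma
  assumes "S \<subseteq> carrier_vec n"
  shows spanned_submod: "submod n (spanned n S)"
    and spanned_superset: "S \<subseteq> spanned n S"
    and spanned_least: "submod n N \<Longrightarrow> S \<subseteq> N \<Longrightarrow> spanned n S \<subseteq> N"
  using module.span_is_submodule[OF module_module_vec, of S]
    module.in_own_span[OF module_module_vec, of S]
    module.span_is_subset[OF module_module_vec, of S N] assms
  by (auto simp: module_vec_simps)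

lemma spanned_eqI:
  assumes "submod n N" "S \<subseteq> N" "\<And>N'. submod n N' \<Longrightarrow> S \<subseteq> N' \<Longrightarrow> N \<subseteq> N'"
  shows "spanned n S = N"
proof -
  have S: "S \<subseteq> carrier_vec n" using assms by (auto simp: submod_iff)
  show ?thesis
    using spanned_submod[OF S] spanned_superset[OF S] spanned_least[OF S assms(1)] assms by blast
qed

lemma spanned_id: "submod n N \<Longrightarrow> spanned n N = N"
  by (rule spanned_eqI) auto

section \<open>Vectors with infinitesimal coefficients\<close>

abbreviation std_vec :: "('a, 'n) infinitesimal vec \<Rightarrow> 'a vec" where
  "std_vec \<equiv> map_vec std_part"

abbreviation eps_vec :: "'n \<Rightarrow> ('a, 'n) infinitesimal vec \<Rightarrow> 'a vec" where
  "eps_vec m \<equiv> map_vec (\<lambda>a. eps_part a m)"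

definition Eps_vec :: "'a vec \<Rightarrow> ('n \<Rightarrow> 'a vec) \<Rightarrow> ('a, 'n) infinitesimal vec" where
  "Eps_vec u v = vec (dim_vec u) (\<lambda>j. Eps (u $ j) (\<lambda>m. v m $ j))"

lemma infinitesimal_simps [simp]:
  "std_part 0 = 0" "std_part 1 = 1" "std_part (a + b) = std_part a + std_part b"
  "std_part (a * b) = std_part a * std_part b" "std_part (- a) = - std_part a"
  "std_part (a - b) = std_part a - std_part b"
  "eps_part 0 m = 0" "eps_part 1 m = 0" "eps_part (a + b) m = eps_part a m + eps_part b m"
  "eps_part (a * b) m = std_part a * eps_part b m + eps_part a m * std_part b"
  "eps_part (- a) m = - eps_part a m" "eps_part (a - b) m = eps_part a m - eps_part b m"
  "std_part (eps_const c) = c" "eps_part (eps_const c) m = 0"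
  for a b :: "('a::comm_ring_1, 'n) infinitesimal"
  by (auto simp: zero_infinitesimal_def one_infinitesimal_def plus_infinitesimal_def
      uminus_infinitesimal_def minus_infinitesimal_def times_infinitesimal_def eps_const_def)

lemma infinitesimal_eq_iff: "a = b \<longleftrightarrow> std_part a = std_part b \<and> (\<forall>m. eps_part a m = eps_part b m)"
  by (cases a; cases b) (auto simp: fun_eq_iff)

lemma infinitesimal_vec_eqI:
  assumes "x \<in> carrier_vec n" "y \<in> carrier_vec n"
    "std_vec x = std_vec y" "\<And>m. eps_vec m x = eps_vec m y"
  shows "x = y"
proof (rule eq_vecI)
  fix j assume j: "j < dim_vec y"
  have "std_part (x $ j) = std_part (y $ j)"
    using arg_cong[OF assms(3), of "\<lambda>v. v $ j"] j assms(1,2) by auto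
  moreover have "eps_part (x $ j) m = eps_part (y $ j) m" for m
    using arg_cong[OF assms(4)[of m], of "\<lambda>v. v $ j"] j assms(1,2) by auto
  ultimately show "x $ j = y $ j" by (simp add: infinitesimal_eq_iff)
qed (use assms in auto)

lemma infinitesimal_vec_simps [simp]:
  fixes x y :: "('a::comm_ring_1, 'n) infinitesimal vec"
  assumes "dim_vec x = dim_vec y"
  shows "std_vec (x + y) = std_vec x + std_vec y" "eps_vec m (x + y) = eps_vec m x + eps_vec m y"
    "std_vec (x - y) = std_vec x - std_vec y" "eps_vec m (x - y) = eps_vec m x - eps_vec m y"
  using assms by (auto intro!: eq_vecI)

lemma infinitesimal_vec_smult [simp]:
  fixes x :: "('a::comm_ring_1, 'n) infinitesimal vec"
  shows "std_vec (c \<cdot>\<^sub>v x) = std_part c \<cdot>\<^sub>v std_vec x"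
    "eps_vec m (c \<cdot>\<^sub>v x) = std_part c \<cdot>\<^sub>v eps_vec m x + eps_part c m \<cdot>\<^sub>v std_vec x"
  by (auto intro!: eq_vecI)

lemma infinitesimal_vec_zero [simp]:
  "std_vec (0\<^sub>v n :: ('a::comm_ring_1, 'n) infinitesimal vec) = 0\<^sub>v n"
  "eps_vec m (0\<^sub>v n :: ('a, 'n) infinitesimal vec) = 0\<^sub>v n"
  by (auto intro!: eq_vecI)

lemma Eps_vec_simps [simp]:
  assumes "u \<in> carrier_vec n" "\<And>m. v m \<in> carrier_vec n"
  shows "Eps_vec u v \<in> carrier_vec n" "std_vec (Eps_vec u v) = u" "eps_vec m (Eps_vec u v) = v m"
proof -
  have "dim_vec (v m) = n" for m using assms(2)[of m] by auto
  then show "Eps_vec u v \<in> carrier_vec n" "std_vec (Eps_vec u v) = u" "eps_vec m (Eps_vec u v) = v m"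
    using assms(1) by (auto simp: Eps_vec_def intro!: eq_vecI)
qed

lemma mult_mat_vec_eps_const [simp]:
  fixes x :: "('a::comm_ring_1, 'n) infinitesimal vec"
  assumes "dim_vec x = dim_col A"
  shows "std_vec (map_mat eps_const A *\<^sub>v x) = A *\<^sub>v std_vec x"
    "eps_vec m (map_mat eps_const A *\<^sub>v x) = A *\<^sub>v eps_vec m x"
proof -
  have s: "std_part (sum f I) = (\<Sum>i\<in>I. std_part (f i))"
    "eps_part (sum f I) m = (\<Sum>i\<in>I. eps_part (f i) m)"
    for f :: "nat \<Rightarrow> ('a, 'n) infinitesimal" and I
    by (induction I rule: infinite_finite_induct) auto
  show "std_vec (map_mat eps_const A *\<^sub>v x) = A *\<^sub>v std_vec x"
    "eps_vec m (map_mat eps_const A *\<^sub>v x) = A *\<^sub>v eps_vec m x"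
    using assms by (auto intro!: eq_vecI simp: scalar_prod_def s)
qed

lemma submod_std_image:
  fixes Z :: "('a::comm_ring_1, 'n) infinitesimal vec set"
  assumes "submod n Z"
  shows "submod n (std_vec ` Z)"
  unfolding submod_iff
proof (intro conjI ballI allI)
  note c [simp] = submod_carrier[OF assms]
  have d [simp]: "dim_vec x = n" if "x \<in> Z" for x using c[OF that] by auto
  show "std_vec ` Z \<subseteq> carrier_vec n" by auto
  show "0\<^sub>v n \<in> std_vec ` Z"
    by (rule image_eqI[OF _ submod_zero[OF assms]]) simp
  fix u assume "u \<in> std_vec ` Z"
  then obtain x where x: "x \<in> Z" "u = std_vec x" by auto
  show "c \<cdot>\<^sub>v u \<in> std_vec ` Z" for c
    by (rule image_eqI[OF _ submod_smult[OF assms x(1), of "eps_const c"]]) (simp add: x)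
  fix v assume "v \<in> std_vec ` Z"
  then obtain y where y: "y \<in> Z" "v = std_vec y" by auto
  show "u + v \<in> std_vec ` Z"
    by (rule image_eqI[OF _ submod_add[OF assms x(1) y(1)]]) (simp add: x y)
qed

text \<open>
  The kernel of the reduction \<open>U \<otimes> K[\<epsilon>\<^sub>m] \<Rightarrow> U\<close>: the module generated by the \<open>\<epsilon>\<^sub>m u\<close> for \<open>u \<in> U\<close>, provided
  that there are finitely many \<open>\<epsilon>\<^sub>m\<close>.
\<close>

definition infinitesimals :: "nat \<Rightarrow> 'a::comm_ring_1 vec set \<Rightarrow> ('a, 'n) infinitesimal vec set" where
  "infinitesimals n U = {y \<in> carrier_vec n. std_vec y = 0\<^sub>v n \<and> (\<forall>m. eps_vec m y \<in> U)}"

lemma infinitesimals_submod: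
  assumes "submod n U"
  shows "submod n (infinitesimals n U)"
  unfolding submod_iff
proof (intro conjI ballI allI)
  note U [simp] = submod_zero[OF assms] submod_smult[OF assms] submod_add[OF assms]
  show "infinitesimals n U \<subseteq> carrier_vec n" by (auto simp: infinitesimals_def)
  show "0\<^sub>v n \<in> infinitesimals n U" by (auto simp: infinitesimals_def)
  fix u :: "('a, 'b) infinitesimal vec" assume u: "u \<in> infinitesimals n U"
  have "c \<cdot>\<^sub>v eps_vec m u + x \<cdot>\<^sub>v 0\<^sub>v n \<in> U" for c x m
    using u by (intro U) (auto simp: infinitesimals_def)
  with u show "c \<cdot>\<^sub>v u \<in> infinitesimals n U" for c by (auto simp: infinitesimals_def)
  fix v :: "('a, 'b) infinitesimal vec" assume v: "v \<in> infinitesimals n U"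
  show "u + v \<in> infinitesimals n U" using u v by (auto simp: infinitesimals_def)
qed

text \<open>
  If \<open>z \<in> Z\<close> reduces to \<open>u\<close>, then \<open>\<epsilon>\<^sub>m u = \<epsilon>\<^sub>m z\<close> lies in \<open>Z\<close>. This produces one coefficient of \<open>y\<close> at a
  time, which is why finitely many \<open>\<epsilon>\<^sub>m\<close> are needed; the induction is on a set containing the \<open>m\<close> with
  \<open>eps_vec m y \<noteq> 0\<close>.
\<close>

lemma infinitesimals_subset:
  fixes Z :: "('a::comm_ring_1, 'n::finite) infinitesimal vec set"
  assumes Z: "submod n Z"
  shows "infinitesimals n (std_vec ` Z) \<subseteq> Z"
proof
  fix y :: "('a, 'n) infinitesimal vec" assume y: "y \<in> infinitesimals n (std_vec ` Z)"
  have "y \<in> Z"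
    if "finite F" "y \<in> infinitesimals n (std_vec ` Z)" "\<And>m. m \<notin> F \<Longrightarrow> eps_vec m y = 0\<^sub>v n" for F y
    using that
  proof (induction F arbitrary: y)
    case empty
    then have "y = 0\<^sub>v n"
      by (intro infinitesimal_vec_eqI[of _ n]) (auto simp: infinitesimals_def)
    then show ?case using submod_zero[OF Z] by simp
  next
    case (insert m F)
    from insert.prems(1) obtain z where z: "z \<in> Z" "eps_vec m y = std_vec z"
      by (auto simp: infinitesimals_def)
    \<comment> \<open>the generator \<open>\<epsilon>\<^sub>m\<close>\<close>
    define e where "e = Eps 0 (\<lambda>k. if k = m then 1 else 0 :: 'a)"
    have e: "std_part e = 0" "eps_part e k = (if k = m then 1 else 0)" for k
      by (auto simp: e_def)
    have zc [simp]: "z \<in> carrier_vec n" and yc [simp]: "y \<in> carrier_vec n"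
      using z submod_carrier[OF Z] insert.prems by (auto simp: infinitesimals_def)
    have ezc [simp]: "e \<cdot>\<^sub>v z \<in> carrier_vec n" by simp
    have dims: "dim_vec z = n" "dim_vec y = n" using zc yc by auto
    have sub: "submod n (std_vec ` Z)" by (rule submod_std_image[OF Z])
    have ez: "std_vec (e \<cdot>\<^sub>v z) = 0\<^sub>v n" "eps_vec k (e \<cdot>\<^sub>v z) = (if k = m then std_vec z else 0\<^sub>v n)" for k
      by (auto simp: e dims intro!: eq_vecI)
    have "e \<cdot>\<^sub>v z \<in> infinitesimals n (std_vec ` Z)"
      using ez z submod_zero[OF sub] by (auto simp: infinitesimals_def)
    then have "y - e \<cdot>\<^sub>v z \<in> infinitesimals n (std_vec ` Z)"
      by (intro submod_minus[OF infinitesimals_submod[OF sub]] insert.prems(1))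
    moreover have "eps_vec k (y - e \<cdot>\<^sub>v z) = 0\<^sub>v n" if "k \<notin> F" for k
      using ez(2)[of k] z(2) insert.prems(2)[of k] that
      by (cases "k = m") (auto simp del: infinitesimal_vec_smult simp: dims)
    ultimately have "y - e \<cdot>\<^sub>v z \<in> Z" by (rule insert.IH)
    moreover have "e \<cdot>\<^sub>v z \<in> Z" using z submod_smult[OF Z] by blast
    ultimately have "(y - e \<cdot>\<^sub>v z) + e \<cdot>\<^sub>v z \<in> Z" by (rule submod_add[OF Z])
    moreover have "(y - e \<cdot>\<^sub>v z) + e \<cdot>\<^sub>v z = y" by (intro eq_vecI) (auto simp: dims)
    ultimately show ?case by simp
  qed
  from this[of UNIV, OF _ y] show "y \<in> Z" by auto
qed

section \<open>Flat lifts and direct summands\<close>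

text \<open>
  For finitely many \<open>\<epsilon>\<^sub>m\<close> the last condition says that the elements of \<open>Z\<close> all of whose entries are
  combinations of the \<open>\<epsilon>\<^sub>m\<close> are generated by the \<open>\<epsilon>\<^sub>m z\<close> with \<open>z \<in> Z\<close>. Over a field \<open>K\<close> it expresses that the quotient by \<open>Z\<close> is flat over \<open>K[\<epsilon>\<^sub>m]\<close>.
\<close>

definition flat_lift :: "nat \<Rightarrow> 'a::comm_ring_1 vec set \<Rightarrow> ('a, 'n) infinitesimal vec set \<Rightarrow> bool" where
  "flat_lift n U Z \<longleftrightarrow> submod n Z \<and> std_vec ` Z = U \<and> {z \<in> Z. std_vec z = 0\<^sub>v n} = infinitesimals n U"

text \<open>
  Let \<open>z \<in> Z\<close> reduce to \<open>0\<close> and let \<open>W\<close> be a complement of \<open>Z\<close>. Decomposing each coefficient of \<open>z\<close> along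
  \<open>Z\<close> and \<open>W\<close> and multiplying by the corresponding \<open>\<epsilon>\<^sub>m\<close> gives \<open>z = y + y'\<close>, where \<open>y\<close> has its coefficients in
  the reduction of \<open>Z\<close> and \<open>y'\<close> has them in the reduction of \<open>W\<close>. Then \<open>y' = z - y\<close> lies in \<open>Z \<inter> W = 0\<close>, so
  \<open>z = y\<close>.
\<close>

lemma direct_summand_flat_lift:
  fixes Z :: "('a::comm_ring_1, 'n::finite) infinitesimal vec set"
  assumes "direct_summand n Z"
  shows "flat_lift n (std_vec ` Z) Z"
proof -
  from assms obtain W where Z: "submod n Z" and W: "submod n W" and int: "Z \<inter> W = {0\<^sub>v n}"
    and sum: "\<And>v. v \<in> carrier_vec n \<Longrightarrow> \<exists>z\<in>Z. \<exists>w\<in>W. v = z + w"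
    unfolding direct_summand_def by blast
  note [simp] = submod_zero[OF submod_std_image[OF Z]]
  have "z \<in> infinitesimals n (std_vec ` Z)" if z: "z \<in> Z" "std_vec z = 0\<^sub>v n" for z
  proof -
    have zc [simp]: "z \<in> carrier_vec n" using submod_carrier[OF Z z(1)] .
    have "\<exists>p q. p \<in> Z \<and> q \<in> W \<and> eps_vec m z = std_vec p + std_vec q" for m
    proof -
      have mz: "eps_vec m z \<in> carrier_vec n" by simp
      have "Eps_vec (eps_vec m z) (\<lambda>_::'n. 0\<^sub>v n) \<in> carrier_vec n"
        by (rule Eps_vec_simps[where n = n]) (use mz in simp_all)
      from sum[OF this] obtain p q where pq: "p \<in> Z" "q \<in> W"
        "Eps_vec (eps_vec m z) (\<lambda>_::'n. 0\<^sub>v n) = p + q" by blast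
      have "eps_vec m z = std_vec (p + q)"
        unfolding pq(3)[symmetric] by (rule Eps_vec_simps(2)[where n = n, symmetric]) (use mz in simp_all)
      also have "\<dots> = std_vec p + std_vec q"
        using submod_carrier[OF Z pq(1)] submod_carrier[OF W pq(2)] by simp
      finally show ?thesis using pq by blast
    qed
    then obtain p q where pq: "p m \<in> Z" "q m \<in> W" "eps_vec m z = std_vec (p m) + std_vec (q m)"
      for m by metis
    have pc [simp]: "p m \<in> carrier_vec n" and qc [simp]: "q m \<in> carrier_vec n" for m
      using submod_carrier[OF Z pq(1)] submod_carrier[OF W pq(2)] by auto
    define y where "y = Eps_vec (0\<^sub>v n) (\<lambda>m. std_vec (p m))"
    define y' where "y' = Eps_vec (0\<^sub>v n) (\<lambda>m. std_vec (q m))"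
    have y [simp]: "y \<in> carrier_vec n" "std_vec y = 0\<^sub>v n" "eps_vec m y = std_vec (p m)" for m
      unfolding y_def by (rule Eps_vec_simps[where n = n]; simp)+
    have y' [simp]: "y' \<in> carrier_vec n" "std_vec y' = 0\<^sub>v n" "eps_vec m y' = std_vec (q m)" for m
      unfolding y'_def by (rule Eps_vec_simps[where n = n]; simp)+
    note [simp] = carrier_vecD[OF y(1)] carrier_vecD[OF y'(1)] carrier_vecD[OF zc]
    have "y \<in> infinitesimals n (std_vec ` Z)" "y' \<in> infinitesimals n (std_vec ` W)"
      using pq by (auto simp: infinitesimals_def)
    then have yZ: "y \<in> Z" and yW: "y' \<in> W"
      using infinitesimals_subset[OF Z] infinitesimals_subset[OF W] by auto
    have "z = y + y'"
      by (rule infinitesimal_vec_eqI[of _ n]) (auto simp: z pq(3))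
    then have "y' = z - y" by (intro eq_vecI) auto
    then have "y' \<in> Z" using submod_minus[OF Z z(1) yZ] by simp
    then have "y' = 0\<^sub>v n" using yW int by auto
    then have "z = y" using \<open>z = y + y'\<close> y(1) by simp
    then show ?thesis using pq by (auto simp: infinitesimals_def z)
  qed
  moreover have "infinitesimals n (std_vec ` Z) \<subseteq> {z \<in> Z. std_vec z = 0\<^sub>v n}"
    using infinitesimals_subset[OF Z] by (auto simp: infinitesimals_def)
  ultimately show ?thesis using Z by (auto simp: flat_lift_def)
qed

text \<open>
  If \<open>W\<close> is a complement of \<open>U\<close>, then \<open>W \<otimes> K[\<epsilon>\<^sub>m]\<close>, called \<open>X\<close> in the proof, is a complement of \<open>Z\<close>: both the
  reduction and the coefficients of the \<open>\<epsilon>\<^sub>m\<close> can be decomposed along \<open>U\<close> and \<open>W\<close>.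
\<close>

lemma flat_lift_direct_summand:
  fixes Z :: "('a::comm_ring_1, 'n::finite) infinitesimal vec set"
  assumes U: "direct_summand n U" and Z: "flat_lift n U Z"
  shows "direct_summand n Z"
proof -
  from U obtain W where U: "submod n U" and W: "submod n W" and int: "U \<inter> W = {0\<^sub>v n}"
    and sum: "\<And>v. v \<in> carrier_vec n \<Longrightarrow> \<exists>u\<in>U. \<exists>w\<in>W. v = u + w"
    unfolding direct_summand_def by blast
  from Z have Zs: "submod n Z" and ZU: "std_vec ` Z = U"
    and Zi: "{z \<in> Z. std_vec z = 0\<^sub>v n} = infinitesimals n U" by (auto simp: flat_lift_def)
  define X :: "('a, 'n) infinitesimal vec set"
    where "X = {x \<in> carrier_vec n. std_vec x \<in> W \<and> (\<forall>m. eps_vec m x \<in> W)}"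
  note [simp] = submod_zero[OF W] submod_add[OF W] submod_smult[OF W]
  have X: "submod n X" by (auto simp: submod_iff X_def)
  have "z = 0\<^sub>v n" if z: "z \<in> Z" "z \<in> X" for z
  proof -
    have "std_vec z \<in> U \<inter> W" using z ZU by (auto simp: X_def)
    then have s: "std_vec z = 0\<^sub>v n" using int by auto
    then have "z \<in> infinitesimals n U" using z Zi by auto
    then have "eps_vec m z \<in> U \<inter> W" for m using z by (auto simp: infinitesimals_def X_def)
    then have e: "eps_vec m z = 0\<^sub>v n" for m using int by auto
    show ?thesis
      using z by (intro infinitesimal_vec_eqI[of _ n]) (auto simp: s e X_def)
  qed
  moreover have "0\<^sub>v n \<in> Z \<inter> X" using submod_zero[OF Zs] submod_zero[OF X] by simp
  moreover have "\<exists>z\<in>Z. \<exists>x\<in>X. v = z + x" if v: "v \<in> carrier_vec n" for v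
  proof -
    have "std_vec v \<in> carrier_vec n" using v by simp
    from sum[OF this] obtain u w where uw: "u \<in> U" "w \<in> W" "std_vec v = u + w" by blast
    from uw(1) ZU obtain z where z: "z \<in> Z" "std_vec z = u" by auto
    have zc [simp]: "z \<in> carrier_vec n" using submod_carrier[OF Zs z(1)] .
    have "eps_vec m v - eps_vec m z \<in> carrier_vec n" for m using v by simp
    from sum[OF this] obtain a b where ab: "a m \<in> U" "b m \<in> W"
      "eps_vec m v - eps_vec m z = a m + b m" for m by metis
    have ac [simp]: "a m \<in> carrier_vec n" and bc [simp]: "b m \<in> carrier_vec n" for m
      using submod_carrier[OF U ab(1)] submod_carrier[OF W ab(2)] by auto
    have wc [simp]: "w \<in> carrier_vec n" using submod_carrier[OF W uw(2)] .
    define y where "y = Eps_vec (0\<^sub>v n) a"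
    define x where "x = Eps_vec w b"
    have y [simp]: "y \<in> carrier_vec n" "std_vec y = 0\<^sub>v n" "eps_vec m y = a m" for m
      unfolding y_def by (rule Eps_vec_simps[where n = n]; simp)+
    have x [simp]: "x \<in> carrier_vec n" "std_vec x = w" "eps_vec m x = b m" for m
      unfolding x_def by (rule Eps_vec_simps[where n = n]; simp)+
    note d [simp] = carrier_vecD[OF x(1)] carrier_vecD[OF y(1)] carrier_vecD[OF zc] carrier_vecD[OF v]
    have "y \<in> infinitesimals n U" using ab by (auto simp: infinitesimals_def)
    then have "z + y \<in> Z" using z(1) Zi by (auto intro!: submod_add[OF Zs])
    moreover have "x \<in> X" using uw ab by (simp add: X_def)
    moreover have "v = (z + y) + x"
    proof (rule infinitesimal_vec_eqI[of _ n])
      have "u \<in> carrier_vec n" using submod_carrier[OF U uw(1)] .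
      then show "std_vec v = std_vec ((z + y) + x)" using uw(3) z(2) by simp
      have "eps_vec m v = eps_vec m z + (eps_vec m v - eps_vec m z)" for m
        by (intro eq_vecI) auto
      then show "eps_vec m v = eps_vec m ((z + y) + x)" for m
        unfolding ab(3) using assoc_add_vec[of "eps_vec m z" n "a m" "b m"] by simp
    qed (use v in auto)
    ultimately show ?thesis by blast
  qed
  ultimately show ?thesis unfolding direct_summand_def using Zs X by blast
qed

lemma primeideal_zero_field: "primeideal {0 :: 'a::field} class_ring"
  using domain.zeroprimeideal[OF field.axioms(1)[OF class_field]] by simp

lemma primeideal_one_notin:
  assumes "primeideal P (class_ring :: 'a::comm_ring_1 ring)"
  shows "1 \<notin> P"
proof
  interpret primeideal P "class_ring :: 'a ring" by (rule assms)
  assume "1 \<in> P"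
  then have "P = UNIV" using one_imp_carrier by simp
  then show False using I_notcarr by simp
qed

lemma mult_mat_vec_submod:
  assumes B: "B \<in> carrier_mat n r" and a: "a \<in> carrier_vec r"
    and U: "submod n U" "set (cols B) \<subseteq> U"
  shows "B *\<^sub>v a \<in> U"
proof -
  have "vec n (\<lambda>i. \<Sum>j<k. B $$ (i, j) * a $ j) \<in> U" if "k \<le> r" for k
    using that
  proof (induction k)
    case 0
    have "vec n (\<lambda>i. \<Sum>j<0. B $$ (i, j) * a $ j) = 0\<^sub>v n" by (intro eq_vecI) auto
    then show ?case using submod_zero[OF U(1)] by simp
  next
    case (Suc k)
    have "col B k \<in> U" using B U(2) Suc.prems by (auto simp: cols_def)
    then have "vec n (\<lambda>i. \<Sum>j<k. B $$ (i, j) * a $ j) + a $ k \<cdot>\<^sub>v col B k \<in> U"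
      using Suc by (intro submod_add[OF U(1)] submod_smult[OF U(1)]) auto
    also have "vec n (\<lambda>i. \<Sum>j<k. B $$ (i, j) * a $ j) + a $ k \<cdot>\<^sub>v col B k =
      vec n (\<lambda>i. \<Sum>j<Suc k. B $$ (i, j) * a $ j)"
      using B Suc.prems by (intro eq_vecI) (auto simp: mult.commute)
    finally show ?case .
  qed
  from this[of r] have "vec n (\<lambda>i. \<Sum>j<r. B $$ (i, j) * a $ j) \<in> U" by simp
  also have "vec n (\<lambda>i. \<Sum>j<r. B $$ (i, j) * a $ j) = B *\<^sub>v a"
    using a B by (intro eq_vecI) (auto simp: scalar_prod_def atLeast0LessThan)
  finally show ?thesis .
qed

text \<open>
  Over a field it suffices to use the prime ideal \<open>0\<close>, and the denominators \<open>s \<noteq> 0\<close> can be inverted, so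
  the columns of \<open>B\<close> form a basis of \<open>U\<close>.
\<close>

lemma has_rank_field_basis:
  fixes U :: "'a::field vec set"
  assumes U: "submod n U" and r: "has_rank n U r"
  obtains B where "B \<in> carrier_mat n r" "set (cols B) \<subseteq> U"
    "\<And>u. u \<in> U \<Longrightarrow> \<exists>a\<in>carrier_vec r. u = B *\<^sub>v a"
    "\<And>a. a \<in> carrier_vec r \<Longrightarrow> B *\<^sub>v a = 0\<^sub>v n \<Longrightarrow> a = 0\<^sub>v r"
proof -
  from r[unfolded has_rank_def, rule_format, OF primeideal_zero_field]
  obtain B where B: "B \<in> carrier_mat n r" "set (cols B) \<subseteq> U"
    and gen: "\<And>u. u \<in> U \<Longrightarrow> \<exists>s. s \<notin> {0} \<and> (\<exists>a\<in>carrier_vec r. s \<cdot>\<^sub>v u = B *\<^sub>v a)"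
    and inj: "\<And>a. a \<in> carrier_vec r \<Longrightarrow> B *\<^sub>v a = 0\<^sub>v n \<Longrightarrow> \<exists>s. s \<notin> {0} \<and> s \<cdot>\<^sub>v a = 0\<^sub>v r"
    by (elim bexE conjE) (metis (lifting))
  show thesis
  proof (rule that[OF B])
    fix u assume "u \<in> U"
    with gen obtain s a where sa: "s \<noteq> 0" "a \<in> carrier_vec r" "s \<cdot>\<^sub>v u = B *\<^sub>v a" by blast
    have "u = inverse s \<cdot>\<^sub>v (s \<cdot>\<^sub>v u)" using sa(1) by (simp add: smult_smult_assoc)
    also have "\<dots> = B *\<^sub>v (inverse s \<cdot>\<^sub>v a)"
      unfolding sa(3) using mult_mat_vec[OF B(1) sa(2)] by simp
    finally show "\<exists>a\<in>carrier_vec r. u = B *\<^sub>v a"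
      by (rule bexI) (simp add: sa(2))
  next
    fix a assume "a \<in> carrier_vec r" "B *\<^sub>v a = 0\<^sub>v n"
    with inj obtain s where s: "s \<noteq> 0" "s \<cdot>\<^sub>v a = 0\<^sub>v r" by blast
    have "a = inverse s \<cdot>\<^sub>v (s \<cdot>\<^sub>v a)" using s(1) by (simp add: smult_smult_assoc)
    also have "\<dots> = 0\<^sub>v r" unfolding s(2) by (intro eq_vecI) auto
    finally show "a = 0\<^sub>v r" .
  qed
qed

text \<open>
  Lifts to \<open>Z\<close> of a basis of \<open>U\<close> form a basis of \<open>Z\<close>. This is Nakayama's lemma for the nilpotent ideal
  of the \<open>\<epsilon>\<^sub>m\<close>: coordinates are found first for the reduction and then for the coefficients of the
  remainder. As this basis is global, \<open>s = 1\<close> serves as denominator at every prime ideal.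
\<close>

lemma flat_lift_has_rank:
  fixes U :: "'a::field vec set" and Z :: "('a, 'n::finite) infinitesimal vec set"
  assumes r: "has_rank n U r" and Z: "flat_lift n U Z"
  shows "has_rank n Z r"
proof -
  from Z have Zs: "submod n Z" and ZU: "std_vec ` Z = U"
    and Zi: "{z \<in> Z. std_vec z = 0\<^sub>v n} = infinitesimals n U" by (auto simp: flat_lift_def)
  have U: "submod n U" using submod_std_image[OF Zs] ZU by simp
  obtain B where B: "B \<in> carrier_mat n r" "set (cols B) \<subseteq> U"
    and gen: "\<And>u. u \<in> U \<Longrightarrow> \<exists>a\<in>carrier_vec r. u = B *\<^sub>v a"
    and inj: "\<And>a. a \<in> carrier_vec r \<Longrightarrow> B *\<^sub>v a = 0\<^sub>v n \<Longrightarrow> a = 0\<^sub>v r"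
    using has_rank_field_basis[OF U r] by blast
  have "\<exists>c. c \<in> Z \<and> std_vec c = col B j" if "j < r" for j
  proof -
    have "col B j \<in> U" using B that by (auto simp: cols_def)
    then show ?thesis using ZU by auto
  qed
  then obtain c where c: "c j \<in> Z" "std_vec (c j) = col B j" if "j < r" for j by metis
  define C where "C = mat_of_cols n (map c [0..<r])"
  have C [simp]: "C \<in> carrier_mat n r" unfolding C_def carrier_mat_def by simp
  note [simp] = carrier_matD[OF C]
  have "cols C = map c [0..<r]"
    unfolding C_def using c submod_carrier[OF Zs] by (intro cols_mat_of_cols) auto
  then have CZ: "set (cols C) \<subseteq> Z" using c by auto
  have CB: "std_part (C $$ (i, j)) = B $$ (i, j)" if "i < n" "j < r" for i j
  proof -
    have "std_part (c j $ i) = std_vec (c j) $ i"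
      using that submod_carrier[OF Zs c(1)[OF that(2)]] by simp
    then show ?thesis using that B c(2)[OF that(2)] by (simp add: C_def mat_of_cols_def)
  qed
  have Ca_std: "std_vec (C *\<^sub>v a) = B *\<^sub>v std_vec a" if a: "a \<in> carrier_vec r" for a
  proof -
    have s: "std_part (sum f I) = (\<Sum>i\<in>I. std_part (f i))"
      for f :: "nat \<Rightarrow> ('a, 'n) infinitesimal" and I
      by (induction I rule: infinite_finite_induct) auto
    show ?thesis
      using a B C by (auto intro!: eq_vecI sum.cong simp: scalar_prod_def s CB)
  qed
  have Ca_eps: "eps_vec m (C *\<^sub>v a) = B *\<^sub>v eps_vec m a"
    if a: "a \<in> carrier_vec r" "std_vec a = 0\<^sub>v r" for a m
  proof -
    have s: "eps_part (sum f I) m = (\<Sum>i\<in>I. eps_part (f i) m)"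
      for f :: "nat \<Rightarrow> ('a, 'n) infinitesimal" and I
      by (induction I rule: infinite_finite_induct) auto
    have z: "std_part (a $ j) = 0" if "j < r" for j
      using arg_cong[OF a(2), of "\<lambda>v. v $ j"] a(1) that by simp
    show ?thesis
      using a B C by (auto intro!: eq_vecI sum.cong simp: scalar_prod_def s CB z)
  qed
  have surj: "\<exists>a\<in>carrier_vec r. z = C *\<^sub>v a" if z: "z \<in> Z" for z
  proof -
    have [simp]: "z \<in> carrier_vec n" using submod_carrier[OF Zs z] .
    from gen[of "std_vec z"] z ZU obtain b where b: "b \<in> carrier_vec r" "std_vec z = B *\<^sub>v b"
      by auto
    define b' where "b' = Eps_vec b (\<lambda>_::'n. 0\<^sub>v r)"
    have b' [simp]: "b' \<in> carrier_vec r" "std_vec b' = b"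
      unfolding b'_def by (rule Eps_vec_simps[where n = r]; simp add: b)+
    have Cb [simp]: "C *\<^sub>v b' \<in> carrier_vec n" by (rule mult_mat_vec_carrier[OF C b'(1)])
    have "z - C *\<^sub>v b' \<in> Z"
      by (intro submod_minus[OF Zs z] mult_mat_vec_submod[OF C b'(1) Zs CZ])
    moreover have "std_vec (z - C *\<^sub>v b') = std_vec z - std_vec (C *\<^sub>v b')"
      using carrier_vecD[OF Cb] by (intro infinitesimal_vec_simps) simp
    then have "std_vec (z - C *\<^sub>v b') = 0\<^sub>v n"
      unfolding Ca_std[OF b'(1)] b'(2) b(2) using B b by simp
    ultimately have "z - C *\<^sub>v b' \<in> infinitesimals n U" using Zi by blast
    then have "\<exists>e\<in>carrier_vec r. eps_vec m (z - C *\<^sub>v b') = B *\<^sub>v e" for m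
      using gen by (simp add: infinitesimals_def)
    then obtain e where e: "e m \<in> carrier_vec r" "eps_vec m (z - C *\<^sub>v b') = B *\<^sub>v e m" for m
      by metis
    define e' where "e' = Eps_vec (0\<^sub>v r) e"
    have e' [simp]: "e' \<in> carrier_vec r" "std_vec e' = 0\<^sub>v r" "eps_vec m e' = e m" for m
      unfolding e'_def by (rule Eps_vec_simps[where n = r]; simp add: e)+
    have Ce [simp]: "C *\<^sub>v e' \<in> carrier_vec n" by (rule mult_mat_vec_carrier[OF C e'(1)])
    have "z - C *\<^sub>v b' = C *\<^sub>v e'"
    proof (rule infinitesimal_vec_eqI[of _ n])
      show "std_vec (z - C *\<^sub>v b') = std_vec (C *\<^sub>v e')"
        unfolding \<open>std_vec (z - C *\<^sub>v b') = 0\<^sub>v n\<close> Ca_std[OF e'(1)] e'(2) using B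
        by (intro eq_vecI) auto
      show "eps_vec m (z - C *\<^sub>v b') = eps_vec m (C *\<^sub>v e')" for m
        unfolding Ca_eps[OF e'(1,2)] e'(3) e(2) ..
    qed auto
    moreover have "z = C *\<^sub>v b' + (z - C *\<^sub>v b')"
      using carrier_vecD[OF Cb] carrier_vecD[OF \<open>z \<in> carrier_vec n\<close>] by (intro eq_vecI) auto
    ultimately have "z = C *\<^sub>v b' + C *\<^sub>v e'" by simp
    also have "\<dots> = C *\<^sub>v (b' + e')" by (rule mult_add_distrib_mat_vec[OF C, symmetric]) auto
    finally show ?thesis using add_carrier_vec[OF b'(1) e'(1)] by blast
  qed
  have inj': "a = 0\<^sub>v r" if a: "a \<in> carrier_vec r" "C *\<^sub>v a = 0\<^sub>v n" for a
  proof -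
    have "B *\<^sub>v std_vec a = 0\<^sub>v n" unfolding Ca_std[OF a(1), symmetric] a(2) by simp
    then have s: "std_vec a = 0\<^sub>v r" using inj a(1) by simp
    have "B *\<^sub>v eps_vec m a = 0\<^sub>v n" for m unfolding Ca_eps[OF a(1) s, symmetric] a(2) by simp
    then have "eps_vec m a = 0\<^sub>v r" for m using inj a(1) by simp
    then show ?thesis using s a(1) by (intro infinitesimal_vec_eqI[of _ r]) auto
  qed
  show ?thesis
    unfolding has_rank_def
  proof (intro allI impI bexI[of _ C] conjI ballI)
    fix P assume "primeideal P (class_ring :: ('a, 'n) infinitesimal ring)"
    then have P: "1 \<notin> P" by (rule primeideal_one_notin)
    show "\<exists>s. s \<notin> P \<and> (\<exists>a\<in>carrier_vec r. s \<cdot>\<^sub>v u = C *\<^sub>v a)" if "u \<in> Z" for u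
      using P surj[OF that] by (intro exI[of _ 1]) simp
    show "\<exists>s. s \<notin> P \<and> s \<cdot>\<^sub>v a = 0\<^sub>v r" if "a \<in> carrier_vec r" "C *\<^sub>v a = 0\<^sub>v n" for a
      using P inj'[OF that] by (intro exI[of _ 1]) simp
  qed (use CZ in auto)
qed

lemma flat_liftD:
  assumes "flat_lift n U Z"
  shows "submod n Z" "std_vec ` Z = U" "submod n U" "infinitesimals n U \<subseteq> Z"
    "\<And>z. z \<in> Z \<Longrightarrow> std_vec z = 0\<^sub>v n \<Longrightarrow> z \<in> infinitesimals n U"
    "\<And>z. z \<in> Z \<Longrightarrow> std_vec z \<in> U"
proof -
  show Z: "submod n Z" and U: "std_vec ` Z = U" using assms by (auto simp: flat_lift_def)
  show "submod n U" using submod_std_image[OF Z] U by simp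
  have *: "{z \<in> Z. std_vec z = 0\<^sub>v n} = infinitesimals n U" using assms by (auto simp: flat_lift_def)
  then show "infinitesimals n U \<subseteq> Z" by blast
  show "z \<in> infinitesimals n U" if "z \<in> Z" "std_vec z = 0\<^sub>v n" for z using * that by blast
  show "std_vec z \<in> U" if "z \<in> Z" for z using U that by blast
qed

lemma flat_liftI:
  fixes Z :: "('a::comm_ring_1, 'n::finite) infinitesimal vec set"
  assumes "submod n Z" "std_vec ` Z = U"
    "\<And>z m. z \<in> Z \<Longrightarrow> std_vec z = 0\<^sub>v n \<Longrightarrow> eps_vec m z \<in> U"
  shows "flat_lift n U Z"
proof -
  have "infinitesimals n U \<subseteq> Z" using infinitesimals_subset[OF assms(1)] assms(2) by simp
  then show ?thesis
    using assms submod_carrier[OF assms(1)] by (auto simp: flat_lift_def infinitesimals_def)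
qed

section \<open>Base change of flat lifts\<close>

lemma (in comm_ring_hom) map_vec_hom_add:
  assumes "dim_vec x = dim_vec y"
  shows "map_vec hom (x + y) = map_vec hom x + map_vec hom y"
  using assms by (intro eq_vecI) (auto simp: hom_add)

text \<open>
  Base change of a module along \<open>\<psi>\<close>, where \<open>\<iota>\<close> makes the source of \<open>\<psi>\<close> an algebra over the residue ring. A
  scalar is the sum of a constant, which comes from the source through \<open>\<iota>\<close>, and of a nilpotent element, which
  sends the image of \<open>Z\<close> into \<open>infinitesimals n U\<close>. Hence the image and these infinitesimals together are
  already closed under all scalars.
\<close>

lemma spanned_image:
  fixes \<psi> :: "'r::comm_ring_1 \<Rightarrow> ('a::comm_ring_1, 'n::finite) infinitesimal"
  assumes \<psi>: "comm_ring_hom \<psi>" and \<iota>: "\<And>c. \<psi> (\<iota> c) = eps_const c" and Z: "submod n Z"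
    and U: "U = std_vec ` map_vec \<psi> ` Z"
  shows "submod n U"
    "spanned n (map_vec \<psi> ` Z) = {map_vec \<psi> x + y |x y. x \<in> Z \<and> y \<in> infinitesimals n U}"
proof -
  interpret \<psi>: comm_ring_hom \<psi> by (rule \<psi>)
  note c [simp] = submod_carrier[OF Z]
  have d [simp]: "dim_vec x = n" if "x \<in> Z" for x using c[OF that] by auto
  have scale: "eps_const a \<cdot>\<^sub>v map_vec \<psi> x = map_vec \<psi> (\<iota> a \<cdot>\<^sub>v x)" for a x
    by (simp add: \<psi>.vec_hom_smult \<iota>)
  show Us: "submod n U"
    unfolding submod_iff
  proof (intro conjI ballI allI)
    show "U \<subseteq> carrier_vec n" by (auto simp: U)
    have "map_vec \<psi> (0\<^sub>v n) \<in> map_vec \<psi> ` Z" using submod_zero[OF Z] by blast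
    moreover have "std_vec (map_vec \<psi> (0\<^sub>v n)) = 0\<^sub>v n" by (intro eq_vecI) auto
    ultimately show "0\<^sub>v n \<in> U" unfolding U by (rule image_eqI[OF sym, rotated])
    fix u assume "u \<in> U"
    then obtain x where x: "x \<in> Z" "u = std_vec (map_vec \<psi> x)" by (auto simp: U)
    have "c \<cdot>\<^sub>v u = std_vec (eps_const c \<cdot>\<^sub>v map_vec \<psi> x)" for c using x by simp
    then show "c \<cdot>\<^sub>v u \<in> U" for c
      unfolding U using submod_smult[OF Z x(1)] scale by auto
    fix v assume "v \<in> U"
    then obtain y where y: "y \<in> Z" "v = std_vec (map_vec \<psi> y)" by (auto simp: U)
    have "u + v = std_vec (map_vec \<psi> (x + y))"
      using x y by (simp add: \<psi>.map_vec_hom_add)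
    then show "u + v \<in> U" unfolding U using submod_add[OF Z x(1) y(1)] by auto
  qed
  note I = infinitesimals_submod[OF Us, where ?'b = 'n]
  let ?N = "{map_vec \<psi> x + y |x y. x \<in> Z \<and> y \<in> infinitesimals n U}"
  show "spanned n (map_vec \<psi> ` Z) = ?N"
  proof (rule spanned_eqI)
    show "map_vec \<psi> ` Z \<subseteq> ?N"
    proof
      fix z assume "z \<in> map_vec \<psi> ` Z"
      then obtain x where "x \<in> Z" "z = map_vec \<psi> x + 0\<^sub>v n" by auto
      then show "z \<in> ?N" using submod_zero[OF I] by blast
    qed
    show "submod n ?N"
      unfolding submod_iff
    proof (intro conjI ballI allI)
      show "?N \<subseteq> carrier_vec n" using submod_carrier[OF I] by auto
      have "0\<^sub>v n = map_vec \<psi> (0\<^sub>v n) + 0\<^sub>v n" by (intro eq_vecI) auto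
      then show "0\<^sub>v n \<in> ?N" using submod_zero[OF I] submod_zero[OF Z] by blast
      fix u assume "u \<in> ?N"
      then obtain x y where u: "x \<in> Z" "y \<in> infinitesimals n U" "u = map_vec \<psi> x + y" by blast
      have yc [simp]: "y \<in> carrier_vec n" using submod_carrier[OF I u(2)] .
      have yd [simp]: "dim_vec y = n" using yc by auto
      show "a \<cdot>\<^sub>v u \<in> ?N" for a
      proof -
        \<comment> \<open>the nilpotent part of the scalar \<open>a\<close>\<close>
        let ?b = "a - eps_const (std_part a)"
        have "?b \<cdot>\<^sub>v map_vec \<psi> x \<in> infinitesimals n U"
        proof -
          have "std_vec (map_vec \<psi> x) \<in> U" using u(1) by (auto simp: U)
          moreover have "0 \<cdot>\<^sub>v eps_vec m (map_vec \<psi> x) + e \<cdot>\<^sub>v std_vec (map_vec \<psi> x)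
            = e \<cdot>\<^sub>v std_vec (map_vec \<psi> x)" for e m
            by (intro eq_vecI) auto
          moreover have "0 \<cdot>\<^sub>v std_vec (map_vec \<psi> x) = 0\<^sub>v n" using u(1) by (intro eq_vecI) auto
          ultimately show ?thesis using u(1) submod_smult[OF Us] by (auto simp: infinitesimals_def)
        qed
        then have "?b \<cdot>\<^sub>v map_vec \<psi> x + a \<cdot>\<^sub>v y \<in> infinitesimals n U"
          using submod_add[OF I] submod_smult[OF I u(2)] by blast
        moreover have "a \<cdot>\<^sub>v u = map_vec \<psi> (\<iota> (std_part a) \<cdot>\<^sub>v x) + (?b \<cdot>\<^sub>v map_vec \<psi> x + a \<cdot>\<^sub>v y)"
          unfolding scale[symmetric] u(3) using u(1) by (intro eq_vecI) (auto simp: algebra_simps)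
        ultimately show ?thesis using submod_smult[OF Z u(1)] by blast
      qed
      fix v assume "v \<in> ?N"
      then obtain p q where v: "p \<in> Z" "q \<in> infinitesimals n U" "v = map_vec \<psi> p + q" by blast
      have qd [simp]: "dim_vec q = n" using submod_carrier[OF I v(2)] by auto
      have "u + v = map_vec \<psi> (x + p) + (y + q)"
        unfolding u(3) v(3) \<psi>.map_vec_hom_add[of x p, unfolded d[OF u(1)] d[OF v(1)], OF refl]
        using u(1) v(1) by (intro eq_vecI) auto
      then show "u + v \<in> ?N" using submod_add[OF Z u(1) v(1)] submod_add[OF I u(2) v(2)] by blast
    qed
    fix N' assume N': "submod n N'" "map_vec \<psi> ` Z \<subseteq> N'"
    have "U \<subseteq> std_vec ` N'" using N'(2) unfolding U by blast
    then have "infinitesimals n U \<subseteq> infinitesimals n (std_vec ` N')"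
      unfolding infinitesimals_def by blast
    then show "?N \<subseteq> N'"
      using infinitesimals_subset[OF N'(1)] N'(2) submod_add[OF N'(1)] by blast
  qed
qed

text \<open>
  Algebra homomorphisms over the residue ring that preserve the ideal of the \<open>\<epsilon>\<^sub>m\<close>. That \<open>\<psi>\<close> is
  linear in the \<open>\<epsilon>\<^sub>m\<close> is stated by its effect on vectors, which is how it is used, and not by a matrix.
\<close>

definition infinitesimal_hom ::
  "(('a::comm_ring_1, 'm) infinitesimal \<Rightarrow> ('a, 'n) infinitesimal) \<Rightarrow> bool" where
  "infinitesimal_hom \<psi> \<longleftrightarrow> comm_ring_hom \<psi> \<and> (\<forall>c. \<psi> (eps_const c) = eps_const c) \<and>
     (\<forall>x. std_part (\<psi> x) = std_part x) \<and>
     (\<forall>n U. submod n U \<longrightarrow> map_vec \<psi> ` infinitesimals n U \<subseteq> infinitesimals n U)"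

lemma std_vec_map_vec:
  "(\<And>x. std_part (\<psi> x) = std_part x) \<Longrightarrow> std_vec (map_vec \<psi> v) = std_vec v"
  by (intro eq_vecI) auto

lemma spanned_infinitesimal_hom:
  fixes \<psi> :: "('a::comm_ring_1, 'm) infinitesimal \<Rightarrow> ('a, 'n::finite) infinitesimal"
  assumes \<psi>: "infinitesimal_hom \<psi>" and Z: "submod n Z" "std_vec ` Z = U"
  shows "spanned n (map_vec \<psi> ` Z) = {map_vec \<psi> x + y |x y. x \<in> Z \<and> y \<in> infinitesimals n U}"
proof -
  have "U = std_vec ` map_vec \<psi> ` Z"
    using Z(2) \<psi> by (auto simp: infinitesimal_hom_def image_image std_vec_map_vec)
  then show ?thesis
    using spanned_image(2)[of \<psi> eps_const, OF _ _ Z(1)] \<psi> by (auto simp: infinitesimal_hom_def)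
qed

text \<open>
  If \<open>\<psi> x + y\<close> with \<open>y\<close> infinitesimal reduces to \<open>0\<close>, so does \<open>x\<close>, and then flatness of \<open>Z\<close> puts the
  coefficients of \<open>x\<close>, hence of \<open>\<psi> x\<close>, into \<open>U\<close>.
\<close>

lemma flat_lift_infinitesimal_hom:
  fixes \<psi> :: "('a::comm_ring_1, 'm) infinitesimal \<Rightarrow> ('a, 'n::finite) infinitesimal"
  assumes \<psi>: "infinitesimal_hom \<psi>" and Z: "flat_lift n U Z"
  shows "flat_lift n U (spanned n (map_vec \<psi> ` Z))"
proof -
  note Z' = flat_liftD[OF Z]
  have std: "std_vec (map_vec \<psi> v) = std_vec v" for v
    using \<psi> by (simp add: infinitesimal_hom_def std_vec_map_vec)
  have c: "map_vec \<psi> ` Z \<subseteq> carrier_vec n" using submod_carrier[OF Z'(1)] by auto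
  note eq = spanned_infinitesimal_hom[OF \<psi> Z'(1,2)]
  have y: "dim_vec y = n" "std_vec y = 0\<^sub>v n" "eps_vec m y \<in> U"
    if "y \<in> infinitesimals n U" for m and y :: "('a, 'n) infinitesimal vec"
    using that by (auto simp: infinitesimals_def)
  have x: "dim_vec x = n" if "x \<in> Z" for x using submod_carrier[OF Z'(1) that] by auto
  have s: "std_vec (map_vec \<psi> x + y) = std_vec x" if "x \<in> Z" "y \<in> infinitesimals n U" for x y
    using that y x submod_carrier[OF Z'(1) that(1)] by (simp add: std)
  show ?thesis
  proof (rule flat_liftI)
    show "submod n (spanned n (map_vec \<psi> ` Z))" by (rule spanned_submod[OF c])
    have "0\<^sub>v n \<in> infinitesimals n U" by (rule submod_zero[OF infinitesimals_submod[OF Z'(3)]])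
    then show "std_vec ` spanned n (map_vec \<psi> ` Z) = U"
      unfolding eq Z'(2)[symmetric] using s Z'(2) by (fastforce simp: image_iff)
    fix z m assume z: "z \<in> spanned n (map_vec \<psi> ` Z)" "std_vec z = 0\<^sub>v n"
    then obtain x y where xy: "x \<in> Z" "y \<in> infinitesimals n U" "z = map_vec \<psi> x + y"
      unfolding eq by blast
    then have "x \<in> infinitesimals n U" using z(2) s Z'(5) by simp
    then have "map_vec \<psi> x \<in> infinitesimals n U"
      using \<psi>[unfolded infinitesimal_hom_def] Z'(3) by blast
    then have "z \<in> infinitesimals n U"
      unfolding xy(3) by (rule submod_add[OF infinitesimals_submod[OF Z'(3)] _ xy(2)])
    then show "eps_vec m z \<in> U" by (simp add: infinitesimals_def)
  qed
qed

lemma eps_const_hom: "comm_ring_hom (eps_const :: 'a::comm_ring_1 \<Rightarrow> ('a, 'n) infinitesimal)"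
  by unfold_locales (auto simp: infinitesimal_eq_iff)

text \<open>
  The constant family \<open>U \<otimes> K[\<epsilon>\<^sub>m]\<close>, which becomes the origin of the tangent space.
\<close>

lemma spanned_eps_const:
  fixes U :: "'a::comm_ring_1 vec set"
  assumes U: "submod n U"
  defines "Z \<equiv> ({z \<in> carrier_vec n. std_vec z \<in> U \<and> (\<forall>m. eps_vec m z \<in> U)} ::
    ('a, 'n::finite) infinitesimal vec set)"
  shows "spanned n (map_vec eps_const ` U) = Z" "flat_lift n U Z"
proof -
  note c [simp] = submod_carrier[OF U] submod_zero[OF U] submod_add[OF U] submod_smult[OF U]
  have std: "std_vec (map_vec eps_const u :: ('a, 'n) infinitesimal vec) = u" for u
    by (intro eq_vecI) auto
  have eps: "eps_vec m (map_vec eps_const u :: ('a, 'n) infinitesimal vec) = 0\<^sub>v (dim_vec u)" for u m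
    by (intro eq_vecI) auto
  have dU [simp]: "dim_vec u = n" if "u \<in> U" for u using c(1)[OF that] by auto
  have "U = std_vec ` map_vec (eps_const :: 'a \<Rightarrow> ('a, 'n) infinitesimal) ` U"
    by (simp add: image_image std)
  from spanned_image(2)[OF eps_const_hom _ U this, of id]
  have "spanned n (map_vec eps_const ` U) =
    {map_vec eps_const x + y |x (y :: ('a, 'n) infinitesimal vec). x \<in> U \<and> y \<in> infinitesimals n U}"
    by simp
  also have "\<dots> = Z"
  proof (intro equalityI subsetI)
    fix z :: "('a, 'n) infinitesimal vec"
    assume "z \<in> {map_vec eps_const x + y |x y. x \<in> U \<and> y \<in> infinitesimals n U}"
    then obtain x and y :: "('a, 'n) infinitesimal vec" where
      xy: "x \<in> U" "y \<in> infinitesimals n U" "z = map_vec eps_const x + y" by blast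
    from xy(2) have [simp]: "dim_vec y = n" "y \<in> carrier_vec n" by (auto simp: infinitesimals_def)
    have [simp]: "eps_vec m y \<in> U" for m using xy(2) by (simp add: infinitesimals_def)
    show "z \<in> Z" using xy by (simp add: Z_def xy(3) std eps infinitesimals_def)
  next
    fix z assume z: "z \<in> Z"
    then have zc: "dim_vec z = n" by (auto simp: Z_def)
    let ?e = "map_vec eps_const (std_vec z) :: ('a, 'n) infinitesimal vec"
    have "z = ?e + (z - ?e)" by (intro eq_vecI) auto
    moreover have "z - ?e \<in> infinitesimals n U"
      using z zc by (auto simp: infinitesimals_def Z_def std eps)
    ultimately show "z \<in> {map_vec eps_const x + y |x y. x \<in> U \<and> y \<in> infinitesimals n U}"
      using z by (auto simp: Z_def)
  qed
  finally show "spanned n (map_vec eps_const ` U) = Z" .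
  then have Zs: "submod n Z"
    using spanned_submod[of "map_vec eps_const ` U :: ('a, 'n) infinitesimal vec set" n] c(1)
    by (metis image_subsetI map_carrier_vec)
  have "u \<in> std_vec ` Z" if "u \<in> U" for u
    using that by (intro image_eqI[of _ _ "map_vec eps_const u"]) (auto simp: Z_def std eps)
  then show "flat_lift n U Z"
    using Zs by (intro flat_liftI) (auto simp: Z_def)
qed

lemma
  fixes c :: "'a::comm_ring_1" and v :: "('a, unit) infinitesimal vec" and z :: "('a, bool) infinitesimal vec"
  shows eps_scale_hom: "infinitesimal_hom (eps_scale c)"
    and eps_proj_hom: "infinitesimal_hom (eps_proj b :: ('a::comm_ring_1, bool) infinitesimal \<Rightarrow> _)"
    and eps_fold_hom: "infinitesimal_hom (eps_fold :: ('a::comm_ring_1, bool) infinitesimal \<Rightarrow> _)"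
    and std_vec_eps_scale [simp]: "std_vec (map_vec (eps_scale c) v) = std_vec v"
    and std_vec_eps_proj [simp]: "std_vec (map_vec (eps_proj b) z) = std_vec z"
    and std_vec_eps_fold [simp]: "std_vec (map_vec eps_fold z) = std_vec z"
    and eps_vec_eps_scale [simp]: "eps_vec m (map_vec (eps_scale c) v) = c \<cdot>\<^sub>v eps_vec () v"
    and eps_vec_eps_proj [simp]: "eps_vec m (map_vec (eps_proj b) z) = eps_vec b z"
    and eps_vec_eps_fold [simp]: "eps_vec m (map_vec eps_fold z) = eps_vec True z + eps_vec False z"
proof -
  show *: "std_vec (map_vec (eps_scale c) v) = std_vec v"
    "std_vec (map_vec (eps_proj b) z) = std_vec z"
    "std_vec (map_vec eps_fold z) = std_vec z"
    "eps_vec m (map_vec (eps_scale c) v) = c \<cdot>\<^sub>v eps_vec () v"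
    "eps_vec m (map_vec (eps_proj b) z) = eps_vec b z"
    "eps_vec m (map_vec eps_fold z) = eps_vec True z + eps_vec False z"
    for b c m and v :: "('a, unit) infinitesimal vec" and z :: "('a, bool) infinitesimal vec"
    by (auto intro!: eq_vecI simp: eps_scale_def eps_proj_def eps_fold_def)
  have "comm_ring_hom (eps_scale c)"
    by unfold_locales (auto simp: infinitesimal_eq_iff eps_scale_def algebra_simps)
  then show "infinitesimal_hom (eps_scale c)"
    by (auto simp: infinitesimal_hom_def infinitesimal_eq_iff infinitesimals_def * submod_smult)
      (auto simp: eps_scale_def)
  have "comm_ring_hom (eps_proj b :: ('a, bool) infinitesimal \<Rightarrow> _)"
    by unfold_locales (auto simp: infinitesimal_eq_iff eps_proj_def)
  then show "infinitesimal_hom (eps_proj b :: ('a, bool) infinitesimal \<Rightarrow> _)"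
    by (auto simp: infinitesimal_hom_def infinitesimal_eq_iff infinitesimals_def *)
      (auto simp: eps_proj_def)
  have "comm_ring_hom (eps_fold :: ('a, bool) infinitesimal \<Rightarrow> _)"
    by unfold_locales (auto simp: infinitesimal_eq_iff eps_fold_def algebra_simps)
  then show "infinitesimal_hom (eps_fold :: ('a, bool) infinitesimal \<Rightarrow> _)"
    by (auto simp: infinitesimal_hom_def infinitesimal_eq_iff infinitesimals_def * submod_add)
      (auto simp: eps_fold_def)
qed

section \<open>Displacements of flat lifts over the dual numbers\<close>

text \<open>
  The displacements \<open>v\<close> of a vector \<open>u\<close>, that is the relation \<open>u + \<epsilon> v \<in> V\<close>.
\<close>

definition graph :: "('a, unit) infinitesimal vec set \<Rightarrow> ('a vec \<times> 'a vec) set" where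
  "graph V = (\<lambda>z. (std_vec z, eps_vec () z)) ` V"

lemma graphI: "z \<in> V \<Longrightarrow> (std_vec z, eps_vec () z) \<in> graph V"
  by (auto simp: graph_def)

lemma graphE:
  assumes "(u, v) \<in> graph V" obtains z where "z \<in> V" "std_vec z = u" "eps_vec () z = v"
  using assms by (auto simp: graph_def)

lemma dual_vec_eqI:
  fixes x y :: "('a::comm_ring_1, unit) infinitesimal vec"
  assumes "x \<in> carrier_vec n" "y \<in> carrier_vec n" "std_vec x = std_vec y" "eps_vec () x = eps_vec () y"
  shows "x = y"
  using assms by (intro infinitesimal_vec_eqI[of x n y]) auto

lemma mem_graph_iff:
  fixes V :: "('a::comm_ring_1, unit) infinitesimal vec set"
  assumes "submod n V" "z \<in> carrier_vec n"
  shows "(std_vec z, eps_vec () z) \<in> graph V \<longleftrightarrow> z \<in> V"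
proof
  assume "(std_vec z, eps_vec () z) \<in> graph V"
  then obtain x where x: "x \<in> V" "std_vec x = std_vec z" "eps_vec () x = eps_vec () z"
    by (rule graphE)
  have "x = z" by (rule dual_vec_eqI[OF submod_carrier[OF assms(1) x(1)] assms(2) x(2,3)])
  with x(1) show "z \<in> V" by simp
qed (rule graphI)

lemma dual_vec_exists:
  fixes u v :: "'a::comm_ring_1 vec"
  assumes "u \<in> carrier_vec n" "v \<in> carrier_vec n"
  obtains z :: "('a, unit) infinitesimal vec"
    where "z \<in> carrier_vec n" "std_vec z = u" "eps_vec () z = v"
  using assms by (intro that[of "Eps_vec u (\<lambda>_. v)"] Eps_vec_simps)

text \<open>
  For a flat lift of \<open>U\<close> the graph is a linear relation, defined on all of \<open>U\<close>, whose values are cosets of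
  \<open>U\<close>: the graph of a linear map \<open>U \<Rightarrow> K\<^sup>n / U\<close>.
\<close>

lemma flat_lift_graph:
  assumes V: "flat_lift n U (V :: ('a::comm_ring_1, unit) infinitesimal vec set)"
  shows graph_carrier: "(u, v) \<in> graph V \<Longrightarrow> u \<in> carrier_vec n \<and> v \<in> carrier_vec n"
    and graph_fst: "(u, v) \<in> graph V \<Longrightarrow> u \<in> U"
    and graph_total: "u \<in> U \<Longrightarrow> \<exists>v. (u, v) \<in> graph V"
    and graph_add: "(u, v) \<in> graph V \<Longrightarrow> (u', v') \<in> graph V \<Longrightarrow> (u + u', v + v') \<in> graph V"
    and graph_smult: "(u, v) \<in> graph V \<Longrightarrow> (c \<cdot>\<^sub>v u, c \<cdot>\<^sub>v v) \<in> graph V"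
    and graph_zero: "(0\<^sub>v n, v) \<in> graph V \<longleftrightarrow> v \<in> U"
    and graph_diff: "(u, v) \<in> graph V \<Longrightarrow> (u, v') \<in> graph V \<Longrightarrow> v - v' \<in> U"
    and graph_shift: "(u, v) \<in> graph V \<Longrightarrow> w \<in> U \<Longrightarrow> (u, v + w) \<in> graph V"
proof -
  note D = flat_liftD[OF V]
  note c = submod_carrier[OF D(1)]
  show car: "u \<in> carrier_vec n \<and> v \<in> carrier_vec n" if "(u, v) \<in> graph V" for u v
    using that c by (auto simp: graph_def)
  show "u \<in> U" if "(u, v) \<in> graph V" for u v using that D(2) by (auto simp: graph_def)
  show "\<exists>v. (u, v) \<in> graph V" if "u \<in> U" for u using that D(2) by (auto simp: graph_def)
  show add: "(u + u', v + v') \<in> graph V" if uv: "(u, v) \<in> graph V" "(u', v') \<in> graph V" for u v u' v'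
  proof -
    from uv obtain z z' where z: "z \<in> V" "z' \<in> V" "std_vec z = u" "std_vec z' = u'"
      "eps_vec () z = v" "eps_vec () z' = v'" by (metis graphE)
    have "dim_vec z = dim_vec z'" using c[OF z(1)] c[OF z(2)] by auto
    then show ?thesis using graphI[OF submod_add[OF D(1) z(1,2)]] z by simp
  qed
  show smult: "(c \<cdot>\<^sub>v u, c \<cdot>\<^sub>v v) \<in> graph V" if uv: "(u, v) \<in> graph V" for c u v
  proof -
    from uv obtain z where z: "z \<in> V" "std_vec z = u" "eps_vec () z = v" by (metis graphE)
    have "c \<cdot>\<^sub>v v + 0 \<cdot>\<^sub>v u = c \<cdot>\<^sub>v v" using car[OF uv] by (intro eq_vecI) auto
    then show ?thesis using graphI[OF submod_smult[OF D(1) z(1), of "eps_const c"]] z by simp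
  qed
  show zero: "(0\<^sub>v n, v) \<in> graph V \<longleftrightarrow> v \<in> U" for v
  proof
    assume "(0\<^sub>v n, v) \<in> graph V"
    then obtain z where "z \<in> V" "std_vec z = 0\<^sub>v n" "eps_vec () z = v" by (metis graphE)
    then show "v \<in> U" using D(5) by (auto simp: infinitesimals_def)
  next
    assume v: "v \<in> U"
    obtain z :: "('a, unit) infinitesimal vec"
      where z: "z \<in> carrier_vec n" "std_vec z = 0\<^sub>v n" "eps_vec () z = v"
      using dual_vec_exists[of "0\<^sub>v n" n v] submod_carrier[OF D(3) v] by auto
    then have "z \<in> V" using v D(4) by (auto simp: infinitesimals_def)
    then show "(0\<^sub>v n, v) \<in> graph V" using graphI[of z V] z by simp
  qed
  show "v - v' \<in> U" if uv: "(u, v) \<in> graph V" "(u, v') \<in> graph V" for u v v'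
  proof -
    have "(u + (- 1) \<cdot>\<^sub>v u, v + (- 1) \<cdot>\<^sub>v v') \<in> graph V" by (intro add smult uv)
    moreover have "u + (- 1) \<cdot>\<^sub>v u = 0\<^sub>v n" using car[OF uv(1)] by (intro eq_vecI) auto
    moreover have "v + (- 1) \<cdot>\<^sub>v v' = v - v'" using car[OF uv(1)] car[OF uv(2)] by (intro eq_vecI) auto
    ultimately show ?thesis using zero by simp
  qed
  show "(u, v + w) \<in> graph V" if uv: "(u, v) \<in> graph V" "w \<in> U" for u v w
    using add[OF uv(1), of "0\<^sub>v n" w] uv(2) zero car[OF uv(1)] by simp
qed

text \<open>
  Every linear map \<open>U \<Rightarrow> K\<^sup>n / U\<close> arises from a flat lift. Closure under the scalar \<open>a + b \<epsilon>\<close> holds because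
  it maps \<open>u + \<epsilon> v\<close> to \<open>a u + \<epsilon> (a v + b u)\<close>, and \<open>b u\<close> belongs to the indeterminacy \<open>U\<close>.
\<close>

lemma flat_lift_of_graph:
  fixes U :: "'a::comm_ring_1 vec set"
  assumes U: "submod n U" and G: "G \<subseteq> U \<times> carrier_vec n" "fst ` G = U"
    and add: "\<And>u v u' v'. (u, v) \<in> G \<Longrightarrow> (u', v') \<in> G \<Longrightarrow> (u + u', v + v') \<in> G"
    and smult: "\<And>c u v. (u, v) \<in> G \<Longrightarrow> (c \<cdot>\<^sub>v u, c \<cdot>\<^sub>v v) \<in> G"
    and zero: "\<And>v. (0\<^sub>v n, v) \<in> G \<longleftrightarrow> v \<in> U"
  defines "V \<equiv> {z \<in> carrier_vec n. (std_vec z, eps_vec () z) \<in> G}"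
  shows "flat_lift n U V" "graph V = G"
proof -
  have Vs: "submod n V"
    unfolding submod_iff
  proof (intro conjI ballI allI)
    show "V \<subseteq> carrier_vec n" by (auto simp: V_def)
    show "0\<^sub>v n \<in> V" using zero submod_zero[OF U] by (simp add: V_def)
    fix x assume x: "x \<in> V"
    show "x + y \<in> V" if "y \<in> V" for y using x that add by (auto simp: V_def)
    fix a :: "('a, unit) infinitesimal"
    have "std_vec x \<in> U" using x G by (auto simp: V_def)
    then have "(0\<^sub>v n, eps_part a () \<cdot>\<^sub>v std_vec x) \<in> G" using zero submod_smult[OF U] by simp
    moreover have "(std_part a \<cdot>\<^sub>v std_vec x, std_part a \<cdot>\<^sub>v eps_vec () x) \<in> G"
      using x smult by (auto simp: V_def)
    ultimately have "(std_part a \<cdot>\<^sub>v std_vec x + 0\<^sub>v n,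
        std_part a \<cdot>\<^sub>v eps_vec () x + eps_part a () \<cdot>\<^sub>v std_vec x) \<in> G" using add by blast
    moreover have "x \<in> carrier_vec n" using x by (simp add: V_def)
    ultimately show "a \<cdot>\<^sub>v x \<in> V" by (simp add: V_def)
  qed
  show gr: "graph V = G"
  proof (intro equalityI subsetI)
    fix p assume p: "p \<in> G"
    then have "fst p \<in> carrier_vec n" "snd p \<in> carrier_vec n"
      using G(1) submod_carrier[OF U] by auto
    then obtain z :: "('a, unit) infinitesimal vec"
      where z: "z \<in> carrier_vec n" "std_vec z = fst p" "eps_vec () z = snd p"
      using dual_vec_exists[of "fst p" n "snd p"] by blast
    have "z \<in> V" using z p by (simp add: V_def)
    then show "p \<in> graph V" using graphI[of z V] z by simp
  qed (auto simp: V_def graph_def)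
  show "flat_lift n U V"
  proof (rule flat_liftI[OF Vs])
    have "std_vec ` V = fst ` graph V" by (simp add: graph_def image_image)
    then show "std_vec ` V = U" using G(2) gr by simp
    show "eps_vec m z \<in> U" if "z \<in> V" "std_vec z = 0\<^sub>v n" for z m
      using that zero by (auto simp: V_def)
  qed
qed

lemma flat_lift_eqI:
  assumes "flat_lift n U V" "flat_lift n U W" "graph V = graph W"
  shows "V = W"
proof -
  have V: "submod n V" and W: "submod n W" using assms flat_liftD(1) by auto
  have "z \<in> V \<longleftrightarrow> z \<in> W" for z
    using mem_graph_iff[OF V, of z] mem_graph_iff[OF W, of z] assms(3)
      submod_carrier[OF V, of z] submod_carrier[OF W, of z] by blast
  then show ?thesis by blast
qed

text \<open>
  As \<open>K[\<epsilon>\<^sub>1, \<epsilon>\<^sub>2] / (\<epsilon>\<^sub>1, \<epsilon>\<^sub>2)\<^sup>2\<close> is the fibre product of two copies of the dual numbers over \<open>K\<close>, a pair of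
  modules with the same reduction glues to a module over it.
\<close>

definition fibre_product ::
  "nat \<Rightarrow> ('a, unit) infinitesimal vec set \<Rightarrow> ('a, unit) infinitesimal vec set
    \<Rightarrow> ('a, bool) infinitesimal vec set" where
  "fibre_product n V W =
     {z \<in> carrier_vec n. map_vec (eps_proj True) z \<in> V \<and> map_vec (eps_proj False) z \<in> W}"

lemma fibre_product_exists:
  fixes v w :: "('a::comm_ring_1, unit) infinitesimal vec"
  assumes "v \<in> carrier_vec n" "w \<in> carrier_vec n" "std_vec v = std_vec w"
  obtains z where "z \<in> carrier_vec n" "map_vec (eps_proj True) z = v" "map_vec (eps_proj False) z = w"
proof
  let ?z = "Eps_vec (std_vec v) (\<lambda>b. if b then eps_vec () v else eps_vec () w)"
  have z: "?z \<in> carrier_vec n" "std_vec ?z = std_vec v"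
    "eps_vec b ?z = (if b then eps_vec () v else eps_vec () w)" for b
    using assms by (intro Eps_vec_simps[where n = n]; simp)+
  show "?z \<in> carrier_vec n" by (rule z)
  show "map_vec (eps_proj True) ?z = v" "map_vec (eps_proj False) ?z = w"
    using assms z by (auto intro!: dual_vec_eqI[of _ n])
qed

lemma fibre_product_props:
  fixes V W :: "('a::comm_ring_1, unit) infinitesimal vec set"
  assumes V: "flat_lift n U V" and W: "flat_lift n U W"
  shows fibre_product_flat_lift: "flat_lift n U (fibre_product n V W)"
    and fibre_product_fst: "map_vec (eps_proj True) ` fibre_product n V W = V"
    and fibre_product_snd: "map_vec (eps_proj False) ` fibre_product n V W = W"
proof -
  note D = flat_liftD[OF V] and E = flat_liftD[OF W]
  interpret p: comm_ring_hom "eps_proj b :: ('a, bool) infinitesimal \<Rightarrow> _" for b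
    by (rule conjunct1[OF eps_proj_hom[unfolded infinitesimal_hom_def]])
  have ex: "\<exists>z\<in>fibre_product n V W. map_vec (eps_proj True) z = v \<and> map_vec (eps_proj False) z = w"
    if "v \<in> V" "w \<in> W" "std_vec v = std_vec w" for v w
    using fibre_product_exists[of v n w] that submod_carrier[OF D(1)] submod_carrier[OF E(1)]
    by (auto simp: fibre_product_def)
  show 1: "map_vec (eps_proj True) ` fibre_product n V W = V"
  proof (intro equalityI subsetI)
    fix v assume v: "v \<in> V"
    then obtain w where "w \<in> W" "std_vec v = std_vec w" using D(2) E(2) by blast
    then show "v \<in> map_vec (eps_proj True) ` fibre_product n V W" using ex v by blast
  qed (auto simp: fibre_product_def)
  show "map_vec (eps_proj False) ` fibre_product n V W = W"
  proof (intro equalityI subsetI)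
    fix w assume w: "w \<in> W"
    then obtain v where "v \<in> V" "std_vec v = std_vec w" using D(2) E(2) by (metis imageE imageI)
    then show "w \<in> map_vec (eps_proj False) ` fibre_product n V W" using ex w by blast
  qed (auto simp: fibre_product_def)
  have z: "map_vec (eps_proj b) (0\<^sub>v n :: ('a, bool) infinitesimal vec) = 0\<^sub>v n" for b
    by (intro eq_vecI) auto
  have "submod n (fibre_product n V W)"
    unfolding submod_iff fibre_product_def
    using submod_zero[OF D(1)] submod_zero[OF E(1)] submod_add[OF D(1)] submod_add[OF E(1)]
      submod_smult[OF D(1)] submod_smult[OF E(1)]
    by (auto simp: z p.map_vec_hom_add p.vec_hom_smult)
  moreover have "std_vec ` fibre_product n V W = U"
    using arg_cong[OF 1, of "(`) std_vec"] D(2) by (simp add: image_image)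
  moreover have "eps_vec b z \<in> U" if "z \<in> fibre_product n V W" "std_vec z = 0\<^sub>v n" for b z
  proof (cases b)
    case True
    have "map_vec (eps_proj True) z \<in> infinitesimals n U"
      using that by (intro D(5)) (auto simp: fibre_product_def)
    then show ?thesis using True by (simp add: infinitesimals_def)
  next
    case False
    have "map_vec (eps_proj False) z \<in> infinitesimals n U"
      using that by (intro E(5)) (auto simp: fibre_product_def)
    then show ?thesis using False by (simp add: infinitesimals_def)
  qed
  ultimately show "flat_lift n U (fibre_product n V W)" by (rule flat_liftI)
qed

text \<open>
  Let \<open>z\<close> be in the fibre product. For each of the two projections there is an element of \<open>Z\<close> with the same
  projection, up to infinitesimals with coefficients in \<open>U\<close>. These two elements of \<open>Z\<close> have the same reduction,
  so by flatness their difference has coefficients in \<open>U\<close>, and \<open>z\<close> differs from either of them by an element of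
  \<open>infinitesimals n U \<subseteq> Z\<close>.
\<close>

lemma fibre_product_unique:
  fixes Z :: "('a::comm_ring_1, bool) infinitesimal vec set"
  assumes Z: "flat_lift n U Z"
    and V: "spanned n (map_vec (eps_proj True) ` Z) = V"
    and W: "spanned n (map_vec (eps_proj False) ` Z) = W"
  shows "Z = fibre_product n V W"
proof (intro equalityI subsetI)
  note D = flat_liftD[OF Z]
  note I = infinitesimals_submod[OF D(3)]
  have c: "map_vec (eps_proj b) ` Z \<subseteq> carrier_vec n" for b
    using submod_carrier[OF D(1)] by auto
  show "z \<in> fibre_product n V W" if "z \<in> Z" for z
    using that spanned_superset[OF c[of True]] spanned_superset[OF c[of False]] V W
      submod_carrier[OF D(1)] by (auto simp: fibre_product_def)
  fix z assume z: "z \<in> fibre_product n V W"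
  then have zc: "z \<in> carrier_vec n" by (simp add: fibre_product_def)
  have pz: "map_vec (eps_proj b) z \<in> spanned n (map_vec (eps_proj b) ` Z)" for b
    using z V W by (cases b) (auto simp: fibre_product_def)
  have "\<exists>x\<in>Z. \<exists>y\<in>infinitesimals n U. map_vec (eps_proj b) z = map_vec (eps_proj b) x + y" for b
    using pz[of b] unfolding spanned_infinitesimal_hom[OF eps_proj_hom D(1,2)] by blast
  then obtain x y where x: "x b \<in> Z" and y: "y b \<in> infinitesimals n U"
    and eq: "map_vec (eps_proj b) z = map_vec (eps_proj b) (x b) + y b" for b by metis
  have xc: "x b \<in> carrier_vec n" for b using submod_carrier[OF D(1) x] .
  have yc: "y b \<in> carrier_vec n" for b using submod_carrier[OF I y] .
  note [simp] = xc yc zc carrier_vecD[OF xc] carrier_vecD[OF yc] carrier_vecD[OF zc]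
  have std: "std_vec z = std_vec (x b)" for b
    using arg_cong[OF eq[of b], of std_vec] y[of b] by (simp add: infinitesimals_def)
  have eps: "eps_vec b z = eps_vec b (x b) + eps_vec () (y b)" for b
    using arg_cong[OF eq[of b], of "eps_vec ()"] by simp
  have "x b - x True \<in> infinitesimals n U" for b
    using submod_minus[OF D(1) x[of b] x[of True]] std[of b, symmetric] std[of True, symmetric]
    by (intro D(5)) auto
  then have e: "eps_vec b (x b) - eps_vec b (x True) \<in> U" for b
    by (auto simp: infinitesimals_def)
  have "eps_vec b (z - x True) \<in> U" for b
  proof -
    have "eps_vec b (z - x True) = eps_vec b z - eps_vec b (x True)" by simp
    also have "\<dots> = eps_vec () (y b) + (eps_vec b (x b) - eps_vec b (x True))"
      unfolding eps[of b] by (intro eq_vecI) auto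
    finally have "eps_vec b (z - x True) = eps_vec () (y b) + (eps_vec b (x b) - eps_vec b (x True))" .
    moreover have "eps_vec () (y b) \<in> U" using y[of b] by (simp add: infinitesimals_def)
    ultimately show ?thesis using submod_add[OF D(3) _ e] by simp
  qed
  moreover have "std_vec (z - x True) = 0\<^sub>v n" using std[of True, symmetric] by simp
  ultimately have "z - x True \<in> infinitesimals n U" by (simp add: infinitesimals_def)
  then have "(z - x True) + x True \<in> Z" using D(4) x submod_add[OF D(1)] by blast
  moreover have "(z - x True) + x True = z" by (intro eq_vecI) auto
  ultimately show "z \<in> Z" by simp
qed

text \<open>
  An invertible \<open>c\<close> would allow \<open>w\<close> to be absorbed into \<open>v\<close>. For \<open>c = 0\<close> it makes the value a whole coset of
  \<open>U\<close>.
\<close>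

lemma graph_eps_scale:
  fixes V :: "('a::comm_ring_1, unit) infinitesimal vec set"
  assumes V: "flat_lift n U V"
  shows "graph (spanned n (map_vec (eps_scale c) ` V)) =
    {(u, c \<cdot>\<^sub>v v + w) |u v w. (u, v) \<in> graph V \<and> w \<in> U}"
proof -
  note D = flat_liftD[OF V]
  have "graph (spanned n (map_vec (eps_scale c) ` V)) =
    {(std_vec x, c \<cdot>\<^sub>v eps_vec () x + eps_vec () y) |x y. x \<in> V \<and> y \<in> infinitesimals n U}"
    (is "_ = ?R")
  proof -
    have *: "std_vec (map_vec (eps_scale c) x + y) = std_vec x"
      "eps_vec () (map_vec (eps_scale c) x + y) = c \<cdot>\<^sub>v eps_vec () x + eps_vec () y"
      if "x \<in> V" "y \<in> infinitesimals n U" for x y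
      using that submod_carrier[OF D(1) that(1)] by (auto simp: infinitesimals_def)
    show ?thesis
      unfolding graph_def spanned_infinitesimal_hom[OF eps_scale_hom D(1,2)]
      using * by (fastforce simp: image_iff)
  qed
  also have "?R = {(u, c \<cdot>\<^sub>v v + w) |u v w. (u, v) \<in> graph V \<and> w \<in> U}"
  proof -
    have "\<exists>y::('a, unit) infinitesimal vec. y \<in> infinitesimals n U \<and> eps_vec () y = w" if w: "w \<in> U" for w
    proof -
      obtain y :: "('a, unit) infinitesimal vec"
        where "y \<in> carrier_vec n" "std_vec y = 0\<^sub>v n" "eps_vec () y = w"
        using dual_vec_exists[OF zero_carrier_vec submod_carrier[OF D(3) w]] .
      then show ?thesis using w by (intro exI[of _ y]) (simp add: infinitesimals_def)
    qed
    moreover have "eps_vec () y \<in> U" if "y \<in> infinitesimals n U" for y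
      using that by (simp add: infinitesimals_def)
    ultimately show ?thesis unfolding graph_def by fast
  qed
  finally show ?thesis .
qed

lemma graph_eps_fold:
  fixes V W :: "('a::comm_ring_1, unit) infinitesimal vec set"
  assumes V: "flat_lift n U V" and W: "flat_lift n U W"
  shows "graph (spanned n (map_vec eps_fold ` fibre_product n V W)) =
    {(u, v + w) |u v w. (u, v) \<in> graph V \<and> (u, w) \<in> graph W}" (is "graph ?S = ?R")
proof -
  note D = flat_liftD[OF V] and E = flat_liftD[OF W]
  note F = fibre_product_flat_lift[OF V W]
  have c: "map_vec eps_fold ` fibre_product n V W \<subseteq> carrier_vec n"
    by (auto simp: fibre_product_def)
  show ?thesis
  proof (intro equalityI subsetI)
    fix p assume "p \<in> graph ?S"
    then obtain x y where x: "x \<in> fibre_product n V W" and y: "y \<in> infinitesimals n U"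
      and p: "p = (std_vec (map_vec eps_fold x + y), eps_vec () (map_vec eps_fold x + y))"
      unfolding spanned_infinitesimal_hom[OF eps_fold_hom flat_liftD(1,2)[OF F]] graph_def by blast
    have "(std_vec x, eps_vec True x) \<in> graph V" "(std_vec x, eps_vec False x) \<in> graph W"
      using x graphI[of "map_vec (eps_proj True) x" V] graphI[of "map_vec (eps_proj False) x" W]
      by (auto simp: fibre_product_def)
    moreover have "eps_vec () y \<in> U" using y by (simp add: infinitesimals_def)
    ultimately have "(std_vec x, eps_vec True x) \<in> graph V" "(std_vec x, eps_vec False x + eps_vec () y) \<in> graph W"
      using graph_shift[OF W] by auto
    moreover have "x \<in> carrier_vec n" "y \<in> carrier_vec n" using x y
      by (auto simp: fibre_product_def infinitesimals_def)
    then have "p = (std_vec x, eps_vec True x + (eps_vec False x + eps_vec () y))"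
      using y by (auto simp: p infinitesimals_def assoc_add_vec[of _ n])
    ultimately show "p \<in> ?R" by blast
  next
    fix p assume "p \<in> ?R"
    then obtain u v w where vw: "(u, v) \<in> graph V" "(u, w) \<in> graph W" "p = (u, v + w)" by blast
    from vw obtain x y where x: "x \<in> V" "std_vec x = u" "eps_vec () x = v"
      and y: "y \<in> W" "std_vec y = u" "eps_vec () y = w" by (metis graphE)
    have "x \<in> carrier_vec n" "y \<in> carrier_vec n"
      using x y submod_carrier[OF D(1)] submod_carrier[OF E(1)] by auto
    then obtain z where z: "z \<in> carrier_vec n" "map_vec (eps_proj True) z = x"
      "map_vec (eps_proj False) z = y"
      using fibre_product_exists[of x n y] x y by auto
    have "z \<in> fibre_product n V W" using x y z by (simp add: fibre_product_def)
    then have "map_vec eps_fold z \<in> ?S" using spanned_superset[OF c] by blast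
    from graphI[OF this] have "(std_vec z, eps_vec True z + eps_vec False z) \<in> graph ?S" by simp
    moreover have "std_vec z = u" "eps_vec True z = v" "eps_vec False z = w"
      using z x y by (auto simp flip: std_vec_eps_proj[of True] eps_vec_eps_proj[where m = "()"])
    ultimately show "p \<in> graph ?S" using vw by simp
  qed
qed

section \<open>The action of a path algebra\<close>

lemma path_module_sel [simp]:
  "carrier (path_module B Q N F) = (\<Pi>\<^sub>E i\<in>verts Q. carrier (N i))"
  "zero (path_module B Q N F) = (\<lambda>i\<in>verts Q. \<zero>\<^bsub>N i\<^esub>)"
  "add (path_module B Q N F) = (\<lambda>x y. \<lambda>i\<in>verts Q. x i \<oplus>\<^bsub>N i\<^esub> y i)"
  "kscale (path_module B Q N F) = (\<lambda>c x. \<lambda>i\<in>verts Q. kscale (N i) c (x i))"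
  by (simp_all add: path_module_def)

lemma path_module_smult:
  "f \<odot>\<^bsub>path_module B Q N F\<^esub> x = (\<lambda>i\<in>verts Q.
     \<Oplus>\<^bsub>N i\<^esub>p\<in>{p. pre_digraph.awalk Q (fst p) (snd p) i \<and> f p \<noteq> \<zero>\<^bsub>B\<^esub>}.
       f p \<odot>\<^bsub>N i\<^esub> fold F (snd p) (x (fst p)))"
  by (simp add: path_module_def)

lemma abelian_group_path_module:
  assumes N: "\<And>i. i \<in> verts Q \<Longrightarrow> abelian_group (N i)"
  shows "abelian_group (path_module B Q N F)"
proof (rule abelian_groupI)
  let ?X = "path_module B Q N F"
  note mon = abelian_group.axioms(1)[OF N]
  have x [simp]: "x i \<in> carrier (N i)" if "x \<in> carrier ?X" "i \<in> verts Q" for x i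
    using that by (auto dest: PiE_mem)
  note [simp] = abelian_monoid.a_closed[OF mon] abelian_monoid.zero_closed[OF mon]
    abelian_monoid.l_zero[OF mon]
  have eqI: "x = y" if "x \<in> carrier ?X" "y \<in> carrier ?X" "\<And>i. i \<in> verts Q \<Longrightarrow> x i = y i" for x y
    using that by (auto intro: PiE_ext)
  show closed: "x \<oplus>\<^bsub>?X\<^esub> y \<in> carrier ?X" if "x \<in> carrier ?X" "y \<in> carrier ?X" for x y
    using x[OF that(1)] x[OF that(2)] by simp
  show zero: "\<zero>\<^bsub>?X\<^esub> \<in> carrier ?X" by simp
  fix x assume x': "x \<in> carrier ?X"
  show "(x \<oplus>\<^bsub>?X\<^esub> y) \<oplus>\<^bsub>?X\<^esub> z = x \<oplus>\<^bsub>?X\<^esub> (y \<oplus>\<^bsub>?X\<^esub> z)" if "y \<in> carrier ?X" "z \<in> carrier ?X" for y z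
    using that x' by (intro eqI closed) (simp_all add: abelian_monoid.a_assoc[OF mon] del: path_module_sel(1))
  show "x \<oplus>\<^bsub>?X\<^esub> y = y \<oplus>\<^bsub>?X\<^esub> x" if "y \<in> carrier ?X" for y
    using that x' by (intro eqI closed) (simp_all add: abelian_monoid.a_comm[OF mon] del: path_module_sel(1))
  show "\<zero>\<^bsub>?X\<^esub> \<oplus>\<^bsub>?X\<^esub> x = x"
    using x' by (intro eqI closed zero) (simp_all del: path_module_sel(1))
  show "\<exists>y\<in>carrier ?X. y \<oplus>\<^bsub>?X\<^esub> x = \<zero>\<^bsub>?X\<^esub>"
    using x[OF x'] by (intro bexI[of _ "\<lambda>i\<in>verts Q. \<ominus>\<^bsub>N i\<^esub> x i"])
      (auto intro!: restrict_ext simp: abelian_group.l_neg[OF N] abelian_group.a_inv_closed[OF N])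
qed

text \<open>
  \<open>P\<close> is a relation between elements indexed by \<open>j\<close>. In this form closure of a submodule and compatibility
  with a homomorphism are instances of one statement.
\<close>

lemma finsum_invariant:
  assumes "abelian_monoid G" "finite A" "\<And>p. p \<in> A \<Longrightarrow> (\<lambda>j. g j p) \<in> P"
    and carrier: "\<And>m j. m \<in> P \<Longrightarrow> m j \<in> carrier G"
    and zero: "(\<lambda>j. \<zero>\<^bsub>G\<^esub>) \<in> P"
    and add: "\<And>m m'. m \<in> P \<Longrightarrow> m' \<in> P \<Longrightarrow> (\<lambda>j. m j \<oplus>\<^bsub>G\<^esub> m' j) \<in> P"
  shows "(\<lambda>j. finsum G (g j) A) \<in> P"
  using assms(2,3)
proof (induction A rule: finite_induct)
  case empty
  interpret abelian_monoid G by fact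
  show ?case using zero by simp
next
  case (insert p A)
  interpret abelian_monoid G by fact
  have "g j q \<in> carrier G" if "q \<in> insert p A" for j q
    using carrier[OF insert.prems[OF that]] .
  then have "finsum G (g j) (insert p A) = g j p \<oplus>\<^bsub>G\<^esub> finsum G (g j) A" for j
    using insert.hyps by (intro finsum_insert) auto
  then show ?case using add[OF insert.prems[of p] insert.IH] insert.prems by simp
qed

lemma path_algebra_support_finite:
  assumes "f \<in> carrier (path_algebra B Q)"
  shows "finite {p. P p \<and> f p \<noteq> \<zero>\<^bsub>B\<^esub>}"
  using assms by (auto simp: path_algebra_def intro: finite_subset[rotated])

lemma path_algebra_coeff:
  assumes "f \<in> carrier (path_algebra B Q)" "pre_digraph.awalk Q (fst p) (snd p) i"
  shows "f p \<in> carrier B"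
  using assms by (cases p) (auto simp: path_algebra_def paths_def)

lemma awalk_Cons: "pre_digraph.awalk Q u (\<alpha> # p) i \<longleftrightarrow> u \<in> verts Q \<and> \<alpha> \<in> arcs Q \<and> tail Q \<alpha> = u
    \<and> pre_digraph.awalk Q (head Q \<alpha>) p i" if "wf_digraph Q"
proof -
  interpret wf_digraph Q by fact
  show ?thesis by (auto simp: awalk_def)
qed

lemma awalk_Nil: "pre_digraph.awalk Q u [] i \<longleftrightarrow> u = i \<and> i \<in> verts Q"
  by (auto simp: pre_digraph.awalk_def pre_digraph.cas.simps)

lemma awalk_end:
  assumes "wf_digraph Q" "pre_digraph.awalk Q u p i"
  shows "i \<in> verts Q" "u \<in> verts Q"
  using wf_digraph.awalk_last_in_verts[OF assms] assms(2) by (simp_all add: pre_digraph.awalk_def)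

lemma fold_invariant:
  assumes Q: "wf_digraph Q"
    and arrow: "\<And>\<alpha> m. \<alpha> \<in> arcs Q \<Longrightarrow> m \<in> P (tail Q \<alpha>) \<Longrightarrow> (\<lambda>j. F \<alpha> (m j)) \<in> P (head Q \<alpha>)"
    and "pre_digraph.awalk Q u p i" "m \<in> P u"
  shows "(\<lambda>j. fold F p (m j)) \<in> P i"
  using assms(3,4)
proof (induction p arbitrary: u m)
  case Nil
  then show ?case by (simp add: awalk_Nil)
next
  case (Cons \<alpha> p)
  then have "(\<lambda>j. F \<alpha> (m j)) \<in> P (head Q \<alpha>)" by (auto simp: awalk_Cons[OF Q] intro: arrow)
  moreover have "pre_digraph.awalk Q (head Q \<alpha>) p i" using Cons.prems by (simp add: awalk_Cons[OF Q])
  ultimately show ?case using Cons.IH[of "head Q \<alpha>" "\<lambda>j. F \<alpha> (m j)"] by simp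
qed

text \<open>
  Let relations \<open>P i\<close> between the elements of \<open>N i\<close>, for the vertices \<open>i\<close>, be linear and preserved by the
  arrows. Then they are preserved along paths, hence by the action of the path algebra. For a one-element index
  type this says that subrepresentations are submodules; for a two-element index type, that the graph of a
  morphism of representations is preserved, so that the morphism is a homomorphism of modules.
\<close>

lemma path_module_invariant:
  fixes x :: "'j \<Rightarrow> 'v \<Rightarrow> 'm"
  assumes Q: "wf_digraph Q"
    and N: "\<And>i. i \<in> verts Q \<Longrightarrow> abelian_monoid (N i)"
    and carrier: "\<And>i m j. i \<in> verts Q \<Longrightarrow> m \<in> P i \<Longrightarrow> m j \<in> carrier (N i)"
    and zero: "\<And>i. i \<in> verts Q \<Longrightarrow> (\<lambda>j. \<zero>\<^bsub>N i\<^esub>) \<in> P i"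
    and add: "\<And>i m m'. i \<in> verts Q \<Longrightarrow> m \<in> P i \<Longrightarrow> m' \<in> P i \<Longrightarrow> (\<lambda>j. m j \<oplus>\<^bsub>N i\<^esub> m' j) \<in> P i"
    and smult: "\<And>i b m. i \<in> verts Q \<Longrightarrow> b \<in> carrier B \<Longrightarrow> m \<in> P i \<Longrightarrow> (\<lambda>j. b \<odot>\<^bsub>N i\<^esub> m j) \<in> P i"
    and arrow: "\<And>\<alpha> m. \<alpha> \<in> arcs Q \<Longrightarrow> m \<in> P (tail Q \<alpha>) \<Longrightarrow> (\<lambda>j. F \<alpha> (m j)) \<in> P (head Q \<alpha>)"
    and f: "f \<in> carrier (path_algebra B Q)"
    and x: "\<And>i. i \<in> verts Q \<Longrightarrow> (\<lambda>j. x j i) \<in> P i"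
    and i: "i \<in> verts Q"
  shows "(\<lambda>j. (f \<odot>\<^bsub>path_module B Q N F\<^esub> x j) i) \<in> P i"
proof -
  let ?A = "{p. pre_digraph.awalk Q (fst p) (snd p) i \<and> f p \<noteq> \<zero>\<^bsub>B\<^esub>}"
  have "(\<lambda>j. f p \<odot>\<^bsub>N i\<^esub> fold F (snd p) (x j (fst p))) \<in> P i" if "p \<in> ?A" for p
    using that
    by (intro smult[OF i] path_algebra_coeff[OF f] fold_invariant[where P = P and F = F, OF Q arrow])
      (auto dest: awalk_end[OF Q] intro!: x)
  then have "(\<lambda>j. \<Oplus>\<^bsub>N i\<^esub>p\<in>?A. f p \<odot>\<^bsub>N i\<^esub> fold F (snd p) (x j (fst p))) \<in> P i"
    by (intro finsum_invariant[OF N[OF i] path_algebra_support_finite[OF f]])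
      (auto intro: carrier zero add i)
  then show ?thesis using i by (simp add: path_module_smult)
qed

text \<open>
  The element \<open>b p\<close> of the path algebra, for a path \<open>p\<close> and a coefficient \<open>b\<close>.
\<close>

lemma path_module_monomial:
  assumes N: "abelian_monoid (N i)" and i: "i \<in> verts Q" and z: "\<zero>\<^bsub>B\<^esub> = z" and b: "b \<noteq> z"
    and carrier: "pre_digraph.awalk Q (fst p) (snd p) i \<Longrightarrow>
      b \<odot>\<^bsub>N i\<^esub> fold F (snd p) (x (fst p)) \<in> carrier (N i)"
  shows "((\<lambda>q. if q = p then b else z) \<odot>\<^bsub>path_module B Q N F\<^esub> x) i =
    (if pre_digraph.awalk Q (fst p) (snd p) i then b \<odot>\<^bsub>N i\<^esub> fold F (snd p) (x (fst p)) else \<zero>\<^bsub>N i\<^esub>)"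
proof -
  interpret abelian_monoid "N i" by fact
  let ?f = "\<lambda>q. if q = p then b else z"
  have "{q. pre_digraph.awalk Q (fst q) (snd q) i \<and> ?f q \<noteq> \<zero>\<^bsub>B\<^esub>} =
    (if pre_digraph.awalk Q (fst p) (snd p) i then {p} else {})" using b z by auto
  then show ?thesis using carrier i by (simp add: path_module_smult)
qed

lemma vec_tensor_module_sel [simp]:
  "carrier (vec_tensor_module \<phi> n) = carrier_vec n"
  "zero (vec_tensor_module \<phi> n) = 0\<^sub>v n"
  "add (vec_tensor_module \<phi> n) = (+)"
  "smult (vec_tensor_module \<phi> n) = (\<lambda>a v. \<phi> a \<cdot>\<^sub>v v)"
  "kscale (vec_tensor_module \<phi> n) = (\<lambda>c v. c \<cdot>\<^sub>v v)"
  by (simp_all add: vec_tensor_module_def)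

lemma abelian_group_vec_tensor_module: "abelian_group (vec_tensor_module \<phi> n)"
proof (rule abelian_groupI; simp)
  fix x :: "'a vec" assume "x \<in> carrier_vec n"
  then show "\<exists>y\<in>carrier_vec n. y + x = 0\<^sub>v n" by (intro bexI[of _ "- x"]) auto
qed (auto intro: comm_add_vec)

lemma wf_linear_quiver: "wf_digraph (linear_quiver \<nu>)"
  by unfold_locales (auto simp: linear_quiver_def)

lemma linear_quiver_sel [simp]:
  "verts (linear_quiver \<nu>) = {..\<nu>}" "arcs (linear_quiver \<nu>) = {..<\<nu>}"
  "tail (linear_quiver \<nu>) = (\<lambda>l. l)" "head (linear_quiver \<nu>) = Suc"
  by (simp_all add: linear_quiver_def)

lemma fold_ident: "fold (\<lambda>_ x. x) p y = y"
  by (induction p) auto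

text \<open>
  The path \<open>p\<close> of the linear quiver with coefficient the path \<open>q\<close> of \<open>Q\<close>, an element of \<open>\<Lambda>\<close>.
\<close>

definition path_element :: "nat \<times> nat list \<Rightarrow> 'v \<times> 'a list \<Rightarrow> nat \<times> nat list \<Rightarrow> 'v \<times> 'a list \<Rightarrow> 'k::field"
where
  "path_element p q = (\<lambda>p'. if p' = p then (\<lambda>q'. if q' = q then 1 else 0) else (\<lambda>_. 0))"

lemma path_element_Lambda:
  assumes "p \<in> paths (linear_quiver \<nu>)" "q \<in> paths Q"
  shows "path_element p q \<in> carrier (Lambda TYPE('k::field) Q \<nu>)"
proof -
  have "{p'. path_element p q p' \<noteq> (\<lambda>_. 0 :: 'k)} \<subseteq> {p}" by (auto simp: path_element_def)
  then have "finite {p'. path_element p q p' \<noteq> (\<lambda>_. 0 :: 'k)}" by (rule finite_subset) simp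
  moreover have "finite {q'. (if q' = q then 1 else 0 :: 'k) \<noteq> 0}" by simp
  ultimately show ?thesis
    using assms by (auto simp: Lambda_def path_algebra_def) (auto simp: path_element_def)
qed

locale rep_over_field = fin_digraph Q + field_hom \<phi>
  for Q :: "('v, 'a) pre_digraph" and \<phi> :: "'k::field \<Rightarrow> 'K::field" +
  fixes n :: "'v \<Rightarrow> nat" and M :: "'a \<Rightarrow> 'k mat" and \<nu> :: nat
  assumes M_Rep: "M \<in> Rep Q n"
begin

abbreviation MK :: "'a \<Rightarrow> 'K mat" where "MK \<alpha> \<equiv> map_mat \<phi> (M \<alpha>)"

abbreviation const_mod where "const_mod \<equiv> constant_module \<phi> Q \<nu> n M"

lemma MK_carrier: "\<alpha> \<in> arcs Q \<Longrightarrow> MK \<alpha> \<in> carrier_mat (n (head Q \<alpha>)) (n (tail Q \<alpha>))"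
  using M_Rep by (auto simp: Rep_def)

lemma rep_module_carrier: "carrier (rep_module \<phi> Q n M) = (\<Pi>\<^sub>E i\<in>verts Q. carrier_vec (n i))"
  by (simp add: rep_module_def)

lemma const_mod_sel:
  "carrier const_mod = (\<Pi>\<^sub>E l\<in>{..\<nu>}. \<Pi>\<^sub>E i\<in>verts Q. carrier_vec (n i))"
  "zero const_mod = (\<lambda>l\<in>{..\<nu>}. \<lambda>i\<in>verts Q. 0\<^sub>v (n i))"
  "add const_mod = (\<lambda>x y. \<lambda>l\<in>{..\<nu>}. \<lambda>i\<in>verts Q. x l i + y l i)"
  "kscale const_mod = (\<lambda>c x. \<lambda>l\<in>{..\<nu>}. \<lambda>i\<in>verts Q. c \<cdot>\<^sub>v x l i)"
  by (simp_all add: constant_module_def rep_module_def)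

lemma abelian_group_rep_module: "abelian_group (rep_module \<phi> Q n M)"
  unfolding rep_module_def by (intro abelian_group_path_module abelian_group_vec_tensor_module)

lemma abelian_group_const_mod: "abelian_group const_mod"
  unfolding constant_module_def by (intro abelian_group_path_module abelian_group_rep_module)

text \<open>
  Since \<open>\<Lambda>\<close> is a path algebra with coefficients in a path algebra, \<open>path_module_invariant\<close> is applied twice:
  for the linear quiver to the relations \<open>P' l\<close> between families of vectors, and inside it for \<open>Q\<close> to the relations
  \<open>P l i\<close>.
\<close>

lemma const_mod_invariant:
  fixes x :: "'j \<Rightarrow> nat \<Rightarrow> 'v \<Rightarrow> 'K vec"
  assumes carrier: "\<And>l i m j. l \<le> \<nu> \<Longrightarrow> i \<in> verts Q \<Longrightarrow> m \<in> P l i \<Longrightarrow> m j \<in> carrier_vec (n i)"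
    and zero: "\<And>l i. l \<le> \<nu> \<Longrightarrow> i \<in> verts Q \<Longrightarrow> (\<lambda>j. 0\<^sub>v (n i)) \<in> P l i"
    and add: "\<And>l i m m'. l \<le> \<nu> \<Longrightarrow> i \<in> verts Q \<Longrightarrow> m \<in> P l i \<Longrightarrow> m' \<in> P l i \<Longrightarrow> (\<lambda>j. m j + m' j) \<in> P l i"
    and smult: "\<And>l i c m. l \<le> \<nu> \<Longrightarrow> i \<in> verts Q \<Longrightarrow> m \<in> P l i \<Longrightarrow> (\<lambda>j. c \<cdot>\<^sub>v m j) \<in> P l i"
    and arrow: "\<And>l \<alpha> m. l \<le> \<nu> \<Longrightarrow> \<alpha> \<in> arcs Q \<Longrightarrow> m \<in> P l (tail Q \<alpha>) \<Longrightarrow>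
      (\<lambda>j. MK \<alpha> *\<^sub>v m j) \<in> P l (head Q \<alpha>)"
    and step: "\<And>l i. l < \<nu> \<Longrightarrow> i \<in> verts Q \<Longrightarrow> P l i \<subseteq> P (Suc l) i"
    and a: "a \<in> carrier (Lambda TYPE('k) Q \<nu>)"
    and x: "\<And>j. x j \<in> carrier const_mod" "\<And>l i. l \<le> \<nu> \<Longrightarrow> i \<in> verts Q \<Longrightarrow> (\<lambda>j. x j l i) \<in> P l i"
  shows "(\<forall>j. a \<odot>\<^bsub>const_mod\<^esub> x j \<in> carrier const_mod) \<and>
    (\<forall>l\<le>\<nu>. \<forall>i\<in>verts Q. (\<lambda>j. (a \<odot>\<^bsub>const_mod\<^esub> x j) l i) \<in> P l i)"
proof -
  let ?R = "rep_module \<phi> Q n M"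
  define P' where "P' l = {m. (\<forall>j. m j \<in> carrier ?R) \<and> (\<forall>i\<in>verts Q. (\<lambda>j. m j i) \<in> P l i)}" for l
  have main: "(\<lambda>j. (a \<odot>\<^bsub>const_mod\<^esub> x j) l) \<in> P' l" if l: "l \<le> \<nu>" for l
    unfolding constant_module_def
  proof (rule path_module_invariant[OF wf_linear_quiver, where P = P'])
    show "abelian_monoid ?R" by (rule abelian_group.axioms(1)[OF abelian_group_rep_module])
    show "m j \<in> carrier ?R" if "m \<in> P' i" for i m j using that by (simp add: P'_def)
    show "(\<lambda>j. \<zero>\<^bsub>?R\<^esub>) \<in> P' i" if "i \<in> verts (linear_quiver \<nu>)" for i
      using that zero by (auto simp: P'_def rep_module_def)
    show "(\<lambda>j. m j \<oplus>\<^bsub>?R\<^esub> m' j) \<in> P' i"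
      if "i \<in> verts (linear_quiver \<nu>)" "m \<in> P' i" "m' \<in> P' i" for i m m'
      using that add by (auto simp: P'_def rep_module_def intro!: add_carrier_vec dest: PiE_mem)
    show "(\<lambda>j. b \<odot>\<^bsub>?R\<^esub> m j) \<in> P' i"
      if i: "i \<in> verts (linear_quiver \<nu>)" and b: "b \<in> carrier (path_algebra class_ring Q)" and m: "m \<in> P' i"
      for i b m
    proof -
      have *: "(\<lambda>j. (b \<odot>\<^bsub>?R\<^esub> m j) v) \<in> P i v" if v: "v \<in> verts Q" for v
        unfolding rep_module_def
        by (rule path_module_invariant[OF wf_digraph, where P = "P i"])
          (use i m carrier zero add smult arrow v b in
            \<open>auto simp: P'_def intro: abelian_group.axioms(1)[OF abelian_group_vec_tensor_module]\<close>)
      have "(b \<odot>\<^bsub>?R\<^esub> m j) v \<in> carrier_vec (n v)" if "v \<in> verts Q" for v j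
        using carrier[OF _ that *[OF that], of j] i by simp
      then have "b \<odot>\<^bsub>?R\<^esub> m j \<in> carrier ?R" for j
        by (auto simp: rep_module_def path_module_smult)
      then show ?thesis using * by (simp add: P'_def)
    qed
    show "(\<lambda>j. m j) \<in> P' (head (linear_quiver \<nu>) \<alpha>)"
      if "\<alpha> \<in> arcs (linear_quiver \<nu>)" "m \<in> P' (tail (linear_quiver \<nu>) \<alpha>)" for \<alpha> m
      using that step by (fastforce simp: P'_def)
    show "a \<in> carrier (path_algebra (path_algebra class_ring Q) (linear_quiver \<nu>))"
      using a by (simp add: Lambda_def)
    show "(\<lambda>j. x j i) \<in> P' i" if "i \<in> verts (linear_quiver \<nu>)" for i
      using that x by (auto simp: P'_def const_mod_sel rep_module_carrier)
  qed (use l in auto)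
  have "a \<odot>\<^bsub>const_mod\<^esub> x j \<in> carrier const_mod" for j
    unfolding const_mod_sel
  proof (rule PiE_I)
    fix l assume "l \<in> {..\<nu>}"
    then show "(a \<odot>\<^bsub>const_mod\<^esub> x j) l \<in> (\<Pi>\<^sub>E i\<in>verts Q. carrier_vec (n i))"
      using main[of l] by (auto simp: P'_def rep_module_carrier)
  qed (simp add: constant_module_def path_module_smult)
  then show ?thesis using main by (simp add: P'_def)
qed

lemma const_mod_action_closed:
  assumes a: "a \<in> carrier (Lambda TYPE('k) Q \<nu>)" and x: "x \<in> carrier const_mod"
  shows "a \<odot>\<^bsub>const_mod\<^esub> x \<in> carrier const_mod"
proof -
  have "(\<forall>j::unit. a \<odot>\<^bsub>const_mod\<^esub> x \<in> carrier const_mod) \<and>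
    (\<forall>l\<le>\<nu>. \<forall>i\<in>verts Q. (\<lambda>j::unit. (a \<odot>\<^bsub>const_mod\<^esub> x) l i) \<in> {m. \<forall>j. m j \<in> carrier_vec (n i)})"
  proof (rule const_mod_invariant[where P = "\<lambda>_ i. {m. \<forall>j. m j \<in> carrier_vec (n i)}"
        and x = "\<lambda>_. x", OF _ _ _ _ _ _ a])
    show "(\<lambda>j. MK \<alpha> *\<^sub>v m j) \<in> {m. \<forall>j. m j \<in> carrier_vec (n (head Q \<alpha>))}"
      if "\<alpha> \<in> arcs Q" "m \<in> {m. \<forall>j. m j \<in> carrier_vec (n (tail Q \<alpha>))}" for \<alpha> and m :: "unit \<Rightarrow> 'K vec"
      using that mult_mat_vec_carrier[OF MK_carrier] by simp
  qed (use x in \<open>auto simp: const_mod_sel PiE_iff\<close>)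
  then show ?thesis by simp
qed

lemma fold_MK_carrier:
  assumes "pre_digraph.awalk Q u q i" "v \<in> carrier_vec (n u)"
  shows "fold (\<lambda>\<alpha> v. MK \<alpha> *\<^sub>v v) q v \<in> carrier_vec (n i)"
  using fold_invariant[OF wf_digraph, where P = "\<lambda>i. {m. \<forall>j::unit. m j \<in> carrier_vec (n i)}"
      and F = "\<lambda>\<alpha> v. MK \<alpha> *\<^sub>v v" and m = "\<lambda>_. v", OF _ assms(1)] assms(2)
    mult_mat_vec_carrier[OF MK_carrier] by auto

lemma path_element_action:
  assumes p: "p \<in> paths (linear_quiver \<nu>)" and q: "q \<in> paths Q" and x: "x \<in> carrier const_mod"
    and l: "l \<le> \<nu>" and i: "i \<in> verts Q"
  shows "(path_element p q \<odot>\<^bsub>const_mod\<^esub> x) l i =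
    (if pre_digraph.awalk (linear_quiver \<nu>) (fst p) (snd p) l \<and> pre_digraph.awalk Q (fst q) (snd q) i
     then fold (\<lambda>\<alpha> v. MK \<alpha> *\<^sub>v v) (snd q) (x (fst p) (fst q)) else 0\<^sub>v (n i))"
proof -
  let ?R = "rep_module \<phi> Q n M"
  let ?q = "\<lambda>q'. if q' = q then 1 else 0 :: 'k"
  have fst_p: "fst p \<le> \<nu>" and fst_q: "fst q \<in> verts Q"
    using p q by (auto simp: paths_def pre_digraph.awalk_def)
  have y: "x (fst p) \<in> carrier ?R"
    using x fst_p by (auto simp: const_mod_sel rep_module_carrier)
  then have yq: "x (fst p) (fst q) \<in> carrier_vec (n (fst q))"
    using fst_q by (auto simp: rep_module_carrier)
  have inner: "(?q \<odot>\<^bsub>?R\<^esub> x (fst p)) v = (if pre_digraph.awalk Q (fst q) (snd q) v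
     then fold (\<lambda>\<alpha> v. MK \<alpha> *\<^sub>v v) (snd q) (x (fst p) (fst q)) else 0\<^sub>v (n v))" if v: "v \<in> verts Q" for v
    using path_module_monomial[where N = "\<lambda>i. vec_tensor_module \<phi> (n i)" and b = 1 and z = 0 and p = q
        and B = "class_ring :: 'k ring" and F = "\<lambda>\<alpha> v. MK \<alpha> *\<^sub>v v" and x = "x (fst p)",
        OF abelian_group.axioms(1)[OF abelian_group_vec_tensor_module] v]
      fold_MK_carrier[OF _ yq]
    by (simp add: rep_module_def)
  have "(?q \<odot>\<^bsub>?R\<^esub> x (fst p)) v \<in> carrier_vec (n v)" if "v \<in> verts Q" for v
    unfolding inner[OF that] using fold_MK_carrier[OF _ yq] by auto
  then have car: "?q \<odot>\<^bsub>?R\<^esub> x (fst p) \<in> carrier ?R"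
    by (auto simp: rep_module_def path_module_smult)
  have "?q \<noteq> (\<lambda>_. 0)" by (metis one_neq_zero)
  then have "(path_element p q \<odot>\<^bsub>const_mod\<^esub> x) l =
    (if pre_digraph.awalk (linear_quiver \<nu>) (fst p) (snd p) l then ?q \<odot>\<^bsub>?R\<^esub> x (fst p) else \<zero>\<^bsub>?R\<^esub>)"
    using path_module_monomial[where N = "\<lambda>_. ?R" and b = ?q and z = "\<lambda>_. 0" and p = p and i = l
        and B = "path_algebra (class_ring :: 'k ring) Q" and F = "\<lambda>_ x. x" and x = x and Q = "linear_quiver \<nu>",
        OF abelian_group.axioms(1)[OF abelian_group_rep_module]] l car
    by (simp add: constant_module_def path_element_def fold_ident path_algebra_def)
  then show ?thesis using inner[OF i] i by (simp add: rep_module_def)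
qed

end

section \<open>Points of the flag scheme over a fixed flag\<close>

lemma Fl_map_apply:
  "l \<le> \<nu> \<Longrightarrow> i \<in> verts Q \<Longrightarrow> Fl_map \<psi> Q \<nu> d Z l i = spanned (d \<nu> i) (map_vec \<psi> ` Z l i)"
  by (simp add: Fl_map_def)

lemma Fl_map_extensional: "Fl_map \<psi> Q \<nu> d Z \<in> {..\<nu>} \<rightarrow>\<^sub>E verts Q \<rightarrow>\<^sub>E UNIV"
  by (auto simp: Fl_map_def)

lemma flag_eqI:
  assumes "V \<in> {..\<nu>} \<rightarrow>\<^sub>E verts Q \<rightarrow>\<^sub>E T" "W \<in> {..\<nu>} \<rightarrow>\<^sub>E verts Q \<rightarrow>\<^sub>E T'"
    "\<And>l i. l \<le> \<nu> \<Longrightarrow> i \<in> verts Q \<Longrightarrow> V l i = W l i"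
  shows "V = W"
proof
  fix l show "V l = W l"
  proof (cases "l \<le> \<nu>")
    case True
    then have "V l \<in> verts Q \<rightarrow>\<^sub>E T" "W l \<in> verts Q \<rightarrow>\<^sub>E T'" using assms(1,2) by (auto dest: PiE_mem)
    then show ?thesis using assms(3)[OF True]
      by (intro extensionalityI[of _ "verts Q"]) (auto simp: PiE_iff)
  next
    case False
    then show ?thesis using PiE_arb[OF assms(1), of l] PiE_arb[OF assms(2), of l] by simp
  qed
qed

locale flag_point = rep_over_field Q \<phi> "d \<nu>" M \<nu>
  for Q :: "('v, 'a) pre_digraph" and \<phi> :: "'k::field \<Rightarrow> 'K::field"
    and d :: "nat \<Rightarrow> 'v \<Rightarrow> nat" and M :: "'a \<Rightarrow> 'k mat" and \<nu> :: nat +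
  fixes U :: "nat \<Rightarrow> 'v \<Rightarrow> 'K vec set"
  assumes U_Fl: "U \<in> Fl \<phi> Q \<nu> d M"
begin

abbreviation dim :: "'v \<Rightarrow> nat" where "dim i \<equiv> d \<nu> i"

lemma U_flag:
  shows U_ext: "U \<in> {..\<nu>} \<rightarrow>\<^sub>E verts Q \<rightarrow>\<^sub>E UNIV"
    and U_summand: "l \<le> \<nu> \<Longrightarrow> i \<in> verts Q \<Longrightarrow> direct_summand (dim i) (U l i)"
    and U_rank: "l \<le> \<nu> \<Longrightarrow> i \<in> verts Q \<Longrightarrow> has_rank (dim i) (U l i) (d l i)"
    and U_submod: "l \<le> \<nu> \<Longrightarrow> i \<in> verts Q \<Longrightarrow> submod (dim i) (U l i)"
    and U_arrow: "l \<le> \<nu> \<Longrightarrow> \<alpha> \<in> arcs Q \<Longrightarrow> u \<in> U l (tail Q \<alpha>) \<Longrightarrow> MK \<alpha> *\<^sub>v u \<in> U l (head Q \<alpha>)"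
    and U_step: "l < \<nu> \<Longrightarrow> i \<in> verts Q \<Longrightarrow> U l i \<subseteq> U (Suc l) i"
  using U_Fl by (auto simp: Fl_def subrepresentation_def)

text \<open>
  The points over \<open>U\<close> with values in an infinitesimal thickening of \<open>K\<close>; the conditions on direct summands
  and ranks have been replaced by flatness.
\<close>

definition flag_lift :: "(nat \<Rightarrow> 'v \<Rightarrow> ('K, 'n) infinitesimal vec set) \<Rightarrow> bool" where
  "flag_lift Z \<longleftrightarrow> Z \<in> {..\<nu>} \<rightarrow>\<^sub>E verts Q \<rightarrow>\<^sub>E UNIV \<and>
     (\<forall>l\<le>\<nu>. \<forall>i\<in>verts Q. flat_lift (dim i) (U l i) (Z l i)) \<and>
     (\<forall>l\<le>\<nu>. \<forall>\<alpha>\<in>arcs Q. \<forall>z\<in>Z l (tail Q \<alpha>). map_mat eps_const (MK \<alpha>) *\<^sub>v z \<in> Z l (head Q \<alpha>)) \<and>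
     (\<forall>l<\<nu>. \<forall>i\<in>verts Q. Z l i \<subseteq> Z (Suc l) i)"

lemma flag_liftD:
  assumes "flag_lift Z"
  shows "Z \<in> {..\<nu>} \<rightarrow>\<^sub>E verts Q \<rightarrow>\<^sub>E UNIV"
    "\<And>l i. l \<le> \<nu> \<Longrightarrow> i \<in> verts Q \<Longrightarrow> flat_lift (dim i) (U l i) (Z l i)"
    "\<And>l \<alpha> z. l \<le> \<nu> \<Longrightarrow> \<alpha> \<in> arcs Q \<Longrightarrow> z \<in> Z l (tail Q \<alpha>) \<Longrightarrow>
      map_mat eps_const (MK \<alpha>) *\<^sub>v z \<in> Z l (head Q \<alpha>)"
    "\<And>l i. l < \<nu> \<Longrightarrow> i \<in> verts Q \<Longrightarrow> Z l i \<subseteq> Z (Suc l) i"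
  using assms by (simp_all add: flag_lift_def)

lemma flag_lift_iff_Fl:
  fixes Z :: "nat \<Rightarrow> 'v \<Rightarrow> ('K, 'n::finite) infinitesimal vec set"
  shows "flag_lift Z \<longleftrightarrow> Z \<in> Fl (eps_const \<circ> \<phi>) Q \<nu> d M \<and>
    (\<forall>l\<le>\<nu>. \<forall>i\<in>verts Q. std_vec ` Z l i = U l i)"
proof -
  have comp: "map_mat (eps_const \<circ> \<phi>) A = map_mat eps_const (map_mat \<phi> A)" for A
    by (intro eq_matI) auto
  have *: "flat_lift (dim i) (U l i) (Z l i) \<longleftrightarrow> direct_summand (dim i) (Z l i) \<and>
      has_rank (dim i) (Z l i) (d l i) \<and> std_vec ` Z l i = U l i" if "l \<le> \<nu>" "i \<in> verts Q" for l i
  proof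
    assume "flat_lift (dim i) (U l i) (Z l i)"
    then show "direct_summand (dim i) (Z l i) \<and> has_rank (dim i) (Z l i) (d l i) \<and> std_vec ` Z l i = U l i"
      using flat_lift_direct_summand[OF U_summand[OF that]] flat_lift_has_rank[OF U_rank[OF that]]
        flat_liftD(2) by blast
  next
    assume "direct_summand (dim i) (Z l i) \<and> has_rank (dim i) (Z l i) (d l i) \<and> std_vec ` Z l i = U l i"
    then show "flat_lift (dim i) (U l i) (Z l i)"
      using direct_summand_flat_lift[of "dim i" "Z l i"] by simp
  qed
  note Fl = Fl_def subrepresentation_def comp mem_Collect_eq
  show ?thesis
  proof
    assume "flag_lift Z"
    note D = flag_liftD[OF this]
    have ds: "direct_summand (dim i) (Z l i)" "has_rank (dim i) (Z l i) (d l i)" "std_vec ` Z l i = U l i"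
      if "l \<le> \<nu>" "i \<in> verts Q" for l i
      using *[OF that] D(2)[OF that] by auto
    then have "submod (dim i) (Z l i)" if "l \<le> \<nu>" "i \<in> verts Q" for l i
      using that by (simp add: direct_summand_def)
    with D ds show "Z \<in> Fl (eps_const \<circ> \<phi>) Q \<nu> d M \<and> (\<forall>l\<le>\<nu>. \<forall>i\<in>verts Q. std_vec ` Z l i = U l i)"
      unfolding Fl by simp
  next
    assume Z: "Z \<in> Fl (eps_const \<circ> \<phi>) Q \<nu> d M \<and> (\<forall>l\<le>\<nu>. \<forall>i\<in>verts Q. std_vec ` Z l i = U l i)"
    then have "flat_lift (dim i) (U l i) (Z l i)" if "l \<le> \<nu>" "i \<in> verts Q" for l i
      using *[OF that] that by (simp add: Fl_def)
    with Z show "flag_lift Z" unfolding flag_lift_def Fl by simp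
  qed
qed

abbreviation T where "T \<equiv> tangent_space \<phi> Q \<nu> d M U"

lemma tangent_carrier: "carrier T = {V. flag_lift V}"
proof -
  have "Fl_map std_part Q \<nu> d V = U \<longleftrightarrow> (\<forall>l\<le>\<nu>. \<forall>i\<in>verts Q. std_vec ` V l i = U l i)"
    if V: "V \<in> Fl (eps_const \<circ> \<phi>) Q \<nu> d M" for V :: "nat \<Rightarrow> 'v \<Rightarrow> ('K, unit) infinitesimal vec set"
  proof -
    have s: "spanned (dim i) (std_vec ` V l i) = std_vec ` V l i" if "l \<le> \<nu>" "i \<in> verts Q" for l i
      using V that by (intro spanned_id submod_std_image) (auto simp: Fl_def direct_summand_def)
    show ?thesis
    proof
      assume eq: "Fl_map std_part Q \<nu> d V = U"
      show "\<forall>l\<le>\<nu>. \<forall>i\<in>verts Q. std_vec ` V l i = U l i"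
        unfolding eq[symmetric] using s by (simp add: Fl_map_apply)
    next
      assume "\<forall>l\<le>\<nu>. \<forall>i\<in>verts Q. std_vec ` V l i = U l i"
      then show "Fl_map std_part Q \<nu> d V = U"
        using s by (intro flag_eqI[OF Fl_map_extensional U_ext]) (simp add: Fl_map_apply)
    qed
  qed
  then show ?thesis by (simp add: tangent_space_def flag_lift_iff_Fl cong: conj_cong)
qed

lemma infinitesimals_arrow:
  fixes y :: "('K, 'n) infinitesimal vec"
  assumes "l \<le> \<nu>" "\<alpha> \<in> arcs Q" "y \<in> infinitesimals (dim (tail Q \<alpha>)) (U l (tail Q \<alpha>))"
  shows "map_mat eps_const (MK \<alpha>) *\<^sub>v y \<in> infinitesimals (dim (head Q \<alpha>)) (U l (head Q \<alpha>))"
proof -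
  note A = MK_carrier[OF assms(2)]
  have y: "y \<in> carrier_vec (dim (tail Q \<alpha>))" using assms(3) by (simp add: infinitesimals_def)
  have "dim_vec y = dim_col (MK \<alpha>)" using y A by auto
  note [simp] = mult_mat_vec_eps_const[OF this]
  have "MK \<alpha> *\<^sub>v 0\<^sub>v (dim (tail Q \<alpha>)) = 0\<^sub>v (dim (head Q \<alpha>))" using A by (intro eq_vecI) auto
  moreover have "map_mat eps_const (MK \<alpha>) *\<^sub>v y \<in> carrier_vec (dim (head Q \<alpha>))"
    using A y by (intro mult_mat_vec_carrier[of _ _ "dim (tail Q \<alpha>)"]) auto
  ultimately show ?thesis
    using assms U_arrow[OF assms(1,2)] by (simp add: infinitesimals_def)
qed

lemma flag_lift_Fl_map:
  fixes \<psi> :: "('K, 'm) infinitesimal \<Rightarrow> ('K, 'n::finite) infinitesimal"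
  assumes \<psi>: "infinitesimal_hom \<psi>" and Z: "flag_lift Z"
  shows "flag_lift (Fl_map \<psi> Q \<nu> d Z)"
proof -
  note D = flag_liftD[OF Z]
  interpret \<psi>: comm_ring_hom \<psi> using \<psi> by (simp add: infinitesimal_hom_def)
  have c: "\<psi> (eps_const a) = eps_const a" for a using \<psi> by (simp add: infinitesimal_hom_def)
  have sp: "Fl_map \<psi> Q \<nu> d Z l i =
      {map_vec \<psi> x + y |x y. x \<in> Z l i \<and> y \<in> infinitesimals (dim i) (U l i)}"
    if "l \<le> \<nu>" "i \<in> verts Q" for l i
    unfolding Fl_map_apply[OF that]
    using spanned_infinitesimal_hom[OF \<psi> flat_liftD(1,2)[OF D(2)[OF that]]] .
  show ?thesis
    unfolding flag_lift_def
  proof (intro conjI allI impI ballI)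
    show "flat_lift (dim i) (U l i) (Fl_map \<psi> Q \<nu> d Z l i)" if "l \<le> \<nu>" "i \<in> verts Q" for l i
      unfolding Fl_map_apply[OF that] by (rule flat_lift_infinitesimal_hom[OF \<psi> D(2)[OF that]])
    show "Fl_map \<psi> Q \<nu> d Z l i \<subseteq> Fl_map \<psi> Q \<nu> d Z (Suc l) i" if "l < \<nu>" "i \<in> verts Q" for l i
    proof -
      have "infinitesimals (dim i) (U l i) \<subseteq> (infinitesimals (dim i) (U (Suc l) i) :: ('K, 'n) infinitesimal vec set)"
        using U_step[OF that] by (auto simp: infinitesimals_def)
      moreover have "l \<le> \<nu>" "Suc l \<le> \<nu>" using that by auto
      ultimately show ?thesis
        using D(4)[OF that] that(2) unfolding sp[OF \<open>l \<le> \<nu>\<close> that(2)] sp[OF \<open>Suc l \<le> \<nu>\<close> that(2)]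
        by blast
    qed
    fix l \<alpha> z assume l: "l \<le> \<nu>" and \<alpha>: "\<alpha> \<in> arcs Q" and z: "z \<in> Fl_map \<psi> Q \<nu> d Z l (tail Q \<alpha>)"
    note A = MK_carrier[OF \<alpha>]
    have tail: "tail Q \<alpha> \<in> verts Q" and head: "head Q \<alpha> \<in> verts Q" using \<alpha> by auto
    from z obtain x y where x: "x \<in> Z l (tail Q \<alpha>)"
      and y: "y \<in> infinitesimals (dim (tail Q \<alpha>)) (U l (tail Q \<alpha>))" and eq: "z = map_vec \<psi> x + y"
      unfolding sp[OF l tail] by blast
    have xc: "x \<in> carrier_vec (dim (tail Q \<alpha>))"
      using submod_carrier[OF flat_liftD(1)[OF D(2)[OF l tail]] x] .
    have yc: "y \<in> carrier_vec (dim (tail Q \<alpha>))" using y by (simp add: infinitesimals_def)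
    have m: "map_mat \<psi> (map_mat eps_const (MK \<alpha>)) = map_mat eps_const (MK \<alpha>)"
      using c by (intro eq_matI) auto
    have Ac: "map_mat eps_const (MK \<alpha>) \<in> carrier_mat (dim (head Q \<alpha>)) (dim (tail Q \<alpha>))"
      using A by simp
    have "map_mat eps_const (MK \<alpha>) *\<^sub>v z =
        map_mat eps_const (MK \<alpha>) *\<^sub>v map_vec \<psi> x + map_mat eps_const (MK \<alpha>) *\<^sub>v y"
      unfolding eq using xc yc by (intro mult_add_distrib_mat_vec[OF Ac]) auto
    also have "map_mat eps_const (MK \<alpha>) *\<^sub>v map_vec \<psi> x = map_vec \<psi> (map_mat eps_const (MK \<alpha>) *\<^sub>v x)"
      using \<psi>.mult_mat_vec_hom[OF Ac xc] m by simp
    finally show "map_mat eps_const (MK \<alpha>) *\<^sub>v z \<in> Fl_map \<psi> Q \<nu> d Z l (head Q \<alpha>)"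
      unfolding sp[OF l head] using D(3)[OF l \<alpha> x] infinitesimals_arrow[OF l \<alpha> y] by blast
  qed (rule Fl_map_extensional)
qed

lemma flag_lift_zero: "flag_lift (Fl_map eps_const Q \<nu> d U :: nat \<Rightarrow> 'v \<Rightarrow> ('K, 'n::finite) infinitesimal vec set)"
proof -
  have sp: "Fl_map eps_const Q \<nu> d U l i =
      ({z \<in> carrier_vec (dim i). std_vec z \<in> U l i \<and> (\<forall>m. eps_vec m z \<in> U l i)} ::
      ('K, 'n) infinitesimal vec set)"
    if "l \<le> \<nu>" "i \<in> verts Q" for l i
    unfolding Fl_map_apply[OF that] by (rule spanned_eps_const(1)[OF U_submod[OF that]])
  show ?thesis
    unfolding flag_lift_def
  proof (intro conjI allI impI ballI)
    show "flat_lift (dim i) (U l i) (Fl_map eps_const Q \<nu> d U l i :: ('K, 'n) infinitesimal vec set)"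
      if "l \<le> \<nu>" "i \<in> verts Q" for l i
      unfolding sp[OF that] by (rule spanned_eps_const(2)[OF U_submod[OF that]])
    show "Fl_map eps_const Q \<nu> d U l i \<subseteq> (Fl_map eps_const Q \<nu> d U (Suc l) i :: ('K, 'n) infinitesimal vec set)"
      if "l < \<nu>" "i \<in> verts Q" for l i
      using sp[of l i] sp[of "Suc l" i] U_step[OF that] that by auto
    fix l \<alpha> and z :: "('K, 'n) infinitesimal vec"
    assume l: "l \<le> \<nu>" and \<alpha>: "\<alpha> \<in> arcs Q" and z: "z \<in> Fl_map eps_const Q \<nu> d U l (tail Q \<alpha>)"
    note A = MK_carrier[OF \<alpha>]
    have tail: "tail Q \<alpha> \<in> verts Q" and head: "head Q \<alpha> \<in> verts Q" using \<alpha> by auto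
    have zc: "z \<in> carrier_vec (dim (tail Q \<alpha>))" using z sp[OF l tail] by simp
    then have "dim_vec z = dim_col (MK \<alpha>)" using A by auto
    note [simp] = mult_mat_vec_eps_const[OF this]
    have "map_mat eps_const (MK \<alpha>) *\<^sub>v z \<in> carrier_vec (dim (head Q \<alpha>))"
      using A zc by (intro mult_mat_vec_carrier[of _ _ "dim (tail Q \<alpha>)"]) auto
    then show "map_mat eps_const (MK \<alpha>) *\<^sub>v z \<in> Fl_map eps_const Q \<nu> d U l (head Q \<alpha>)"
      using z U_arrow[OF l \<alpha>] unfolding sp[OF l head] sp[OF l tail] by simp
  qed (rule Fl_map_extensional)
qed

section \<open>The vector space structure on the tangent space\<close>

definition flag_fibre_product where
  "flag_fibre_product V W = (\<lambda>l\<in>{..\<nu>}. \<lambda>i\<in>verts Q. fibre_product (dim i) (V l i) (W l i))"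

lemma flag_lift_fibre_product:
  assumes V: "flag_lift V" and W: "flag_lift W"
  shows "flag_lift (flag_fibre_product V W)"
proof -
  note D = flag_liftD[OF V] and E = flag_liftD[OF W]
  show ?thesis
    unfolding flag_lift_def
  proof (intro conjI allI impI ballI)
    show "flag_fibre_product V W \<in> {..\<nu>} \<rightarrow>\<^sub>E verts Q \<rightarrow>\<^sub>E UNIV" by (auto simp: flag_fibre_product_def)
    show "flat_lift (dim i) (U l i) (flag_fibre_product V W l i)" if "l \<le> \<nu>" "i \<in> verts Q" for l i
      using fibre_product_flat_lift[OF D(2) E(2)] that by (simp add: flag_fibre_product_def)
    show "flag_fibre_product V W l i \<subseteq> flag_fibre_product V W (Suc l) i" if "l < \<nu>" "i \<in> verts Q" for l i
      using D(4)[OF that] E(4)[OF that] that by (auto simp: flag_fibre_product_def fibre_product_def)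
    fix l \<alpha> z assume l: "l \<le> \<nu>" and \<alpha>: "\<alpha> \<in> arcs Q" and z: "z \<in> flag_fibre_product V W l (tail Q \<alpha>)"
    have Ac: "map_mat eps_const (MK \<alpha>) \<in> carrier_mat (dim (head Q \<alpha>)) (dim (tail Q \<alpha>))"
      using MK_carrier[OF \<alpha>] by simp
    have zc: "z \<in> carrier_vec (dim (tail Q \<alpha>))"
      using z l \<alpha> by (simp add: flag_fibre_product_def fibre_product_def)
    have "map_vec (eps_proj b) (map_mat eps_const (MK \<alpha>) *\<^sub>v z) =
      map_mat eps_const (MK \<alpha>) *\<^sub>v map_vec (eps_proj b) z" for b
    proof -
      interpret p: comm_ring_hom "eps_proj b :: ('K, bool) infinitesimal \<Rightarrow> _"
        by (rule conjunct1[OF eps_proj_hom[unfolded infinitesimal_hom_def]])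
      have "map_mat (eps_proj b) (map_mat eps_const (MK \<alpha>)) = map_mat eps_const (MK \<alpha>)"
        by (intro eq_matI) (auto simp: infinitesimal_eq_iff eps_proj_def)
      then show ?thesis using p.mult_mat_vec_hom[OF Ac zc] by simp
    qed
    then show "map_mat eps_const (MK \<alpha>) *\<^sub>v z \<in> flag_fibre_product V W l (head Q \<alpha>)"
      using z l \<alpha> D(3)[OF l \<alpha>] E(3)[OF l \<alpha>] mult_mat_vec_carrier[OF Ac zc]
      by (simp add: flag_fibre_product_def fibre_product_def)
  qed
qed

text \<open>
  The fibre product is the unique point that the definition of the sum refers to.
\<close>

lemma tangent_add:
  assumes V: "flag_lift V" and W: "flag_lift W"
  shows "V \<oplus>\<^bsub>T\<^esub> W = Fl_map eps_fold Q \<nu> d (flag_fibre_product V W)"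
proof -
  note D = flag_liftD[OF V] and E = flag_liftD[OF W]
  let ?P = "flag_fibre_product V W"
  have "(THE Z. Z \<in> Fl (eps_const \<circ> \<phi>) Q \<nu> d M \<and>
      Fl_map (eps_proj True) Q \<nu> d Z = V \<and> Fl_map (eps_proj False) Q \<nu> d Z = W) = ?P"
  proof (rule the_equality, intro conjI)
    show "?P \<in> Fl (eps_const \<circ> \<phi>) Q \<nu> d M"
      using flag_lift_fibre_product[OF V W] flag_lift_iff_Fl by blast
    show "Fl_map (eps_proj True) Q \<nu> d ?P = V"
      using spanned_id[OF flat_liftD(1)[OF D(2)]]
      by (intro flag_eqI[OF Fl_map_extensional D(1)])
        (simp add: Fl_map_apply flag_fibre_product_def fibre_product_fst[OF D(2) E(2)])
    show "Fl_map (eps_proj False) Q \<nu> d ?P = W"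
      using spanned_id[OF flat_liftD(1)[OF E(2)]]
      by (intro flag_eqI[OF Fl_map_extensional E(1)])
        (simp add: Fl_map_apply flag_fibre_product_def fibre_product_snd[OF D(2) E(2)])
  next
    fix Z assume Z: "Z \<in> Fl (eps_const \<circ> \<phi>) Q \<nu> d M \<and>
      Fl_map (eps_proj True) Q \<nu> d Z = V \<and> Fl_map (eps_proj False) Q \<nu> d Z = W"
    show "Z = ?P"
    proof (rule flag_eqI)
      show "Z \<in> {..\<nu>} \<rightarrow>\<^sub>E verts Q \<rightarrow>\<^sub>E UNIV" using Z by (simp add: Fl_def)
      show "?P \<in> {..\<nu>} \<rightarrow>\<^sub>E verts Q \<rightarrow>\<^sub>E UNIV" by (auto simp: flag_fibre_product_def)
      fix l i assume l: "l \<le> \<nu>" and i: "i \<in> verts Q"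
      have s: "spanned (dim i) (map_vec (eps_proj True) ` Z l i) = V l i"
        "spanned (dim i) (map_vec (eps_proj False) ` Z l i) = W l i"
        using Z Fl_map_apply[OF l i, of _ d Z] by auto
      have "direct_summand (dim i) (Z l i)" using Z l i by (simp add: Fl_def)
      then have "flat_lift (dim i) (std_vec ` Z l i) (Z l i)" by (rule direct_summand_flat_lift)
      from fibre_product_unique[OF this s] show "Z l i = ?P l i"
        using l i by (simp add: flag_fibre_product_def)
    qed
  qed
  then show ?thesis by (simp add: tangent_space_def)
qed

lemma tangent_sel:
  "\<zero>\<^bsub>T\<^esub> = Fl_map eps_const Q \<nu> d U" "c \<odot>\<^bsub>T\<^esub> V = Fl_map (eps_scale c) Q \<nu> d V"
  by (simp_all add: tangent_space_def)

lemma tangent_closed: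
  "\<zero>\<^bsub>T\<^esub> \<in> carrier T"
  "V \<in> carrier T \<Longrightarrow> W \<in> carrier T \<Longrightarrow> V \<oplus>\<^bsub>T\<^esub> W \<in> carrier T"
  "V \<in> carrier T \<Longrightarrow> c \<odot>\<^bsub>T\<^esub> V \<in> carrier T"
  using flag_lift_zero flag_lift_Fl_map[OF eps_fold_hom flag_lift_fibre_product]
    flag_lift_Fl_map[OF eps_scale_hom]
  by (auto simp: tangent_carrier tangent_sel tangent_add)

lemma graph_tangent_add:
  assumes "V \<in> carrier T" "W \<in> carrier T" "l \<le> \<nu>" "i \<in> verts Q"
  shows "graph ((V \<oplus>\<^bsub>T\<^esub> W) l i) = {(u, v + w) |u v w. (u, v) \<in> graph (V l i) \<and> (u, w) \<in> graph (W l i)}"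
  using assms graph_eps_fold[OF flag_liftD(2) flag_liftD(2)]
  by (simp add: tangent_carrier tangent_add Fl_map_apply flag_fibre_product_def)

lemma graph_tangent_smult:
  assumes "V \<in> carrier T" "l \<le> \<nu>" "i \<in> verts Q"
  shows "graph ((c \<odot>\<^bsub>T\<^esub> V) l i) = {(u, c \<cdot>\<^sub>v v + w) |u v w. (u, v) \<in> graph (V l i) \<and> w \<in> U l i}"
  using assms graph_eps_scale[OF flag_liftD(2)]
  by (simp add: tangent_carrier tangent_sel Fl_map_apply)

lemma graph_tangent_zero:
  assumes "l \<le> \<nu>" "i \<in> verts Q" "u \<in> U l i"
  shows "(u, 0\<^sub>v (dim i)) \<in> graph (\<zero>\<^bsub>T\<^esub> l i)"
proof -
  note s = U_submod[OF assms(1,2)]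
  obtain z :: "('K, unit) infinitesimal vec"
    where z: "z \<in> carrier_vec (dim i)" "std_vec z = u" "eps_vec () z = 0\<^sub>v (dim i)"
    using dual_vec_exists[OF submod_carrier[OF s assms(3)] zero_carrier_vec] .
  have "z \<in> Fl_map eps_const Q \<nu> d U l i"
    unfolding Fl_map_apply[OF assms(1,2)] spanned_eps_const(1)[OF s]
    using z assms submod_zero[OF s] by simp
  from graphI[OF this] show ?thesis using z by (simp add: tangent_sel)
qed

lemma graph_arrow:
  assumes V: "flag_lift V" and l: "l \<le> \<nu>" and \<alpha>: "\<alpha> \<in> arcs Q" and uv: "(u, v) \<in> graph (V l (tail Q \<alpha>))"
  shows "(MK \<alpha> *\<^sub>v u, MK \<alpha> *\<^sub>v v) \<in> graph (V l (head Q \<alpha>))"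
proof -
  from uv obtain z where z: "z \<in> V l (tail Q \<alpha>)" "std_vec z = u" "eps_vec () z = v" by (rule graphE)
  have "z \<in> carrier_vec (dim (tail Q \<alpha>))"
    using submod_carrier[OF flat_liftD(1)[OF flag_liftD(2)[OF V l]] z(1)] \<alpha> by simp
  then have "dim_vec z = dim_col (MK \<alpha>)" using MK_carrier[OF \<alpha>] by auto
  from mult_mat_vec_eps_const[OF this] show ?thesis
    using graphI[OF flag_liftD(3)[OF V l \<alpha> z(1)]] z by simp
qed

end

section \<open>Transport of a vector space structure\<close>

text \<open>
  The axioms hold in \<open>V\<close> because both sides of each of them have the same image under the injective map \<open>f\<close>.
\<close>

lemma vectorspace_transport:
  assumes W: "vectorspace K W" and f: "bij_betw f (carrier V) (carrier W)"
    and closed: "\<zero>\<^bsub>V\<^esub> \<in> carrier V"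
      "\<And>x y. x \<in> carrier V \<Longrightarrow> y \<in> carrier V \<Longrightarrow> x \<oplus>\<^bsub>V\<^esub> y \<in> carrier V"
      "\<And>c x. c \<in> carrier K \<Longrightarrow> x \<in> carrier V \<Longrightarrow> c \<odot>\<^bsub>V\<^esub> x \<in> carrier V"
    and hom: "f \<zero>\<^bsub>V\<^esub> = \<zero>\<^bsub>W\<^esub>"
      "\<And>x y. x \<in> carrier V \<Longrightarrow> y \<in> carrier V \<Longrightarrow> f (x \<oplus>\<^bsub>V\<^esub> y) = f x \<oplus>\<^bsub>W\<^esub> f y"
      "\<And>c x. c \<in> carrier K \<Longrightarrow> x \<in> carrier V \<Longrightarrow> f (c \<odot>\<^bsub>V\<^esub> x) = c \<odot>\<^bsub>W\<^esub> f x"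
  shows "linear_map K V W f"
proof -
  interpret W: vectorspace K W by (rule W)
  have fW [simp]: "f x \<in> carrier W" if "x \<in> carrier V" for x
    using f that by (auto simp: bij_betw_def)
  have eqI: "x = y" if "f x = f y" "x \<in> carrier V" "y \<in> carrier V" for x y
    using f that by (auto simp: bij_betw_def inj_on_def)
  note [simp] = closed hom
  have "abelian_group V"
  proof (rule abelian_groupI)
    fix x assume x: "x \<in> carrier V"
    have "\<ominus>\<^bsub>W\<^esub> f x \<in> f ` carrier V" using f x by (simp add: bij_betw_def)
    then obtain y where y: "y \<in> carrier V" "f y = \<ominus>\<^bsub>W\<^esub> f x" by auto
    have "y \<oplus>\<^bsub>V\<^esub> x = \<zero>\<^bsub>V\<^esub>" by (rule eqI) (use x y in \<open>simp_all add: W.M.l_neg\<close>)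
    then show "\<exists>y\<in>carrier V. y \<oplus>\<^bsub>V\<^esub> x = \<zero>\<^bsub>V\<^esub>" using y by blast
    show "\<zero>\<^bsub>V\<^esub> \<oplus>\<^bsub>V\<^esub> x = x" by (rule eqI) (use x in simp_all)
    fix y assume y: "y \<in> carrier V"
    show "x \<oplus>\<^bsub>V\<^esub> y = y \<oplus>\<^bsub>V\<^esub> x" by (rule eqI) (use x y in \<open>simp_all add: W.M.a_comm\<close>)
    fix z assume z: "z \<in> carrier V"
    show "x \<oplus>\<^bsub>V\<^esub> y \<oplus>\<^bsub>V\<^esub> z = x \<oplus>\<^bsub>V\<^esub> (y \<oplus>\<^bsub>V\<^esub> z)"
      by (rule eqI) (use x y z in \<open>simp_all add: W.M.a_assoc\<close>)
  qed simp_all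
  then have "Module.module K V"
  proof (rule moduleI[OF W.R.is_cring])
    fix a b x assume a: "a \<in> carrier K" and b: "b \<in> carrier K" and x: "x \<in> carrier V"
    show "(a \<oplus>\<^bsub>K\<^esub> b) \<odot>\<^bsub>V\<^esub> x = a \<odot>\<^bsub>V\<^esub> x \<oplus>\<^bsub>V\<^esub> b \<odot>\<^bsub>V\<^esub> x"
      by (rule eqI) (use a b x in \<open>simp_all add: W.smult_l_distr\<close>)
    show "(a \<otimes>\<^bsub>K\<^esub> b) \<odot>\<^bsub>V\<^esub> x = a \<odot>\<^bsub>V\<^esub> (b \<odot>\<^bsub>V\<^esub> x)"
      by (rule eqI) (use a b x in \<open>simp_all add: W.smult_assoc1\<close>)
  next
    fix a x y assume a: "a \<in> carrier K" and x: "x \<in> carrier V" "y \<in> carrier V"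
    show "a \<odot>\<^bsub>V\<^esub> (x \<oplus>\<^bsub>V\<^esub> y) = a \<odot>\<^bsub>V\<^esub> x \<oplus>\<^bsub>V\<^esub> a \<odot>\<^bsub>V\<^esub> y"
      by (rule eqI) (use a x in \<open>simp_all add: W.smult_r_distr\<close>)
  next
    fix x assume x: "x \<in> carrier V"
    show "\<one>\<^bsub>K\<^esub> \<odot>\<^bsub>V\<^esub> x = x" by (rule eqI) (use x in simp_all)
  qed simp_all
  then have "vectorspace K V" by (intro vectorspace.intro W.field_axioms)
  then show ?thesis
    by (intro linear_map.intro mod_hom.intro mod_hom_axioms.intro)
      (auto simp: vectorspace.axioms W.module_axioms W.vectorspace_axioms LinearCombinations.module_hom_def)
qed

section \<open>Tangent vectors and homomorphisms\<close>

context flag_point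
begin

abbreviation N where "N \<equiv> flag_carrier Q \<nu> U"
abbreviation H where "H \<equiv> Hom_flag \<phi> Q \<nu> d M U"

lemma N_iff: "x \<in> N \<longleftrightarrow> x \<in> carrier const_mod \<and> (\<forall>l\<le>\<nu>. \<forall>i\<in>verts Q. x l i \<in> U l i)"
proof
  assume x: "x \<in> N"
  then have "x l i \<in> U l i" if "l \<le> \<nu>" "i \<in> verts Q" for l i
    using that by (auto simp: flag_carrier_def dest!: PiE_mem)
  moreover from this have "x l i \<in> carrier_vec (dim i)" if "l \<le> \<nu>" "i \<in> verts Q" for l i
    using that submod_carrier[OF U_submod] by blast
  ultimately show "x \<in> carrier const_mod \<and> (\<forall>l\<le>\<nu>. \<forall>i\<in>verts Q. x l i \<in> U l i)"
    using x by (auto simp: flag_carrier_def const_mod_sel PiE_iff)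
next
  assume "x \<in> carrier const_mod \<and> (\<forall>l\<le>\<nu>. \<forall>i\<in>verts Q. x l i \<in> U l i)"
  then show "x \<in> N" by (auto simp: flag_carrier_def const_mod_sel PiE_iff)
qed

lemma const_mod_mem: "x \<in> carrier const_mod \<Longrightarrow> l \<le> \<nu> \<Longrightarrow> i \<in> verts Q \<Longrightarrow> x l i \<in> carrier_vec (dim i)"
  by (auto simp: const_mod_sel PiE_iff)

lemma const_mod_eqI:
  assumes "x \<in> carrier const_mod" "y \<in> carrier const_mod"
    "\<And>l i. l \<le> \<nu> \<Longrightarrow> i \<in> verts Q \<Longrightarrow> x l i = y l i"
  shows "x = y"
proof (rule flag_eqI[of x _ _ UNIV y UNIV])
  show "x \<in> {..\<nu>} \<rightarrow>\<^sub>E verts Q \<rightarrow>\<^sub>E UNIV" "y \<in> {..\<nu>} \<rightarrow>\<^sub>E verts Q \<rightarrow>\<^sub>E UNIV"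
    using assms by (auto simp: const_mod_sel PiE_iff)
qed (rule assms)

lemma const_mod_closed:
  "x \<in> carrier const_mod \<Longrightarrow> y \<in> carrier const_mod \<Longrightarrow> x \<oplus>\<^bsub>const_mod\<^esub> y \<in> carrier const_mod"
  "x \<in> carrier const_mod \<Longrightarrow> kscale const_mod c x \<in> carrier const_mod"
  "\<zero>\<^bsub>const_mod\<^esub> \<in> carrier const_mod"
  by (auto simp: const_mod_sel PiE_iff)

lemma const_mod_apply [simp]:
  assumes "l \<le> \<nu>" "i \<in> verts Q"
  shows "(x \<oplus>\<^bsub>const_mod\<^esub> y) l i = x l i + y l i" "kscale const_mod c x l i = c \<cdot>\<^sub>v x l i"
    "\<zero>\<^bsub>const_mod\<^esub> l i = 0\<^sub>v (dim i)"
  using assms by (simp_all add: const_mod_sel)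

lemma N_closed:
  "x \<in> N \<Longrightarrow> y \<in> N \<Longrightarrow> x \<oplus>\<^bsub>const_mod\<^esub> y \<in> N"
  "x \<in> N \<Longrightarrow> kscale const_mod c x \<in> N"
  "\<zero>\<^bsub>const_mod\<^esub> \<in> N"
  using submod_add[OF U_submod] submod_smult[OF U_submod] submod_zero[OF U_submod] const_mod_closed
  by (auto simp: N_iff)

lemma const_mod_minus:
  assumes x: "x \<in> carrier const_mod"
  shows "\<ominus>\<^bsub>const_mod\<^esub> x = kscale const_mod (- 1) x"
proof -
  interpret abelian_group const_mod by (rule abelian_group_const_mod)
  have "x \<oplus>\<^bsub>const_mod\<^esub> kscale const_mod (- 1) x = \<zero>\<^bsub>const_mod\<^esub>"
    using x carrier_vecD[OF const_mod_mem[OF x]]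
    by (intro const_mod_eqI const_mod_closed) (auto intro!: eq_vecI)
  then show ?thesis using x const_mod_closed(2) by (metis minus_equality a_comm)
qed

lemma abelian_subgroup_N: "abelian_subgroup N const_mod"
proof (rule abelian_subgroupI3[OF additive_subgroupI abelian_group_const_mod])
  interpret abelian_group const_mod by (rule abelian_group_const_mod)
  show "subgroup N (add_monoid const_mod)"
  proof (rule group.subgroupI[OF a_group])
    show "N \<subseteq> carrier (add_monoid const_mod)" by (auto simp: N_iff)
    show "N \<noteq> {}" using N_closed(3) by auto
    show "inv\<^bsub>add_monoid const_mod\<^esub> x \<in> N" if "x \<in> N" for x
      using const_mod_minus[of x] N_closed(2)[OF that, of "- 1"] that by (simp add: a_inv_def N_iff)
  qed (use N_closed in auto)
qed

sublocale N: abelian_subgroup N const_mod by (rule abelian_subgroup_N)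

lemma coset_iff:
  assumes y: "y \<in> carrier const_mod"
  shows "z \<in> N +>\<^bsub>const_mod\<^esub> y \<longleftrightarrow>
    z \<in> carrier const_mod \<and> (\<forall>l\<le>\<nu>. \<forall>i\<in>verts Q. z l i - y l i \<in> U l i)"
proof (cases "z \<in> carrier const_mod")
  case True
  have "z l i + - 1 \<cdot>\<^sub>v y l i = z l i - y l i" if "l \<le> \<nu>" "i \<in> verts Q" for l i
    using const_mod_mem[OF y that] const_mod_mem[OF True that] by (intro eq_vecI) auto
  then show ?thesis
    using N.a_rcos_module[OF y True] True const_mod_closed y
    by (auto simp: const_mod_minus N_iff)
qed (use N.a_elemrcos_carrier[OF y] in blast)

lemma coset_eq:
  "y \<in> carrier const_mod \<Longrightarrow> z \<in> N +>\<^bsub>const_mod\<^esub> y \<Longrightarrow> N +>\<^bsub>const_mod\<^esub> z = N +>\<^bsub>const_mod\<^esub> y"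
  using N.a_repr_independence' by metis

lemma rcosets_eq: "a_rcosets\<^bsub>const_mod\<^esub> N = (\<lambda>y. N +>\<^bsub>const_mod\<^esub> y) ` carrier const_mod"
  by (auto simp: A_RCOSETS_def RCOSETS_def a_r_coset_def)

lemma rcoset_eq_of_mem:
  assumes "C \<in> a_rcosets\<^bsub>const_mod\<^esub> N" "y \<in> C"
  shows "y \<in> carrier const_mod" "C = N +>\<^bsub>const_mod\<^esub> y"
  using assms coset_eq coset_iff by (auto simp: rcosets_eq)

lemma H_carrier:
  "F \<in> carrier H \<longleftrightarrow> F \<in> extensional N \<and> (\<forall>x\<in>N. F x \<in> a_rcosets\<^bsub>const_mod\<^esub> N) \<and>
    (\<forall>x\<in>N. \<forall>x'\<in>N. F (x \<oplus>\<^bsub>const_mod\<^esub> x') = F x <+>\<^bsub>const_mod\<^esub> F x') \<and>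
    (\<forall>a\<in>carrier (Lambda TYPE('k) Q \<nu>). \<forall>x\<in>N.
      F (a \<odot>\<^bsub>const_mod\<^esub> x) = (\<Union>y\<in>F x. N +>\<^bsub>const_mod\<^esub> (a \<odot>\<^bsub>const_mod\<^esub> y))) \<and>
    (\<forall>c. \<forall>x\<in>N. F (kscale const_mod c x) = (\<Union>y\<in>F x. N +>\<^bsub>const_mod\<^esub> kscale const_mod c y))"
  by (auto simp: Hom_flag_def Let_def Hom_tensor_def LinearCombinations.module_hom_def quotient_module_def)

lemma H_D:
  assumes "F \<in> carrier H"
  shows H_extensional: "F \<in> extensional N"
    and H_rcoset: "x \<in> N \<Longrightarrow> F x \<in> a_rcosets\<^bsub>const_mod\<^esub> N"
    and H_add: "x \<in> N \<Longrightarrow> x' \<in> N \<Longrightarrow> F (x \<oplus>\<^bsub>const_mod\<^esub> x') = F x <+>\<^bsub>const_mod\<^esub> F x'"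
    and H_action: "a \<in> carrier (Lambda TYPE('k) Q \<nu>) \<Longrightarrow> x \<in> N \<Longrightarrow>
      F (a \<odot>\<^bsub>const_mod\<^esub> x) = (\<Union>y\<in>F x. N +>\<^bsub>const_mod\<^esub> (a \<odot>\<^bsub>const_mod\<^esub> y))"
    and H_kscale: "x \<in> N \<Longrightarrow>
      F (kscale const_mod c x) = (\<Union>y\<in>F x. N +>\<^bsub>const_mod\<^esub> kscale const_mod c y)"
proof -
  note F = assms[unfolded H_carrier]
  note F' = conjunct2[OF F] and F'' = conjunct2[OF conjunct2[OF conjunct2[OF F]]]
  show "F \<in> extensional N" by (rule conjunct1[OF F])
  show "x \<in> N \<Longrightarrow> F x \<in> a_rcosets\<^bsub>const_mod\<^esub> N" by (rule bspec[OF conjunct1[OF F']])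
  show "x \<in> N \<Longrightarrow> x' \<in> N \<Longrightarrow> F (x \<oplus>\<^bsub>const_mod\<^esub> x') = F x <+>\<^bsub>const_mod\<^esub> F x'"
    by (rule conjunct1[OF conjunct2[OF F'], rule_format])
  show "a \<in> carrier (Lambda TYPE('k) Q \<nu>) \<Longrightarrow> x \<in> N \<Longrightarrow>
      F (a \<odot>\<^bsub>const_mod\<^esub> x) = (\<Union>y\<in>F x. N +>\<^bsub>const_mod\<^esub> (a \<odot>\<^bsub>const_mod\<^esub> y))"
    by (rule conjunct1[OF F'', rule_format])
  show "x \<in> N \<Longrightarrow>
      F (kscale const_mod c x) = (\<Union>y\<in>F x. N +>\<^bsub>const_mod\<^esub> kscale const_mod c y)"
    by (rule conjunct2[OF F'', rule_format])
qed

lemma H_sel: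
  "\<zero>\<^bsub>H\<^esub> = (\<lambda>x\<in>N. N)"
  "F \<oplus>\<^bsub>H\<^esub> G = (\<lambda>x\<in>N. F x <+>\<^bsub>const_mod\<^esub> G x)"
  "c \<odot>\<^bsub>H\<^esub> F = (\<lambda>x\<in>N. \<Union>y\<in>F x. N +>\<^bsub>const_mod\<^esub> kscale const_mod c y)"
  by (simp_all add: Hom_flag_def Let_def Hom_tensor_def quotient_module_def)

lemma kscale_coset:
  assumes y: "y \<in> carrier const_mod"
  shows "(\<Union>z\<in>N +>\<^bsub>const_mod\<^esub> y. N +>\<^bsub>const_mod\<^esub> kscale const_mod c z) = N +>\<^bsub>const_mod\<^esub> kscale const_mod c y"
proof -
  have "N +>\<^bsub>const_mod\<^esub> kscale const_mod c z = N +>\<^bsub>const_mod\<^esub> kscale const_mod c y"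
    if z: "z \<in> N +>\<^bsub>const_mod\<^esub> y" for z
  proof (rule coset_eq)
    from z coset_iff[OF y] have zc: "z \<in> carrier const_mod"
      and d: "\<And>l i. l \<le> \<nu> \<Longrightarrow> i \<in> verts Q \<Longrightarrow> z l i - y l i \<in> U l i" by auto
    have "c \<cdot>\<^sub>v z l i - c \<cdot>\<^sub>v y l i = c \<cdot>\<^sub>v (z l i - y l i)" if "l \<le> \<nu>" "i \<in> verts Q" for l i
      using const_mod_mem[OF y that] const_mod_mem[OF zc that]
      by (intro eq_vecI) (auto simp: algebra_simps)
    then show "kscale const_mod c z \<in> N +>\<^bsub>const_mod\<^esub> kscale const_mod c y"
      using y zc d submod_smult[OF U_submod] by (auto simp: coset_iff const_mod_closed)
  qed (use y const_mod_closed in blast)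
  then show ?thesis using N.a_rcos_self[OF y] by blast
qed

definition tangent_hom :: "(nat \<Rightarrow> 'v \<Rightarrow> ('K, unit) infinitesimal vec set)
    \<Rightarrow> (nat \<Rightarrow> 'v \<Rightarrow> 'K vec) \<Rightarrow> (nat \<Rightarrow> 'v \<Rightarrow> 'K vec) set" where
  "tangent_hom V = (\<lambda>x\<in>N. {y \<in> carrier const_mod. \<forall>l\<le>\<nu>. \<forall>i\<in>verts Q. (x l i, y l i) \<in> graph (V l i)})"

lemma tangent_hom_iff:
  "x \<in> N \<Longrightarrow> y \<in> tangent_hom V x \<longleftrightarrow>
    y \<in> carrier const_mod \<and> (\<forall>l\<le>\<nu>. \<forall>i\<in>verts Q. (x l i, y l i) \<in> graph (V l i))"
  by (simp add: tangent_hom_def)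

lemma tangent_hom_nonempty:
  assumes V: "flag_lift V" and x: "x \<in> N"
  obtains y where "y \<in> tangent_hom V x"
proof -
  have "\<exists>v. (x l i, v) \<in> graph (V l i)" if "l \<le> \<nu>" "i \<in> verts Q" for l i
    using graph_total[OF flag_liftD(2)[OF V that]] x that by (simp add: N_iff)
  then obtain y where y: "(x l i, y l i) \<in> graph (V l i)" if "l \<le> \<nu>" "i \<in> verts Q" for l i
    by metis
  have "(\<lambda>l\<in>{..\<nu>}. \<lambda>i\<in>verts Q. y l i) \<in> tangent_hom V x"
    using y graph_carrier[OF flag_liftD(2)[OF V] y] by (auto simp: tangent_hom_iff[OF x] const_mod_sel)
  then show thesis by (rule that)
qed

text \<open>
  Two displacements of \<open>x\<close> along \<open>V\<close> differ by an element of \<open>U\<close> at every vertex. Hence equality of values of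
  homomorphisms follows from a single common element.
\<close>

lemma tangent_hom_coset:
  assumes V: "flag_lift V" and x: "x \<in> N" and y: "y \<in> tangent_hom V x"
  shows "tangent_hom V x = N +>\<^bsub>const_mod\<^esub> y"
proof -
  from y have yc: "y \<in> carrier const_mod"
    and g: "\<And>l i. l \<le> \<nu> \<Longrightarrow> i \<in> verts Q \<Longrightarrow> (x l i, y l i) \<in> graph (V l i)"
    by (simp_all add: tangent_hom_iff[OF x])
  have "(x l i, z l i) \<in> graph (V l i) \<longleftrightarrow> z l i - y l i \<in> U l i"
    if "z \<in> carrier const_mod" and l: "l \<le> \<nu>" "i \<in> verts Q" for z l i
  proof
    assume "z l i - y l i \<in> U l i"
    then have "(x l i, y l i + (z l i - y l i)) \<in> graph (V l i)"
      by (rule graph_shift[OF flag_liftD(2)[OF V l] g[OF l]])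
    moreover have "y l i + (z l i - y l i) = z l i"
      using const_mod_mem[OF yc l] const_mod_mem[OF that(1) l] by (intro eq_vecI) auto
    ultimately show "(x l i, z l i) \<in> graph (V l i)" by simp
  qed (rule graph_diff[OF flag_liftD(2)[OF V l] _ g[OF l]])
  then show ?thesis by (auto simp: tangent_hom_iff[OF x] coset_iff[OF yc])
qed

text \<open>
  The relation between \<open>m True\<close> and \<open>m False\<close> given by the graphs of \<open>V\<close> is preserved by the arrows of \<open>Q\<close>
  because \<open>V\<close> consists of subrepresentations, and grows with \<open>l\<close> because \<open>V\<close> is a flag.
\<close>

lemma tangent_hom_action:
  assumes V: "flag_lift V" and a: "a \<in> carrier (Lambda TYPE('k) Q \<nu>)" and x: "x \<in> N" and y: "y \<in> tangent_hom V x"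
  shows "a \<odot>\<^bsub>const_mod\<^esub> x \<in> N" "a \<odot>\<^bsub>const_mod\<^esub> y \<in> tangent_hom V (a \<odot>\<^bsub>const_mod\<^esub> x)"
proof -
  define P :: "nat \<Rightarrow> 'v \<Rightarrow> (bool \<Rightarrow> 'K vec) set"
    where "P l i = {m. (m True, m False) \<in> graph (V l i)}" for l i
  note fl = flag_liftD(2)[OF V]
  have inv: "(\<forall>j. a \<odot>\<^bsub>const_mod\<^esub> (if j then x else y) \<in> carrier const_mod) \<and>
    (\<forall>l\<le>\<nu>. \<forall>i\<in>verts Q. (\<lambda>j. (a \<odot>\<^bsub>const_mod\<^esub> (if j then x else y)) l i) \<in> P l i)"
  proof (rule const_mod_invariant[where P = P and x = "\<lambda>j. if j then x else y", OF _ _ _ _ _ _ a])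
    show "m j \<in> carrier_vec (dim i)" if "l \<le> \<nu>" "i \<in> verts Q" "m \<in> P l i" for l i m j
      using graph_carrier[OF fl[OF that(1,2)], of "m True" "m False"] that(3) by (cases j) (auto simp: P_def)
    show "(\<lambda>j. 0\<^sub>v (dim i)) \<in> P l i" if "l \<le> \<nu>" "i \<in> verts Q" for l i
      using graph_zero[OF fl[OF that]] submod_zero[OF U_submod[OF that]] by (simp add: P_def)
    show "(\<lambda>j. m j + m' j) \<in> P l i" if "l \<le> \<nu>" "i \<in> verts Q" "m \<in> P l i" "m' \<in> P l i" for l i m m'
      using graph_add[OF fl[OF that(1,2)]] that(3,4) by (simp add: P_def)
    show "(\<lambda>j. c \<cdot>\<^sub>v m j) \<in> P l i" if "l \<le> \<nu>" "i \<in> verts Q" "m \<in> P l i" for l i c m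
      using graph_smult[OF fl[OF that(1,2)]] that(3) by (simp add: P_def)
    show "(\<lambda>j. MK \<alpha> *\<^sub>v m j) \<in> P l (head Q \<alpha>)"
      if "l \<le> \<nu>" "\<alpha> \<in> arcs Q" "m \<in> P l (tail Q \<alpha>)" for l \<alpha> m
      using graph_arrow[OF V that(1,2)] that(3) by (simp add: P_def)
    show "P l i \<subseteq> P (Suc l) i" if "l < \<nu>" "i \<in> verts Q" for l i
      using flag_liftD(4)[OF V that] by (auto simp: P_def graph_def)
    show "(if j then x else y) \<in> carrier const_mod" for j
      using x y by (simp add: N_iff tangent_hom_iff)
    show "(\<lambda>j. (if j then x else y) l i) \<in> P l i" if "l \<le> \<nu>" "i \<in> verts Q" for l i
      using y that by (simp add: P_def tangent_hom_iff[OF x])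
  qed
  from conjunct1[OF inv, rule_format, of True] conjunct1[OF inv, rule_format, of False]
  have c: "a \<odot>\<^bsub>const_mod\<^esub> x \<in> carrier const_mod" "a \<odot>\<^bsub>const_mod\<^esub> y \<in> carrier const_mod"
    by simp_all
  from conjunct2[OF inv, rule_format]
  have g: "\<And>l i. l \<le> \<nu> \<Longrightarrow> i \<in> verts Q \<Longrightarrow>
      ((a \<odot>\<^bsub>const_mod\<^esub> x) l i, (a \<odot>\<^bsub>const_mod\<^esub> y) l i) \<in> graph (V l i)"
    by (simp add: P_def)
  show ax: "a \<odot>\<^bsub>const_mod\<^esub> x \<in> N" using c(1) graph_fst[OF fl g] by (simp add: N_iff)
  show "a \<odot>\<^bsub>const_mod\<^esub> y \<in> tangent_hom V (a \<odot>\<^bsub>const_mod\<^esub> x)" using c(2) g by (simp add: tangent_hom_iff[OF ax])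
qed

lemma N_action_closed:
  assumes "a \<in> carrier (Lambda TYPE('k) Q \<nu>)" "x \<in> N"
  shows "a \<odot>\<^bsub>const_mod\<^esub> x \<in> N"
  using tangent_hom_nonempty[OF flag_lift_zero assms(2)] tangent_hom_action(1)[OF flag_lift_zero assms] by blast

text \<open>
  The operations on a quotient module are unions over the representatives of a coset. It is enough to know
  where the operation \<open>g\<close> on representatives leads.
\<close>

lemma tangent_hom_UN:
  assumes V: "flag_lift V" and x: "x \<in> N" and W: "flag_lift W" and x': "x' \<in> N"
    and g: "\<And>y. y \<in> tangent_hom V x \<Longrightarrow> g y \<in> tangent_hom W x'"
  shows "tangent_hom W x' = (\<Union>y\<in>tangent_hom V x. N +>\<^bsub>const_mod\<^esub> g y)"
  using tangent_hom_nonempty[OF V x] tangent_hom_coset[OF W x' g] by blast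

lemma tangent_hom_add_mem:
  assumes V: "V \<in> carrier T" "W \<in> carrier T" and x: "x \<in> N" and y: "y \<in> tangent_hom V x" "z \<in> tangent_hom W x"
  shows "y \<oplus>\<^bsub>const_mod\<^esub> z \<in> tangent_hom (V \<oplus>\<^bsub>T\<^esub> W) x"
proof -
  have "(x l i, y l i + z l i) \<in> graph ((V \<oplus>\<^bsub>T\<^esub> W) l i)" if l: "l \<le> \<nu>" "i \<in> verts Q" for l i
  proof -
    have "(x l i, y l i) \<in> graph (V l i)" "(x l i, z l i) \<in> graph (W l i)"
      using y l by (auto simp: tangent_hom_iff[OF x])
    then show ?thesis unfolding graph_tangent_add[OF V l] by blast
  qed
  then show ?thesis using y const_mod_closed by (simp add: tangent_hom_iff[OF x])
qed

text \<open>
  Two cosets agree as soon as they share an element, so for each law it is enough to follow one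
  representative through both sides.
\<close>

lemma tangent_hom_in_H:
  assumes V: "flag_lift V"
  shows "tangent_hom V \<in> carrier H"
  unfolding H_carrier
proof (intro conjI ballI allI)
  show "tangent_hom V \<in> extensional N" by (simp add: tangent_hom_def)
  fix x assume x: "x \<in> N"
  note fl = flag_liftD(2)[OF V]
  obtain y where y: "y \<in> tangent_hom V x" using tangent_hom_nonempty[OF V x] .
  then have yc: "y \<in> carrier const_mod" by (simp add: tangent_hom_iff[OF x])
  show "tangent_hom V x \<in> a_rcosets\<^bsub>const_mod\<^esub> N"
    using tangent_hom_coset[OF V x y] yc by (simp add: rcosets_eq)
  show "tangent_hom V (x \<oplus>\<^bsub>const_mod\<^esub> x') = tangent_hom V x <+>\<^bsub>const_mod\<^esub> tangent_hom V x'" if x': "x' \<in> N" for x'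
  proof -
    obtain y' where y': "y' \<in> tangent_hom V x'" using tangent_hom_nonempty[OF V x'] .
    then have y'c: "y' \<in> carrier const_mod" by (simp add: tangent_hom_iff[OF x'])
    have "y \<oplus>\<^bsub>const_mod\<^esub> y' \<in> tangent_hom V (x \<oplus>\<^bsub>const_mod\<^esub> x')"
      using y y' graph_add[OF fl] const_mod_closed
      by (simp add: tangent_hom_iff[OF x] tangent_hom_iff[OF x'] tangent_hom_iff[OF N_closed(1)[OF x x']])
    then show ?thesis
      using tangent_hom_coset[OF V] N_closed(1)[OF x x'] x x' y y' N.a_rcos_sum[OF yc y'c] by simp
  qed
  show "tangent_hom V (a \<odot>\<^bsub>const_mod\<^esub> x) = (\<Union>y\<in>tangent_hom V x. N +>\<^bsub>const_mod\<^esub> (a \<odot>\<^bsub>const_mod\<^esub> y))"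
    if a: "a \<in> carrier (Lambda TYPE('k) Q \<nu>)" for a
    by (rule tangent_hom_UN[OF V x V]) (rule tangent_hom_action[OF V a x y] tangent_hom_action(2)[OF V a x], assumption?)+
  show "tangent_hom V (kscale const_mod c x) = (\<Union>y\<in>tangent_hom V x. N +>\<^bsub>const_mod\<^esub> kscale const_mod c y)" for c
  proof (rule tangent_hom_UN[OF V x V N_closed(2)[OF x]])
    fix y assume "y \<in> tangent_hom V x"
    then show "kscale const_mod c y \<in> tangent_hom V (kscale const_mod c x)"
      using graph_smult[OF fl] const_mod_closed by (simp add: tangent_hom_iff[OF x] tangent_hom_iff[OF N_closed(2)[OF x]])
  qed
qed

lemma tangent_hom_add:
  assumes V: "V \<in> carrier T" "W \<in> carrier T"
  shows "tangent_hom (V \<oplus>\<^bsub>T\<^esub> W) = tangent_hom V \<oplus>\<^bsub>H\<^esub> tangent_hom W"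
proof (rule extensionalityI[of _ N])
  fix x assume x: "x \<in> N"
  have fl: "flag_lift V" "flag_lift W" "flag_lift (V \<oplus>\<^bsub>T\<^esub> W)"
    using V tangent_closed(2)[OF V] by (auto simp: tangent_carrier)
  obtain y where y: "y \<in> tangent_hom V x" using tangent_hom_nonempty[OF fl(1) x] .
  obtain z where z: "z \<in> tangent_hom W x" using tangent_hom_nonempty[OF fl(2) x] .
  have c: "y \<in> carrier const_mod" "z \<in> carrier const_mod" using y z by (auto simp: tangent_hom_iff[OF x])
  show "tangent_hom (V \<oplus>\<^bsub>T\<^esub> W) x = (tangent_hom V \<oplus>\<^bsub>H\<^esub> tangent_hom W) x"
    using tangent_hom_coset[OF fl(3) x tangent_hom_add_mem[OF V x y z]] tangent_hom_coset[OF fl(1) x y]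
      tangent_hom_coset[OF fl(2) x z] N.a_rcos_sum[OF c] x by (simp add: H_sel)
qed (auto simp: tangent_hom_def H_sel)

lemma tangent_hom_smult:
  assumes V: "V \<in> carrier T"
  shows "tangent_hom (c \<odot>\<^bsub>T\<^esub> V) = c \<odot>\<^bsub>H\<^esub> tangent_hom V"
proof (rule extensionalityI[of _ N])
  fix x assume x: "x \<in> N"
  have fl: "flag_lift V" "flag_lift (c \<odot>\<^bsub>T\<^esub> V)"
    using V tangent_closed(3)[OF V] by (auto simp: tangent_carrier)
  have "kscale const_mod c y \<in> tangent_hom (c \<odot>\<^bsub>T\<^esub> V) x" if y: "y \<in> tangent_hom V x" for y
  proof -
    have "(x l i, c \<cdot>\<^sub>v y l i) \<in> graph ((c \<odot>\<^bsub>T\<^esub> V) l i)" if l: "l \<le> \<nu>" "i \<in> verts Q" for l i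
    proof -
      have "c \<cdot>\<^sub>v y l i = c \<cdot>\<^sub>v y l i + 0\<^sub>v (dim i)"
        using const_mod_mem[of y l i] y l by (simp add: tangent_hom_iff[OF x])
      then show ?thesis
        unfolding graph_tangent_smult[OF V l] using y l submod_zero[OF U_submod[OF l]]
        by (auto simp: tangent_hom_iff[OF x])
    qed
    then show ?thesis using y const_mod_closed by (simp add: tangent_hom_iff[OF x])
  qed
  from tangent_hom_UN[OF fl(1) x fl(2) x this]
  show "tangent_hom (c \<odot>\<^bsub>T\<^esub> V) x = (c \<odot>\<^bsub>H\<^esub> tangent_hom V) x" using x by (simp add: H_sel)
qed (auto simp: tangent_hom_def H_sel)

lemma tangent_hom_zero: "tangent_hom \<zero>\<^bsub>T\<^esub> = \<zero>\<^bsub>H\<^esub>"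
proof (rule extensionalityI[of _ N])
  fix x assume x: "x \<in> N"
  have fl: "flag_lift \<zero>\<^bsub>T\<^esub>" using tangent_closed(1) by (simp add: tangent_carrier)
  have "\<zero>\<^bsub>const_mod\<^esub> \<in> tangent_hom \<zero>\<^bsub>T\<^esub> x"
    using x const_mod_closed graph_tangent_zero by (simp add: tangent_hom_iff N_iff)
  from tangent_hom_coset[OF fl x this] show "tangent_hom \<zero>\<^bsub>T\<^esub> x = \<zero>\<^bsub>H\<^esub> x"
    using x N.a_rcos_const[OF N_closed(3)] by (simp add: H_sel)
qed (auto simp: tangent_hom_def H_sel)

definition single :: "nat \<Rightarrow> 'v \<Rightarrow> 'K vec \<Rightarrow> nat \<Rightarrow> 'v \<Rightarrow> 'K vec" where
  "single l i v = (\<lambda>l'\<in>{..\<nu>}. \<lambda>i'\<in>verts Q. if l' = l \<and> i' = i then v else 0\<^sub>v (dim i'))"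

lemma single_apply:
  "l' \<le> \<nu> \<Longrightarrow> i' \<in> verts Q \<Longrightarrow> single l i v l' i' = (if l' = l \<and> i' = i then v else 0\<^sub>v (dim i'))"
  by (simp add: single_def)

lemma single_carrier: "v \<in> carrier_vec (dim i) \<Longrightarrow> single l i v \<in> carrier const_mod"
  by (auto simp: single_def const_mod_sel)

lemma single_N:
  assumes "l \<le> \<nu>" "i \<in> verts Q" "v \<in> U l i"
  shows "single l i v \<in> N"
  unfolding N_iff
proof (intro conjI allI impI ballI)
  show "single l i v \<in> carrier const_mod"
    by (rule single_carrier[OF submod_carrier[OF U_submod[OF assms(1,2)] assms(3)]])
  show "single l i v l' i' \<in> U l' i'" if "l' \<le> \<nu>" "i' \<in> verts Q" for l' i'
    using submod_zero[OF U_submod[OF that]] assms(3) by (simp add: single_apply[OF that])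
qed

text \<open>
  A pair in the graph at one vertex is extended by \<open>0\<close> at all other vertices. So \<open>tangent_hom V\<close> determines
  the graphs of \<open>V\<close>, hence \<open>V\<close>.
\<close>

lemma graph_tangent_hom:
  assumes V: "flag_lift V" and l: "l \<le> \<nu>" "i \<in> verts Q"
  shows "graph (V l i) = {(x l i, y l i) |x y. x \<in> N \<and> y \<in> tangent_hom V x}"
proof (intro equalityI subsetI)
  fix p assume "p \<in> graph (V l i)"
  then obtain u v where p: "p = (u, v)" "(u, v) \<in> graph (V l i)" by (cases p) auto
  note fl = flag_liftD(2)[OF V]
  have u: "u \<in> U l i" and v: "v \<in> carrier_vec (dim i)"
    using graph_fst[OF fl[OF l] p(2)] graph_carrier[OF fl[OF l] p(2)] by auto
  have "(0\<^sub>v (dim i'), 0\<^sub>v (dim i')) \<in> graph (V l' i')" if "l' \<le> \<nu>" "i' \<in> verts Q" for l' i'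
    using graph_zero[OF fl[OF that]] submod_zero[OF U_submod[OF that]] by simp
  then have "single l i v \<in> tangent_hom V (single l i u)"
    using p(2) single_carrier[OF v] by (auto simp: tangent_hom_iff[OF single_N[OF l u]] single_apply)
  moreover have "p = (single l i u l i, single l i v l i)" using p l by (simp add: single_apply)
  ultimately show "p \<in> {(x l i, y l i) |x y. x \<in> N \<and> y \<in> tangent_hom V x}"
    using single_N[OF l u] by blast
qed (use l in \<open>auto simp: tangent_hom_iff\<close>)

lemma tangent_hom_inj: "inj_on tangent_hom (carrier T)"
proof (rule inj_onI)
  fix V W assume VW: "V \<in> carrier T" "W \<in> carrier T" and eq: "tangent_hom V = tangent_hom W"
  then have V: "flag_lift V" and W: "flag_lift W" by (auto simp: tangent_carrier)
  show "V = W"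
    using graph_tangent_hom[OF V] graph_tangent_hom[OF W] eq
    by (intro flag_eqI[OF flag_liftD(1)[OF V] flag_liftD(1)[OF W]]
        flat_lift_eqI[OF flag_liftD(2)[OF V] flag_liftD(2)[OF W]]) simp_all
qed

lemma pathI: "pre_digraph.awalk G u p v \<Longrightarrow> (u, p) \<in> paths G"
  by (auto simp: paths_def)

text \<open>
  The vertex idempotents, the arrows of \<open>Q\<close> and the arrows of the linear quiver, which recover from a
  \<open>\<Lambda>\<close>-homomorphism its components at the vertices and their compatibility.
\<close>

lemma path_element_single:
  assumes x: "x \<in> carrier const_mod" and l: "l \<le> \<nu>"
  shows
    "i \<in> verts Q \<Longrightarrow> path_element (l, []) (i, []) \<in> carrier (Lambda TYPE('k) Q \<nu>)"
    "i \<in> verts Q \<Longrightarrow> l' \<le> \<nu> \<Longrightarrow> i' \<in> verts Q \<Longrightarrow>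
      (path_element (l, []) (i, []) \<odot>\<^bsub>const_mod\<^esub> x) l' i' = single l i (x l i) l' i'"
    "\<alpha> \<in> arcs Q \<Longrightarrow> path_element (l, []) (tail Q \<alpha>, [\<alpha>]) \<in> carrier (Lambda TYPE('k) Q \<nu>)"
    "\<alpha> \<in> arcs Q \<Longrightarrow>
      (path_element (l, []) (tail Q \<alpha>, [\<alpha>]) \<odot>\<^bsub>const_mod\<^esub> x) l (head Q \<alpha>) = MK \<alpha> *\<^sub>v x l (tail Q \<alpha>)"
    "i \<in> verts Q \<Longrightarrow> l < \<nu> \<Longrightarrow> path_element (l, [l]) (i, []) \<in> carrier (Lambda TYPE('k) Q \<nu>)"
    "i \<in> verts Q \<Longrightarrow> l < \<nu> \<Longrightarrow> (path_element (l, [l]) (i, []) \<odot>\<^bsub>const_mod\<^esub> x) (Suc l) i = x l i"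
proof -
  have p: "(l, []) \<in> paths (linear_quiver \<nu>)" "l < \<nu> \<Longrightarrow> (l, [l]) \<in> paths (linear_quiver \<nu>)"
    using l pathI[of "linear_quiver \<nu>" l "[]" l] pathI[of "linear_quiver \<nu>" l "[l]" "Suc l"]
    by (simp_all add: awalk_Nil awalk_Cons[OF wf_linear_quiver])
  have q: "(i, []) \<in> paths Q" if "i \<in> verts Q" for i
    using that pathI[of Q i "[]" i] by (simp add: awalk_Nil)
  have q': "(tail Q \<alpha>, [\<alpha>]) \<in> paths Q" if "\<alpha> \<in> arcs Q" for \<alpha>
    using that pathI[of Q "tail Q \<alpha>" "[\<alpha>]" "head Q \<alpha>"]
    by (simp add: awalk_Nil awalk_Cons[OF wf_digraph])
  note act = path_element_action[OF _ _ x]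
  show "i \<in> verts Q \<Longrightarrow> path_element (l, []) (i, []) \<in> carrier (Lambda TYPE('k) Q \<nu>)"
    "\<alpha> \<in> arcs Q \<Longrightarrow> path_element (l, []) (tail Q \<alpha>, [\<alpha>]) \<in> carrier (Lambda TYPE('k) Q \<nu>)"
    "i \<in> verts Q \<Longrightarrow> l < \<nu> \<Longrightarrow> path_element (l, [l]) (i, []) \<in> carrier (Lambda TYPE('k) Q \<nu>)"
    by (simp_all add: path_element_Lambda p q q')
  show "(path_element (l, []) (i, []) \<odot>\<^bsub>const_mod\<^esub> x) l' i' = single l i (x l i) l' i'"
    if "i \<in> verts Q" "l' \<le> \<nu>" "i' \<in> verts Q"
    unfolding act[OF p(1) q[OF that(1)] that(2,3)] using that l
    by (auto simp: awalk_Nil single_apply)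
  show "(path_element (l, []) (tail Q \<alpha>, [\<alpha>]) \<odot>\<^bsub>const_mod\<^esub> x) l (head Q \<alpha>) = MK \<alpha> *\<^sub>v x l (tail Q \<alpha>)"
    if "\<alpha> \<in> arcs Q"
    using act[OF p(1) q'[OF that] l, of "head Q \<alpha>"] that l
    by (simp add: awalk_Nil awalk_Cons[OF wf_digraph])
  show "(path_element (l, [l]) (i, []) \<odot>\<^bsub>const_mod\<^esub> x) (Suc l) i = x l i" if "i \<in> verts Q" "l < \<nu>"
    using act[OF p(2) q[OF that(1)], of "Suc l" i] that
    by (simp add: awalk_Nil awalk_Cons[OF wf_linear_quiver])
qed

text \<open>
  A homomorphism \<open>F\<close> is used through the relation \<open>y \<in> F x\<close>: it is a submodule of the product of the flag
  module with the constant module. It relates \<open>0\<close> exactly to the flag module because \<open>F 0\<close> is a coset that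
  contains \<open>0 \<cdot> y = 0\<close> for some \<open>y\<close>.
\<close>

lemma H_relation:
  assumes F: "F \<in> carrier H"
  defines "R \<equiv> {(x, y). x \<in> N \<and> y \<in> F x}"
  shows "\<And>x. x \<in> N \<Longrightarrow> \<exists>y. (x, y) \<in> R"
    "\<And>x y. (x, y) \<in> R \<Longrightarrow> x \<in> N \<and> y \<in> carrier const_mod \<and> F x = N +>\<^bsub>const_mod\<^esub> y"
    "\<And>x y x' y'. (x, y) \<in> R \<Longrightarrow> (x', y') \<in> R \<Longrightarrow> (x \<oplus>\<^bsub>const_mod\<^esub> x', y \<oplus>\<^bsub>const_mod\<^esub> y') \<in> R"
    "\<And>c x y. (x, y) \<in> R \<Longrightarrow> (kscale const_mod c x, kscale const_mod c y) \<in> R"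
    "\<And>a x y. a \<in> carrier (Lambda TYPE('k) Q \<nu>) \<Longrightarrow> (x, y) \<in> R \<Longrightarrow> a \<odot>\<^bsub>const_mod\<^esub> x \<in> N \<Longrightarrow>
      a \<odot>\<^bsub>const_mod\<^esub> y \<in> carrier const_mod \<Longrightarrow> (a \<odot>\<^bsub>const_mod\<^esub> x, a \<odot>\<^bsub>const_mod\<^esub> y) \<in> R"
    "\<And>y. (\<zero>\<^bsub>const_mod\<^esub>, y) \<in> R \<longleftrightarrow> y \<in> N"
proof -
  note cos = H_rcoset[OF F]
  have ex: "\<exists>y\<in>carrier const_mod. F x = N +>\<^bsub>const_mod\<^esub> y" if "x \<in> N" for x
    using cos[OF that] by (auto simp: rcosets_eq)
  show total: "\<exists>y. (x, y) \<in> R" if x: "x \<in> N" for x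
  proof -
    from ex[OF x] obtain y where "y \<in> carrier const_mod" "F x = N +>\<^bsub>const_mod\<^esub> y" ..
    then have "y \<in> F x" using N.a_rcos_self by simp
    then show ?thesis using x by (auto simp: R_def)
  qed
  show mem: "x \<in> N \<and> y \<in> carrier const_mod \<and> F x = N +>\<^bsub>const_mod\<^esub> y" if "(x, y) \<in> R" for x y
    using that rcoset_eq_of_mem[OF cos] by (auto simp: R_def)
  show "(x \<oplus>\<^bsub>const_mod\<^esub> x', y \<oplus>\<^bsub>const_mod\<^esub> y') \<in> R" if "(x, y) \<in> R" "(x', y') \<in> R" for x y x' y'
  proof -
    have "F (x \<oplus>\<^bsub>const_mod\<^esub> x') = N +>\<^bsub>const_mod\<^esub> (y \<oplus>\<^bsub>const_mod\<^esub> y')"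
      using H_add[OF F] mem[OF that(1)] mem[OF that(2)] N.a_rcos_sum by simp
    then show ?thesis
      using mem[OF that(1)] mem[OF that(2)] N_closed(1) const_mod_closed(1) N.a_rcos_self
      by (simp add: R_def)
  qed
  show sc: "(kscale const_mod c x, kscale const_mod c y) \<in> R" if "(x, y) \<in> R" for c x y
  proof -
    have "F (kscale const_mod c x) = N +>\<^bsub>const_mod\<^esub> kscale const_mod c y"
      using H_kscale[OF F] mem[OF that] kscale_coset by simp
    then show ?thesis
      using mem[OF that] N_closed(2) const_mod_closed(2) N.a_rcos_self by (simp add: R_def)
  qed
  show "(a \<odot>\<^bsub>const_mod\<^esub> x, a \<odot>\<^bsub>const_mod\<^esub> y) \<in> R"
    if a: "a \<in> carrier (Lambda TYPE('k) Q \<nu>)" and xy: "(x, y) \<in> R"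
      and c: "a \<odot>\<^bsub>const_mod\<^esub> x \<in> N" "a \<odot>\<^bsub>const_mod\<^esub> y \<in> carrier const_mod" for a x y
  proof -
    have "F (a \<odot>\<^bsub>const_mod\<^esub> x) = (\<Union>y\<in>F x. N +>\<^bsub>const_mod\<^esub> (a \<odot>\<^bsub>const_mod\<^esub> y))"
      using H_action[OF F a] xy by (simp add: R_def)
    then show ?thesis using xy c N.a_rcos_self[OF c(2)] by (auto simp: R_def)
  qed
  show "(\<zero>\<^bsub>const_mod\<^esub>, y) \<in> R \<longleftrightarrow> y \<in> N" for y
  proof -
    from total[OF N_closed(3)] obtain y0 where y0: "(\<zero>\<^bsub>const_mod\<^esub>, y0) \<in> R" ..
    have "kscale const_mod 0 z = \<zero>\<^bsub>const_mod\<^esub>" if z: "z \<in> carrier const_mod" for z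
      using carrier_vecD[OF const_mod_mem[OF z]] by (intro const_mod_eqI const_mod_closed z) (auto intro!: eq_vecI)
    then have "(\<zero>\<^bsub>const_mod\<^esub>, \<zero>\<^bsub>const_mod\<^esub>) \<in> R"
      using sc[OF y0, of 0] mem[OF y0] const_mod_closed(3) by simp
    then have "F \<zero>\<^bsub>const_mod\<^esub> = N" using mem N.a_rcos_const[OF N_closed(3)] by simp
    then show ?thesis using N_closed(3) by (simp add: R_def)
  qed
qed

text \<open>
  Let \<open>G l i\<close> be the projection to the vertex \<open>(l, i)\<close> of the relation \<open>y \<in> F x\<close>. Its indeterminacy is \<open>U l i\<close>: if
  \<open>x\<close> vanishes at \<open>(l, i)\<close>, the vertex idempotent \<open>?e\<close> annihilates \<open>x\<close>, so it maps \<open>y\<close> to a value at \<open>0\<close>, an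
  element of the flag module. Therefore the \<open>G l i\<close> are the graphs of flat lifts \<open>V l i\<close>. The remaining elements
  of \<open>\<Lambda>\<close> from \<open>path_element_single\<close> show that \<open>V\<close> is a flag of subrepresentations.
\<close>

lemma tangent_hom_surj:
  assumes F: "F \<in> carrier H"
  shows "\<exists>V. flag_lift V \<and> tangent_hom V = F"
proof -
  define R where "R = {(x, y). x \<in> N \<and> y \<in> F x}"
  note R = H_relation[OF F, folded R_def]
  define G where "G l i = {(x l i, y l i) |x y. (x, y) \<in> R}" for l i
  have G: "(x l i, y l i) \<in> G l i" if "(x, y) \<in> R" for x y l i using that by (auto simp: G_def)
  note act_closed' = const_mod_action_closed
  note act = R(5)[OF _ _ N_action_closed act_closed']
  have zero: "(0\<^sub>v (dim i), v) \<in> G l i \<longleftrightarrow> v \<in> U l i" if l: "l \<le> \<nu>" and i: "i \<in> verts Q" for l i v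
  proof
    assume "(0\<^sub>v (dim i), v) \<in> G l i"
    then obtain x y where xy: "(x, y) \<in> R" "x l i = 0\<^sub>v (dim i)" "y l i = v" by (auto simp: G_def)
    have c: "x \<in> N" "x \<in> carrier const_mod" "y \<in> carrier const_mod" using R(2)[OF xy(1)] by (auto simp: N_iff)
    let ?e = "path_element (l, []) (i, [])"
    note e = path_element_single(1,2)[OF _ l i]
    have eL: "?e \<in> carrier (Lambda TYPE('k) Q \<nu>)" using e(1)[OF c(2)] .
    have "?e \<odot>\<^bsub>const_mod\<^esub> x = \<zero>\<^bsub>const_mod\<^esub>"
      by (rule const_mod_eqI[OF act_closed'[OF eL c(2)] const_mod_closed(3)])
        (simp add: e(2)[OF c(2)] single_apply xy)
    then have "?e \<odot>\<^bsub>const_mod\<^esub> y \<in> N" using act[OF eL xy(1) eL c(1) eL c(3)] R(6) by simp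
    then have "(?e \<odot>\<^bsub>const_mod\<^esub> y) l i \<in> U l i" using l i by (simp add: N_iff)
    then show "v \<in> U l i" using e(2)[OF c(3) l i] xy(3) l i by (simp add: single_apply)
  next
    assume v: "v \<in> U l i"
    then have "(\<zero>\<^bsub>const_mod\<^esub>, single l i v) \<in> R" using R(6) single_N[OF l i] by simp
    from G[OF this, of l i] show "(0\<^sub>v (dim i), v) \<in> G l i" using l i by (simp add: single_apply)
  qed
  define V where "V = (\<lambda>l\<in>{..\<nu>}. \<lambda>i\<in>verts Q. {z \<in> carrier_vec (dim i). (std_vec z, eps_vec () z) \<in> G l i})"
  have fl: "flat_lift (dim i) (U l i) (V l i)" and gr: "graph (V l i) = G l i"
    if l: "l \<le> \<nu>" and i: "i \<in> verts Q" for l i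
  proof -
    have sub: "G l i \<subseteq> U l i \<times> carrier_vec (dim i)"
      using R(2) l i const_mod_mem by (fastforce simp: G_def N_iff)
    moreover have "u \<in> fst ` G l i" if u: "u \<in> U l i" for u
    proof -
      obtain y where "(single l i u, y) \<in> R" using R(1)[OF single_N[OF l i u]] by auto
      from G[OF this, of l i] show ?thesis using l i by (force simp: single_apply)
    qed
    ultimately have fst: "fst ` G l i = U l i" by auto
    have add: "(u + u', v + v') \<in> G l i" if "(u, v) \<in> G l i" "(u', v') \<in> G l i" for u v u' v'
    proof -
      from that obtain x y x' y' where xy: "(x, y) \<in> R" "(x', y') \<in> R" "u = x l i" "v = y l i"
        "u' = x' l i" "v' = y' l i" by (auto simp: G_def)
      from G[OF R(3)[OF xy(1,2)], of l i] show ?thesis using l i xy by simp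
    qed
    have smult: "(c \<cdot>\<^sub>v u, c \<cdot>\<^sub>v v) \<in> G l i" if "(u, v) \<in> G l i" for c u v
    proof -
      from that obtain x y where xy: "(x, y) \<in> R" "u = x l i" "v = y l i" by (auto simp: G_def)
      from G[OF R(4)[OF xy(1), of c], of l i] show ?thesis using l i xy by simp
    qed
    note f = flat_lift_of_graph[OF U_submod[OF l i] sub fst add smult zero[OF l i]]
    show "flat_lift (dim i) (U l i) (V l i)" using f(1) l i by (simp add: V_def)
    show "graph (V l i) = G l i" using f(2) l i by (simp add: V_def)
  qed
  have V: "flag_lift V"
    unfolding flag_lift_def
  proof (intro conjI allI impI ballI)
    show "V \<in> {..\<nu>} \<rightarrow>\<^sub>E verts Q \<rightarrow>\<^sub>E UNIV" by (auto simp: V_def)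
    show "flat_lift (dim i) (U l i) (V l i)" if "l \<le> \<nu>" "i \<in> verts Q" for l i using fl[OF that] .
    show "V l i \<subseteq> V (Suc l) i" if l: "l < \<nu>" and i: "i \<in> verts Q" for l i
    proof -
      have "G l i \<subseteq> G (Suc l) i"
      proof
        fix p assume "p \<in> G l i"
        then obtain x y where xy: "(x, y) \<in> R" "p = (x l i, y l i)" by (auto simp: G_def)
        have c: "x \<in> N" "x \<in> carrier const_mod" "y \<in> carrier const_mod" using R(2)[OF xy(1)] by (auto simp: N_iff)
        have l': "l \<le> \<nu>" using l by simp
        note e = path_element_single(5,6)[OF _ l' i l]
        note eL = e(1)[OF c(2)]
        from G[OF act[OF eL xy(1) eL c(1) eL c(3)], of "Suc l" i]
        show "p \<in> G (Suc l) i" using e(2)[OF c(2)] e(2)[OF c(3)] xy by simp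
      qed
      then show ?thesis using l i by (auto simp: V_def)
    qed
    fix l \<alpha> z assume l: "l \<le> \<nu>" and \<alpha>: "\<alpha> \<in> arcs Q" and z: "z \<in> V l (tail Q \<alpha>)"
    have zc: "z \<in> carrier_vec (dim (tail Q \<alpha>))" and zG: "(std_vec z, eps_vec () z) \<in> G l (tail Q \<alpha>)"
      using z l \<alpha> by (auto simp: V_def)
    from zG obtain x y where xy: "(x, y) \<in> R" "std_vec z = x l (tail Q \<alpha>)" "eps_vec () z = y l (tail Q \<alpha>)"
      by (auto simp: G_def)
    have c: "x \<in> N" "x \<in> carrier const_mod" "y \<in> carrier const_mod" using R(2)[OF xy(1)] by (auto simp: N_iff)
    note e = path_element_single(3,4)[OF _ l \<alpha>]
    note eL = e(1)[OF c(2)]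
    from G[OF act[OF eL xy(1) eL c(1) eL c(3)], of l "head Q \<alpha>"]
    have "(MK \<alpha> *\<^sub>v std_vec z, MK \<alpha> *\<^sub>v eps_vec () z) \<in> G l (head Q \<alpha>)"
      using e(2)[OF c(2)] e(2)[OF c(3)] xy by simp
    moreover have "dim_vec z = dim_col (MK \<alpha>)" using MK_carrier[OF \<alpha>] zc by auto
    moreover have "map_mat eps_const (MK \<alpha>) *\<^sub>v z \<in> carrier_vec (dim (head Q \<alpha>))"
      using MK_carrier[OF \<alpha>] zc by (intro mult_mat_vec_carrier[of _ _ "dim (tail Q \<alpha>)"]) auto
    ultimately show "map_mat eps_const (MK \<alpha>) *\<^sub>v z \<in> V l (head Q \<alpha>)"
      using l \<alpha> by (simp add: V_def)
  qed
  have "tangent_hom V = F"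
  proof (rule extensionalityI[of _ N])
    fix x assume x: "x \<in> N"
    then obtain y where y: "(x, y) \<in> R" using R(1) by blast
    then have "y \<in> tangent_hom V x" using R(2)[OF y] G[OF y] gr by (simp add: tangent_hom_iff[OF x])
    from tangent_hom_coset[OF V x this] show "tangent_hom V x = F x" using R(2)[OF y] by simp
  next
    show "F \<in> extensional N" by (rule H_extensional[OF F])
  qed (simp add: tangent_hom_def)
  with V show ?thesis by blast
qed

lemma tangent_hom_bij: "bij_betw tangent_hom (carrier T) (carrier H)"
  using tangent_hom_inj tangent_hom_in_H tangent_hom_surj by (auto simp: bij_betw_def tangent_carrier)

text \<open>
  Closure under the operations is inherited from the tangent space, as every element is of the form
  \<open>tangent_hom V\<close>. The axioms hold pointwise in the quotient module, where each value has a representative.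
\<close>

lemma vectorspace_H: "vectorspace class_ring H"
proof -
  have ex: "\<exists>V\<in>carrier T. F = tangent_hom V" if "F \<in> carrier H" for F
    using tangent_hom_surj[OF that] by (auto simp: tangent_carrier)
  have mem: "tangent_hom V \<in> carrier H" if "V \<in> carrier T" for V
    using that tangent_hom_in_H by (simp add: tangent_carrier)
  have add: "F \<oplus>\<^bsub>H\<^esub> G \<in> carrier H" if "F \<in> carrier H" "G \<in> carrier H" for F G
    using ex[OF that(1)] ex[OF that(2)] mem tangent_closed(2) by (auto simp flip: tangent_hom_add)
  have smult: "c \<odot>\<^bsub>H\<^esub> F \<in> carrier H" if "F \<in> carrier H" for c F
    using ex[OF that] mem tangent_closed(3) by (auto simp flip: tangent_hom_smult)
  have zero: "\<zero>\<^bsub>H\<^esub> \<in> carrier H" using mem tangent_closed(1) by (simp flip: tangent_hom_zero)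
  have rep: "\<exists>y\<in>carrier const_mod. F x = N +>\<^bsub>const_mod\<^esub> y" if "F \<in> carrier H" "x \<in> N" for F x
  proof -
    have "F x \<in> a_rcosets\<^bsub>const_mod\<^esub> N" using that by (rule H_rcoset)
    then show ?thesis by (auto simp: rcosets_eq)
  qed
  have eqI: "F = G" if "F \<in> carrier H" "G \<in> carrier H" "\<And>x. x \<in> N \<Longrightarrow> F x = G x" for F G
    using H_extensional[OF that(1)] H_extensional[OF that(2)] that(3) by (rule extensionalityI)
  have app: "(c \<odot>\<^bsub>H\<^esub> F) x = N +>\<^bsub>const_mod\<^esub> kscale const_mod c y"
      if "x \<in> N" "y \<in> carrier const_mod" "F x = N +>\<^bsub>const_mod\<^esub> y" for c F x y
    using that kscale_coset by (simp add: H_sel)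
  have app_add: "(F \<oplus>\<^bsub>H\<^esub> G) x = N +>\<^bsub>const_mod\<^esub> (y \<oplus>\<^bsub>const_mod\<^esub> z)"
      if "x \<in> N" "y \<in> carrier const_mod" "F x = N +>\<^bsub>const_mod\<^esub> y"
        "z \<in> carrier const_mod" "G x = N +>\<^bsub>const_mod\<^esub> z" for F G x y z
    using that N.a_rcos_sum by (simp add: H_sel)
  have vec: "kscale const_mod (a + b) y = kscale const_mod a y \<oplus>\<^bsub>const_mod\<^esub> kscale const_mod b y"
      "kscale const_mod (a * b) y = kscale const_mod a (kscale const_mod b y)"
      "kscale const_mod 1 y = y"
      "kscale const_mod (- 1) y \<oplus>\<^bsub>const_mod\<^esub> y = \<zero>\<^bsub>const_mod\<^esub>"
    if y: "y \<in> carrier const_mod" for a b y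
    using y carrier_vecD[OF const_mod_mem[OF y]]
    by (auto intro!: const_mod_eqI const_mod_closed eq_vecI simp: algebra_simps)
  have vec_add: "kscale const_mod a (y \<oplus>\<^bsub>const_mod\<^esub> z) = kscale const_mod a y \<oplus>\<^bsub>const_mod\<^esub> kscale const_mod a z"
    if y: "y \<in> carrier const_mod" "z \<in> carrier const_mod" for a y z
    using y carrier_vecD[OF const_mod_mem[OF y(1)]] carrier_vecD[OF const_mod_mem[OF y(2)]]
    by (auto intro!: const_mod_eqI const_mod_closed eq_vecI simp: algebra_simps)
  have "abelian_group H"
  proof (rule abelian_groupI[OF add zero])
    fix F assume F: "F \<in> carrier H"
    show "\<zero>\<^bsub>H\<^esub> \<oplus>\<^bsub>H\<^esub> F = F"
    proof (rule eqI[OF add[OF zero F] F])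
      fix x assume x: "x \<in> N"
      then show "(\<zero>\<^bsub>H\<^esub> \<oplus>\<^bsub>H\<^esub> F) x = F x" using N.rcosets_add_eq[OF H_rcoset[OF F x]] by (simp add: H_sel)
    qed
    \<comment> \<open>negatives are multiples by \<open>- 1\<close>, which are already known to be homomorphisms\<close>
    have "(- 1) \<odot>\<^bsub>H\<^esub> F \<oplus>\<^bsub>H\<^esub> F = \<zero>\<^bsub>H\<^esub>"
    proof (rule eqI[OF add[OF smult[OF F] F] zero])
      fix x assume x: "x \<in> N"
      from rep[OF F x] obtain y where "y \<in> carrier const_mod" "F x = N +>\<^bsub>const_mod\<^esub> y" by blast
      then show "((- 1) \<odot>\<^bsub>H\<^esub> F \<oplus>\<^bsub>H\<^esub> F) x = \<zero>\<^bsub>H\<^esub> x"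
        using x N.a_rcos_const[OF N_closed(3)] H_sel(1)
        by (simp add: app_add[of x _ "(- 1) \<odot>\<^bsub>H\<^esub> F" _ F, OF x const_mod_closed(2) app] const_mod_closed vec)
    qed
    then show "\<exists>G\<in>carrier H. G \<oplus>\<^bsub>H\<^esub> F = \<zero>\<^bsub>H\<^esub>" using smult[OF F] by blast
    fix G assume G: "G \<in> carrier H"
    show "F \<oplus>\<^bsub>H\<^esub> G = G \<oplus>\<^bsub>H\<^esub> F"
    proof (rule eqI[OF add[OF F G] add[OF G F]])
      fix x assume x: "x \<in> N"
      from rep[OF F x] obtain y where y: "y \<in> carrier const_mod" "F x = N +>\<^bsub>const_mod\<^esub> y" ..
      from rep[OF G x] obtain z where z: "z \<in> carrier const_mod" "G x = N +>\<^bsub>const_mod\<^esub> z" ..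
      show "(F \<oplus>\<^bsub>H\<^esub> G) x = (G \<oplus>\<^bsub>H\<^esub> F) x"
        unfolding app_add[of x y F z G, OF x y z] app_add[of x z G y F, OF x z y] N.a_comm[OF y(1) z(1)] ..
    qed
    fix E assume E: "E \<in> carrier H"
    show "F \<oplus>\<^bsub>H\<^esub> G \<oplus>\<^bsub>H\<^esub> E = F \<oplus>\<^bsub>H\<^esub> (G \<oplus>\<^bsub>H\<^esub> E)"
    proof (rule eqI[OF add[OF add[OF F G] E] add[OF F add[OF G E]]])
      fix x assume x: "x \<in> N"
      then show "(F \<oplus>\<^bsub>H\<^esub> G \<oplus>\<^bsub>H\<^esub> E) x = (F \<oplus>\<^bsub>H\<^esub> (G \<oplus>\<^bsub>H\<^esub> E)) x"
        using N.a_rcosets_assoc[OF H_rcoset[OF F x] H_rcoset[OF G x] H_rcoset[OF E x]] by (simp add: H_sel)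
    qed
  qed
  then have "Module.module class_ring H"
  proof (rule moduleI[OF class_cring.is_cring])
    fix a b :: 'K and F assume F: "F \<in> carrier H"
    show "a \<odot>\<^bsub>H\<^esub> F \<in> carrier H" by (rule smult[OF F])
    show "(a \<oplus>\<^bsub>class_ring\<^esub> b) \<odot>\<^bsub>H\<^esub> F = a \<odot>\<^bsub>H\<^esub> F \<oplus>\<^bsub>H\<^esub> b \<odot>\<^bsub>H\<^esub> F"
    proof (rule eqI[OF smult[OF F] add[OF smult[OF F] smult[OF F]]])
      fix x assume x: "x \<in> N"
      from rep[OF F x] obtain y where y: "y \<in> carrier const_mod" "F x = N +>\<^bsub>const_mod\<^esub> y" ..
      note c = const_mod_closed(2)[OF y(1)]
      show "((a \<oplus>\<^bsub>class_ring\<^esub> b) \<odot>\<^bsub>H\<^esub> F) x = (a \<odot>\<^bsub>H\<^esub> F \<oplus>\<^bsub>H\<^esub> b \<odot>\<^bsub>H\<^esub> F) x"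
        unfolding app[of x y F, OF x y]
          app_add[of x _ "a \<odot>\<^bsub>H\<^esub> F" _ "b \<odot>\<^bsub>H\<^esub> F", OF x c app[of x y F, OF x y] c app[of x y F, OF x y]] by (simp add: vec(1)[OF y(1)])
    qed
    show "(a \<otimes>\<^bsub>class_ring\<^esub> b) \<odot>\<^bsub>H\<^esub> F = a \<odot>\<^bsub>H\<^esub> (b \<odot>\<^bsub>H\<^esub> F)"
    proof (rule eqI[OF smult[OF F] smult[OF smult[OF F]]])
      fix x assume x: "x \<in> N"
      from rep[OF F x] obtain y where y: "y \<in> carrier const_mod" "F x = N +>\<^bsub>const_mod\<^esub> y" ..
      show "((a \<otimes>\<^bsub>class_ring\<^esub> b) \<odot>\<^bsub>H\<^esub> F) x = (a \<odot>\<^bsub>H\<^esub> (b \<odot>\<^bsub>H\<^esub> F)) x"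
        unfolding app[of x y F, OF x y]
          app[of x _ "b \<odot>\<^bsub>H\<^esub> F", OF x const_mod_closed(2)[OF y(1)] app[of x y F, OF x y]]
        by (simp add: vec(2)[OF y(1)])
    qed
    show "\<one>\<^bsub>class_ring\<^esub> \<odot>\<^bsub>H\<^esub> F = F"
    proof (rule eqI[OF smult[OF F] F])
      fix x assume x: "x \<in> N"
      from rep[OF F x] obtain y where y: "y \<in> carrier const_mod" "F x = N +>\<^bsub>const_mod\<^esub> y" ..
      show "(\<one>\<^bsub>class_ring\<^esub> \<odot>\<^bsub>H\<^esub> F) x = F x"
        unfolding app[of x y F, OF x y] y(2) by (simp add: vec(3)[OF y(1)])
    qed
    fix G assume G: "G \<in> carrier H"
    show "a \<odot>\<^bsub>H\<^esub> (F \<oplus>\<^bsub>H\<^esub> G) = a \<odot>\<^bsub>H\<^esub> F \<oplus>\<^bsub>H\<^esub> a \<odot>\<^bsub>H\<^esub> G"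
    proof (rule eqI[OF smult[OF add[OF F G]] add[OF smult[OF F] smult[OF G]]])
      fix x assume x: "x \<in> N"
      from rep[OF F x] obtain y where y: "y \<in> carrier const_mod" "F x = N +>\<^bsub>const_mod\<^esub> y" ..
      from rep[OF G x] obtain z where z: "z \<in> carrier const_mod" "G x = N +>\<^bsub>const_mod\<^esub> z" ..
      note c = const_mod_closed(2)[OF y(1)] const_mod_closed(2)[OF z(1)]
      show "(a \<odot>\<^bsub>H\<^esub> (F \<oplus>\<^bsub>H\<^esub> G)) x = (a \<odot>\<^bsub>H\<^esub> F \<oplus>\<^bsub>H\<^esub> a \<odot>\<^bsub>H\<^esub> G) x"
        unfolding app[of x _ "F \<oplus>\<^bsub>H\<^esub> G", OF x const_mod_closed(1)[OF y(1) z(1)] app_add[of x y F z G, OF x y z]]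
          app_add[of x _ "a \<odot>\<^bsub>H\<^esub> F" _ "a \<odot>\<^bsub>H\<^esub> G", OF x c(1) app[of x y F, OF x y] c(2) app[of x z G, OF x z]] vec_add[OF y(1) z(1)] ..
    qed
  qed
  then show ?thesis by (intro vectorspace.intro class_field)
qed

lemma tangent_hom_linear_map: "linear_map class_ring T H tangent_hom"
  using tangent_hom_add tangent_hom_smult tangent_hom_zero tangent_closed
  by (intro vectorspace_transport[OF vectorspace_H tangent_hom_bij]) auto

end

theorem lemma4p1:
  fixes Q :: "('v, 'a) pre_digraph"
    and \<phi> :: "'k::field \<Rightarrow> 'K::field"
    and \<nu> :: nat
    and d :: "nat \<Rightarrow> 'v \<Rightarrow> nat"
    and M :: "'a \<Rightarrow> 'k mat"
    and U :: "nat \<Rightarrow> 'v \<Rightarrow> 'K vec set"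
  assumes "fin_digraph Q"
    and "filtration Q \<nu> d"
    and "M \<in> Rep Q (d \<nu>)"
    and "field_hom \<phi>"
    and "U \<in> Fl \<phi> Q \<nu> d M"
  shows "\<exists>f. linear_map class_ring (tangent_space \<phi> Q \<nu> d M U) (Hom_flag \<phi> Q \<nu> d M U) f \<and>
             bij_betw f (carrier (tangent_space \<phi> Q \<nu> d M U)) (carrier (Hom_flag \<phi> Q \<nu> d M U))"
proof -
  interpret fin_digraph Q by (rule assms(1))
  interpret field_hom \<phi> by (rule assms(4))
  interpret flag_point Q \<phi> d M \<nu> U by unfold_locales (rule assms)+
  show ?thesis using tangent_hom_linear_map tangent_hom_bij by blast
qed

end
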